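(* Let $0 < \mu \leq 1$ and $0 < \epsilon \leq 1/2$. There is an algorithm that runs in time $O\left(nd\cdot 2^{\tilde{O}\left(\frac{k^2}{\mu\cdot\epsilon}\right)}\right)$ and gives a $(1+\epsilon)$-approximation to the $k$-median objective function with respect to a $\mu$-similar Bregman divergence $D_\phi$ on a domain $\mathbb{X}\subseteq\mathbb{R}^d$, for any point set $P\subseteq\mathbb{X}$ with $|P| = n$.
   Context: Let $\phi:\mathbb{X}\to\mathbb{R}$ be a continuously differentiable, strictly convex real-valued function on a closed convex set $\mathbb{X}\subseteq\mathbb{R}^d$. The Bregman divergence associated with $\phi$ is $D_\phi(p,q) = \phi(p) - \phi(q) - \nabla\phi(q)^T(p-q)$. For a symmetric positive definite matrix $U$, $D_U(p,q) = (p-q)^T U (p-q)$. $D_\phi$ is $\mu$-similar if there exists a symmetric positive definite matrix $U$ such that $\mu D_U(p,q)\le D_\phi(p,q)\le D_U(p,q)$ for all $p,q\in\mathbb{X}$. The $k$-median objective with respect to $D_\phi$ is $\Delta(P,C) = \sum_{p\in P}\min_{c\in C} D_\phi(p,c)$ for a set $C$ of $k$ centers; a $(1+\epsilon)$-approximation is a set $C$ of $k$ centers with cost at most $(1+\epsilon)$ times the minimum possible cost. The $\tilde{O}$ notation hides logarithmic factors in the exponent. The algorithm is randomized and its approximation guarantee holds with high probability. *)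

theory Defs
  imports
    "HOL-Analysis.Analysis"
    "HOL-Analysis.Finite_Function_Topology"
    "HOL-Probability.Probability_Mass_Function"
begin

section \<open>Euclidean spaces of varying dimension\<close>

text \<open>
  A single algorithm has to serve all dimensions, so the dimension cannot be a type. All spaces
  $R^d$ are therefore embedded in the finitely supported real sequences, as the subspaces
  \<open>Rspace d\<close>. The library norm on this type is the sum norm; on each finite-dimensional
  \<open>Rspace d\<close> it is equivalent to the Euclidean norm, so that closedness, continuity and
  differentiability have their usual meaning.
\<close>

type_synonym rvec = "nat \<Rightarrow>\<^sub>0 real"

definition Rspace :: "nat \<Rightarrow> rvec set" where
  "Rspace d = {x. \<forall>i\<ge>d. Poly_Mapping.lookup x i = 0}"

definition dot :: "nat \<Rightarrow> rvec \<Rightarrow> rvec \<Rightarrow> real" where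
  "dot d x y = (\<Sum>i<d. Poly_Mapping.lookup x i * Poly_Mapping.lookup y i)"

definition vec_of :: "nat \<Rightarrow> (nat \<Rightarrow> real) \<Rightarrow> rvec" where
  "vec_of d f = Abs_poly_mapping (\<lambda>j. if j < d then f j else 0)"


section \<open>Bregman divergences\<close>

definition strictly_convex_on :: "'a::real_vector set \<Rightarrow> ('a \<Rightarrow> real) \<Rightarrow> bool" where
  "strictly_convex_on S f \<longleftrightarrow> convex S \<and>
     (\<forall>x\<in>S. \<forall>y\<in>S. \<forall>t. x \<noteq> y \<longrightarrow> 0 < t \<longrightarrow> t < 1 \<longrightarrow>
        f ((1 - t) *\<^sub>R x + t *\<^sub>R y) < (1 - t) * f x + t * f y)"

text \<open>
  \<open>g\<close> is the gradient of \<open>\<phi>\<close>. Derivatives are taken within \<open>X\<close>, which also covers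
  boundary points. If \<open>X\<close> has empty interior, \<open>g\<close> need not be unique, but the divergence
  below is: for \<open>p, q\<close> in the convex set \<open>X\<close> the number \<open>dot d (g q) (p - q)\<close> is the
  one-sided derivative of \<open>\<phi>\<close> at \<open>q\<close> along the segment from \<open>q\<close> to \<open>p\<close>.
\<close>

definition bregman_generator ::
  "nat \<Rightarrow> rvec set \<Rightarrow> (rvec \<Rightarrow> real) \<Rightarrow> (rvec \<Rightarrow> rvec) \<Rightarrow> bool" where
  "bregman_generator d X \<phi> g \<longleftrightarrow>
     X \<subseteq> Rspace d \<and> closed X \<and> convex X \<and> strictly_convex_on X \<phi> \<and>
     g ` X \<subseteq> Rspace d \<and> continuous_on X g \<and>
     (\<forall>q\<in>X. (\<phi> has_derivative (\<lambda>h. dot d (g q) h)) (at q within X))"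

definition bregman ::
  "nat \<Rightarrow> (rvec \<Rightarrow> real) \<Rightarrow> (rvec \<Rightarrow> rvec) \<Rightarrow> rvec \<Rightarrow> rvec \<Rightarrow> real" where
  "bregman d \<phi> g p q = \<phi> p - \<phi> q - dot d (g q) (p - q)"

definition quad_form :: "nat \<Rightarrow> (nat \<Rightarrow> nat \<Rightarrow> real) \<Rightarrow> rvec \<Rightarrow> real" where
  "quad_form d U x =
     (\<Sum>i<d. \<Sum>j<d. Poly_Mapping.lookup x i * U i j * Poly_Mapping.lookup x j)"

definition sym_pos_def :: "nat \<Rightarrow> (nat \<Rightarrow> nat \<Rightarrow> real) \<Rightarrow> bool" where
  "sym_pos_def d U \<longleftrightarrow>
     (\<forall>i<d. \<forall>j<d. U i j = U j i) \<and> (\<forall>x\<in>Rspace d. x \<noteq> 0 \<longrightarrow> quad_form d U x > 0)"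

definition mu_similar ::
  "nat \<Rightarrow> real \<Rightarrow> rvec set \<Rightarrow> (rvec \<Rightarrow> rvec \<Rightarrow> real) \<Rightarrow> bool" where
  "mu_similar d \<mu> X D \<longleftrightarrow>
     (\<exists>U. sym_pos_def d U \<and>
        (\<forall>p\<in>X. \<forall>q\<in>X. \<mu> * quad_form d U (p - q) \<le> D p q \<and> D p q \<le> quad_form d U (p - q)))"


section \<open>The k-median problem\<close>

definition kmedian_cost ::
  "(rvec \<Rightarrow> rvec \<Rightarrow> real) \<Rightarrow> rvec set \<Rightarrow> rvec set \<Rightarrow> real" where
  "kmedian_cost D P C = (\<Sum>p\<in>P. Min ((\<lambda>c. D p c) ` C))"

text \<open>
  The \<open>k\<close> centers are allowed to coincide, so that the problem makes sense even if \<open>X\<close> has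
  fewer than \<open>k\<close> points. If \<open>X\<close> has at least \<open>k\<close> points, the optimal cost is the same as
  with \<open>k\<close> distinct centers, since additional centers never increase the cost.
\<close>

definition center_sets :: "rvec set \<Rightarrow> nat \<Rightarrow> rvec set set" where
  "center_sets X k = {C. C \<subseteq> X \<and> finite C \<and> C \<noteq> {} \<and> card C \<le> k}"

definition kmedian_opt ::
  "(rvec \<Rightarrow> rvec \<Rightarrow> real) \<Rightarrow> rvec set \<Rightarrow> nat \<Rightarrow> rvec set \<Rightarrow> real" where
  "kmedian_opt D X k P = (INF C\<in>center_sets X k. kmedian_cost D P C)"

definition kmedian_approx ::
  "(rvec \<Rightarrow> rvec \<Rightarrow> real) \<Rightarrow> rvec set \<Rightarrow> nat \<Rightarrow> real \<Rightarrow> rvec set \<Rightarrow> rvec set \<Rightarrow> bool" where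
  "kmedian_approx D X k \<epsilon> P C \<longleftrightarrow>
     C \<in> center_sets X k \<and> kmedian_cost D P C \<le> (1 + \<epsilon>) * kmedian_opt D X k P"


section \<open>Randomized real RAM programs with a divergence oracle\<close>

text \<open>
  Programs work on natural-number registers (used for counting and addressing) and on named
  arrays of exact real numbers. Every arithmetic operation, memory access, comparison and
  biased coin flip costs one unit. There is no rounding operation, and real constants enter
  only as natural numbers. The input divergence is accessible only through the expression
  \<open>Diverg A i B j\<close>, which evaluates it on the \<open>d\<close>-dimensional vectors stored in \<open>A\<close> from
  cell \<open>i\<close> on and in \<open>B\<close> from cell \<open>j\<close> on. Each such evaluation costs \<open>d\<close> units.
\<close>

datatype nexp =
    NConst nat
  | NVar string
  | NAdd nexp nexp
  | NSub nexp nexp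
  | NMul nexp nexp

datatype rexp =
    OfNat nexp
  | Cell string nexp
  | RAdd rexp rexp
  | RSub rexp rexp
  | RMul rexp rexp
  | RDiv rexp rexp
  | Diverg string nexp string nexp

text \<open>
  \<open>IfLess a b c1 c2\<close> branches on \<open>a < b\<close>; \<open>Coin r c1 c2\<close> executes \<open>c1\<close> with probability
  \<open>r\<close> (clamped to the unit interval) and \<open>c2\<close> otherwise, using a fresh coin.
  \<open>For x r c\<close> evaluates \<open>r\<close> once and then executes \<open>c\<close> for \<open>x = 0, 1, 2, ...\<close> as long as
  \<open>x < r\<close>; assignments to \<open>x\<close> within \<open>c\<close> do not influence the iteration.
\<close>

datatype com =
    Skip
  | Assign string nexp
  | Store string nexp rexp
  | Seq com com
  | IfLess rexp rexp com com
  | Coin rexp com com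
  | For string rexp com

record state =
  nreg :: "string \<Rightarrow> nat"
  rarr :: "string \<Rightarrow> nat \<Rightarrow> real"

primrec nval :: "nexp \<Rightarrow> state \<Rightarrow> nat" where
  "nval (NConst m) s = m"
| "nval (NVar x) s = nreg s x"
| "nval (NAdd a b) s = nval a s + nval b s"
| "nval (NSub a b) s = nval a s - nval b s"
| "nval (NMul a b) s = nval a s * nval b s"

primrec ncost :: "nexp \<Rightarrow> nat" where
  "ncost (NConst m) = 1"
| "ncost (NVar x) = 1"
| "ncost (NAdd a b) = 1 + ncost a + ncost b"
| "ncost (NSub a b) = 1 + ncost a + ncost b"
| "ncost (NMul a b) = 1 + ncost a + ncost b"

definition vec_at :: "nat \<Rightarrow> state \<Rightarrow> string \<Rightarrow> nat \<Rightarrow> rvec" where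
  "vec_at d s A i = vec_of d (\<lambda>j. rarr s A (i + j))"

primrec rval :: "(rvec \<Rightarrow> rvec \<Rightarrow> real) \<Rightarrow> nat \<Rightarrow> rexp \<Rightarrow> state \<Rightarrow> real" where
  "rval D d (OfNat a) s = real (nval a s)"
| "rval D d (Cell A i) s = rarr s A (nval i s)"
| "rval D d (RAdd a b) s = rval D d a s + rval D d b s"
| "rval D d (RSub a b) s = rval D d a s - rval D d b s"
| "rval D d (RMul a b) s = rval D d a s * rval D d b s"
| "rval D d (RDiv a b) s = rval D d a s / rval D d b s"
| "rval D d (Diverg A i B j) s = D (vec_at d s A (nval i s)) (vec_at d s B (nval j s))"

primrec rcost :: "nat \<Rightarrow> rexp \<Rightarrow> nat" where
  "rcost d (OfNat a) = 1 + ncost a"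
| "rcost d (Cell A i) = 1 + ncost i"
| "rcost d (RAdd a b) = 1 + rcost d a + rcost d b"
| "rcost d (RSub a b) = 1 + rcost d a + rcost d b"
| "rcost d (RMul a b) = 1 + rcost d a + rcost d b"
| "rcost d (RDiv a b) = 1 + rcost d a + rcost d b"
| "rcost d (Diverg A i B j) = d + ncost i + ncost j"

text \<open>Executing a program yields the joint distribution of final state and running time.\<close>

type_synonym outcome = "(state \<times> nat) pmf"

definition tick :: "nat \<Rightarrow> outcome \<Rightarrow> outcome" where
  "tick c p = map_pmf (\<lambda>(s, t). (s, c + t)) p"

definition andthen :: "outcome \<Rightarrow> (state \<Rightarrow> outcome) \<Rightarrow> outcome" where
  "andthen p f = bind_pmf p (\<lambda>(s, t). tick t (f s))"

primrec iterate :: "(nat \<Rightarrow> state \<Rightarrow> outcome) \<Rightarrow> nat \<Rightarrow> state \<Rightarrow> outcome" where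
  "iterate f 0 s = return_pmf (s, 0)"
| "iterate f (Suc m) s = andthen (iterate f m s) (f m)"

definition set_nreg :: "string \<Rightarrow> nat \<Rightarrow> state \<Rightarrow> state" where
  "set_nreg x m s = s\<lparr>nreg := (nreg s)(x := m)\<rparr>"

definition set_cell :: "string \<Rightarrow> nat \<Rightarrow> real \<Rightarrow> state \<Rightarrow> state" where
  "set_cell A i r s = s\<lparr>rarr := (rarr s)(A := (rarr s A)(i := r))\<rparr>"

primrec exec :: "(rvec \<Rightarrow> rvec \<Rightarrow> real) \<Rightarrow> nat \<Rightarrow> com \<Rightarrow> state \<Rightarrow> outcome" where
  "exec D d Skip = (\<lambda>s. return_pmf (s, 1))"
| "exec D d (Assign x a) = (\<lambda>s. return_pmf (set_nreg x (nval a s) s, 1 + ncost a))"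
| "exec D d (Store A i r) =
     (\<lambda>s. return_pmf (set_cell A (nval i s) (rval D d r s) s, 1 + ncost i + rcost d r))"
| "exec D d (Seq c1 c2) = (\<lambda>s. andthen (exec D d c1 s) (exec D d c2))"
| "exec D d (IfLess a b c1 c2) =
     (\<lambda>s. tick (1 + rcost d a + rcost d b)
            (if rval D d a s < rval D d b s then exec D d c1 s else exec D d c2 s))"
| "exec D d (Coin r c1 c2) =
     (\<lambda>s. tick (1 + rcost d r)
            (bind_pmf (bernoulli_pmf (rval D d r s))
               (\<lambda>b. if b then exec D d c1 s else exec D d c2 s)))"
| "exec D d (For x r c) =
     (\<lambda>s. tick (1 + rcost d r)
            (iterate (\<lambda>i s'. tick 1 (exec D d c (set_nreg x i s')))
               (nat \<lceil>rval D d r s\<rceil>) s))"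

text \<open>
  Input: the numbers \<open>n\<close>, \<open>d\<close>, \<open>k\<close>, the parameters \<open>\<mu>\<close> and \<open>\<epsilon>\<close>, and the coordinates of
  the points, point after point. Output: \<open>k\<close> centers, stored one after another.
\<close>

definition input_state :: "nat \<Rightarrow> nat \<Rightarrow> real \<Rightarrow> real \<Rightarrow> rvec list \<Rightarrow> state" where
  "input_state d k \<mu> \<epsilon> ps =
     \<lparr> nreg = (\<lambda>_. 0)(''n'' := length ps, ''d'' := d, ''k'' := k),
       rarr = (\<lambda>_ _. 0)
         (''mu'' := (\<lambda>_. \<mu>), ''eps'' := (\<lambda>_. \<epsilon>),
          ''P'' := (\<lambda>m. if m < length ps * d
                        then Poly_Mapping.lookup (ps ! (m div d)) (m mod d) else 0)) \<rparr>"

definition output_centers :: "nat \<Rightarrow> nat \<Rightarrow> state \<Rightarrow> rvec set" where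
  "output_centers d k s = (\<lambda>i. vec_at d s ''C'' (i * d)) ` {..<k}"

end

theory Submission
  imports Defs
begin

text \<open>
  One trial builds the centers one by one; each new center is the mean of \<open>M = O(1/(\<mu>\<epsilon>))\<close> random
  samples, where a sample is either a previous center or a point drawn with probability
  proportional to its divergence from the previous centers (uniformly for the first center). As long as the centers are not good
  enough, some optimal cluster that is not covered yet carries a share of at least \<open>\<epsilon>/(3k)\<close> of the
  current cost. Moving those points of this cluster that are very close to the centers onto their
  nearest center hardly changes its mean, and every point of the modified cluster is sampled with
  probability at least \<open>\<gamma>\<close> times its share, where \<open>1/\<gamma>\<close> is polynomial in \<open>k/(\<mu>\<epsilon>)\<close>. So with
  probability \<open>\<gamma>^M\<close> all \<open>M\<close> samples behave like uniform samples from the modified cluster, whose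
  mean is then close to the centroid by Markov's inequality. A trial thus succeeds with probability
  at least \<open>(\<gamma>^M/2)^k\<close>, and the best of \<open>O((2/\<gamma>^M)^k)\<close> trials is good enough with probability
  \<open>1 - \<delta>\<close>. The program is linked to this random process by a simulation relation
  that also bounds the running time.
\<close>

section \<open>Simulation of programs by abstract random processes\<close>

text \<open>Drawing by divergence alone would fail: an optimal cluster may consist mostly of points
  lying so close to the centers that they are hardly ever drawn, although they decide where its mean
  lies. A center can stand in for such points and is cheap to draw; hence the centers belong to the
  sample space. A divergence need be neither symmetric nor subject to a triangle inequality.
  Distances are therefore compared through the quadratic form of the similarity, which loses a
  factor \<open>\<mu>\<close>, and the centroid identity of Bregman divergences turns the distance
  between a center and a mean back into cost. The share \<open>\<epsilon> / (3 * k)\<close> of an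
  uncovered cluster, the threshold \<open>\<epsilon> * \<mu>\<^sup>2 / 96\<close> for being close,
  and the chance of at least \<open>1 / k\<close> that a sample is a point at all multiply to the
  bound on \<open>\<gamma>\<close>. The number of trials has a logarithm of order k M
  log(1/\<gamma>), which is O(x log x) for x = k^2/(\<mu> \<epsilon>), because k M is O(x).\<close>

primrec iter_pmf :: "(nat \<Rightarrow> 'a \<Rightarrow> 'a pmf) \<Rightarrow> nat \<Rightarrow> 'a \<Rightarrow> 'a pmf" where
  "iter_pmf G 0 a = return_pmf a"
| "iter_pmf G (Suc m) a = bind_pmf (iter_pmf G m a) (G m)"

text \<open>A coupling, because a final state holds scratch data that the abstract process ignores.
  The bound \<open>\<tau>\<close> applies to every outcome in the support, so running times are
  worst-case and not expected ones.\<close>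

definition sim :: "outcome \<Rightarrow> nat \<Rightarrow> 'a pmf \<Rightarrow> (state \<Rightarrow> 'a \<Rightarrow> bool) \<Rightarrow> bool" where
  "sim p \<tau> F Q \<longleftrightarrow> rel_pmf (\<lambda>(s, t) a. Q s a \<and> t \<le> \<tau>) p F"

text \<open>Meant for program parts without coin flips; by \<open>sim_return_pmf_iff\<close> this is
  the simulation of a point mass.\<close>

definition surely :: "outcome \<Rightarrow> nat \<Rightarrow> (state \<Rightarrow> bool) \<Rightarrow> bool" where
  "surely p \<tau> Q \<longleftrightarrow> (\<forall>(s, t)\<in>set_pmf p. Q s \<and> t \<le> \<tau>)"

lemma sim_mono:
  assumes "sim p \<tau> F Q" "\<tau> \<le> \<tau>'" "\<And>s a. a \<in> set_pmf F \<Longrightarrow> Q s a \<Longrightarrow> Q' s a"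
  shows "sim p \<tau>' F Q'"
  using assms(1) unfolding sim_def
  by (rule pmf.rel_mono_strong) (use assms(2,3) in \<open>auto dest: order_trans\<close>)

lemma sim_return: "Q s a \<Longrightarrow> t \<le> \<tau> \<Longrightarrow> sim (return_pmf (s, t)) \<tau> (return_pmf a) Q"
  by (simp add: sim_def rel_pmf_return_pmf1)

lemma sim_tick: "sim p \<tau> F Q \<Longrightarrow> sim (tick c p) (c + \<tau>) F Q"
  unfolding sim_def tick_def pmf.rel_map
  by (erule pmf.rel_mono_strong) auto

lemma sim_andthen:
  assumes "sim p \<tau>1 F Q1" "\<And>s a. a \<in> set_pmf F \<Longrightarrow> Q1 s a \<Longrightarrow> sim (f s) \<tau>2 (G a) Q2"
  shows "sim (andthen p f) (\<tau>1 + \<tau>2) (bind_pmf F G) Q2"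
proof -
  \<comment> \<open>The coupling is restricted to the support of \<open>F\<close>, so that facts
    about the possible values of the process, such as centers lying in \<open>X\<close>, are
    available for the second part.\<close>
  have "rel_pmf (\<lambda>(s, t) a. Q1 s a \<and> t \<le> \<tau>1 \<and> a \<in> set_pmf F) p F"
    using assms(1) unfolding sim_def by (rule pmf.rel_mono_strong) auto
  then show ?thesis
    unfolding sim_def andthen_def
  proof (rule rel_pmf_bindI)
    fix x a
    assume *: "(case x of (s, t) \<Rightarrow> \<lambda>a. Q1 s a \<and> t \<le> \<tau>1 \<and> a \<in> set_pmf F) a"
    obtain s t where x: "x = (s, t)" by (cases x)
    have "sim (tick t (f s)) (t + \<tau>2) (G a) Q2"
      using * x assms(2) by (auto intro: sim_tick)
    then have "sim (tick t (f s)) (\<tau>1 + \<tau>2) (G a) Q2"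
      by (rule sim_mono) (use * x in auto)
    then show "rel_pmf (\<lambda>(s, t) a. Q2 s a \<and> t \<le> \<tau>1 + \<tau>2)
        (case x of (s, t) \<Rightarrow> tick t (f s)) (G a)"
      by (simp add: x sim_def)
  qed
qed

lemma sim_iterate:
  assumes "Q 0 s a"
    and "\<And>i s a. i < m \<Longrightarrow> Q i s a \<Longrightarrow> sim (f i s) \<tau> (G i a) (Q (Suc i))"
  shows "sim (iterate f m s) (m * \<tau>) (iter_pmf G m a) (Q m)"
  using assms
proof (induction m)
  case 0
  then show ?case by (simp add: sim_return)
next
  case (Suc m)
  then have "sim (iterate f m s) (m * \<tau>) (iter_pmf G m a) (Q m)"
    by simp
  then have "sim (andthen (iterate f m s) (f m)) (m * \<tau> + \<tau>) (iter_pmf G (Suc m) a) (Q (Suc m))"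
    unfolding iter_pmf.simps by (rule sim_andthen) (use Suc.prems in auto)
  then show ?case by (simp add: add.commute)
qed

text \<open>A point mass admits only one coupling, so the relation has to hold on the whole
  support.\<close>

lemma sim_return_pmf_iff: "sim p \<tau> (return_pmf a) Q \<longleftrightarrow> surely p \<tau> (\<lambda>s. Q s a)"
  unfolding sim_def surely_def rel_pmf_return_pmf2 by (auto split: prod.splits)

lemma sim_bernoulli:
  assumes "\<And>b. sim (f b) \<tau> (G b) Q"
  shows "sim (bind_pmf (bernoulli_pmf r) f) \<tau> (bind_pmf (bernoulli_pmf r) G) Q"
  unfolding sim_def
  by (rule rel_pmf_bindI[where R = "(=)"]) (use assms in \<open>auto simp: sim_def pmf.rel_eq\<close>)

lemma sim_andthen_surely_left:
  assumes "surely p \<tau>1 Q1" "\<And>s. Q1 s \<Longrightarrow> sim (f s) \<tau>2 G Q2"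
  shows "sim (andthen p f) (\<tau>1 + \<tau>2) G Q2"
proof -
  have "sim p \<tau>1 (return_pmf ()) (\<lambda>s _. Q1 s)"
    by (simp add: sim_return_pmf_iff assms)
  from sim_andthen[OF this, of f \<tau>2 "\<lambda>_. G"] show ?thesis
    using assms(2) by (simp add: bind_return_pmf)
qed

lemma sim_andthen_surely_right:
  assumes "sim p \<tau>1 F Q1" "\<And>s a. a \<in> set_pmf F \<Longrightarrow> Q1 s a \<Longrightarrow> surely (f s) \<tau>2 (\<lambda>s. Q2 s a)"
  shows "sim (andthen p f) (\<tau>1 + \<tau>2) F Q2"
  using sim_andthen[OF assms(1), of f \<tau>2 return_pmf Q2] assms(2)
  by (simp add: sim_return_pmf_iff bind_return_pmf')

lemma surely_mono:
  "surely p \<tau> Q \<Longrightarrow> \<tau> \<le> \<tau>' \<Longrightarrow> (\<And>s. Q s \<Longrightarrow> Q' s) \<Longrightarrow> surely p \<tau>' Q'"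
  unfolding surely_def by fastforce

lemma surely_return: "Q s \<Longrightarrow> t \<le> \<tau> \<Longrightarrow> surely (return_pmf (s, t)) \<tau> Q"
  by (simp add: surely_def)

lemma surely_tick: "surely p \<tau> Q \<Longrightarrow> surely (tick c p) (c + \<tau>) Q"
  unfolding surely_def tick_def by auto

lemma surely_andthen:
  assumes "surely p \<tau>1 Q1" "\<And>s. Q1 s \<Longrightarrow> surely (f s) \<tau>2 Q2"
  shows "surely (andthen p f) (\<tau>1 + \<tau>2) Q2"
  using sim_andthen_surely_left[of p \<tau>1 Q1 f \<tau>2 "return_pmf ()" "\<lambda>s _. Q2 s"] assms
  by (simp add: sim_return_pmf_iff)

lemma surely_iterate:
  assumes "Q 0 s" "\<And>i s. i < m \<Longrightarrow> Q i s \<Longrightarrow> surely (f i s) \<tau> (Q (Suc i))"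
  shows "surely (iterate f m s) (m * \<tau>) (Q m)"
proof -
  have "iter_pmf (\<lambda>_ _. return_pmf ()) m () = return_pmf ()"
    by (induction m) (simp_all add: bind_return_pmf)
  with sim_iterate[of "\<lambda>i s _. Q i s" s "()" m f \<tau> "\<lambda>_ _. return_pmf ()"] assms show ?thesis
    by (simp add: sim_return_pmf_iff)
qed

section \<open>Proof rules for sequencing, branching, coins and loops\<close>

lemma surely_Seq:
  assumes "surely (exec D d c1 s) \<tau>1 Q1" "\<And>s. Q1 s \<Longrightarrow> surely (exec D d c2 s) \<tau>2 Q2"
  shows "surely (exec D d (Seq c1 c2) s) (\<tau>1 + \<tau>2) Q2"
  using surely_andthen[OF assms] by simp

lemma surely_IfLess:
  assumes "rval D d a s < rval D d b s \<Longrightarrow> surely (exec D d c1 s) \<tau> Q"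
    and "\<not> rval D d a s < rval D d b s \<Longrightarrow> surely (exec D d c2 s) \<tau> Q"
  shows "surely (exec D d (IfLess a b c1 c2) s) (1 + rcost d a + rcost d b + \<tau>) Q"
  unfolding exec.simps by (rule surely_tick) (use assms in auto)

lemma surely_For:
  assumes "nat \<lceil>rval D d r s\<rceil> = m" "Q 0 s"
    and "\<And>i s. i < m \<Longrightarrow> Q i s \<Longrightarrow> surely (exec D d c (set_nreg x i s)) \<tau> (Q (Suc i))"
  shows "surely (exec D d (For x r c) s) (1 + rcost d r + m * (1 + \<tau>)) (Q m)"
  unfolding exec.simps assms(1)
  by (intro surely_tick surely_iterate) (use assms in auto)

lemma sim_For:
  assumes "nat \<lceil>rval D d r s\<rceil> = m" "Q 0 s a"
    and "\<And>i s a. i < m \<Longrightarrow> Q i s a \<Longrightarrow> sim (exec D d c (set_nreg x i s)) \<tau> (G i a) (Q (Suc i))"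
  shows "sim (exec D d (For x r c) s) (1 + rcost d r + m * (1 + \<tau>)) (iter_pmf G m a) (Q m)"
  unfolding exec.simps assms(1)
  by (intro sim_tick sim_iterate) (use assms in auto)

lemma sim_Coin:
  assumes "\<And>b. sim (exec D d (if b then c1 else c2) s) \<tau> (G b) Q"
  shows "sim (exec D d (Coin r c1 c2) s) (1 + rcost d r + \<tau>)
    (bind_pmf (bernoulli_pmf (rval D d r s)) G) Q"
  unfolding exec.simps
proof (intro sim_tick sim_bernoulli)
  show "sim (if b then exec D d c1 s else exec D d c2 s) \<tau> (G b) Q" for b
    using assms[of b] by (cases b) simp_all
qed

lemma sim_Seq_surely_left:
  assumes "surely (exec D d c1 s) \<tau>1 Q1" "\<And>s. Q1 s \<Longrightarrow> sim (exec D d c2 s) \<tau>2 G Q2"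
  shows "sim (exec D d (Seq c1 c2) s) (\<tau>1 + \<tau>2) G Q2"
  using sim_andthen_surely_left[OF assms] by simp

lemma sim_Seq_surely_right:
  assumes "sim (exec D d c1 s) \<tau>1 F Q1"
    and "\<And>s a. a \<in> set_pmf F \<Longrightarrow> Q1 s a \<Longrightarrow> surely (exec D d c2 s) \<tau>2 (\<lambda>s. Q2 s a)"
  shows "sim (exec D d (Seq c1 c2) s) (\<tau>1 + \<tau>2) F Q2"
  using sim_andthen_surely_right[OF assms] by simp

lemma sim_Seq:
  assumes "sim (exec D d c1 s) \<tau>1 F Q1"
    and "\<And>s a. a \<in> set_pmf F \<Longrightarrow> Q1 s a \<Longrightarrow> sim (exec D d c2 s) \<tau>2 (G a) Q2"
  shows "sim (exec D d (Seq c1 c2) s) (\<tau>1 + \<tau>2) (bind_pmf F G) Q2"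
  using sim_andthen[OF assms] by simp

section \<open>Averages of random samples\<close>

text \<open>Only semidefinite, since all dimensions share one type: a form reading the first
  \<open>d\<close> coordinates vanishes on vectors supported beyond them.\<close>

locale semi_inner =
  fixes B :: "'a::real_vector \<Rightarrow> 'a \<Rightarrow> real"
  assumes add_left: "B (x + y) z = B x z + B y z"
    and scale_left: "B (r *\<^sub>R x) z = r * B x z"
    and commute: "B x y = B y x"
    and nonneg: "0 \<le> B x x"
begin

definition Q :: "'a \<Rightarrow> real" where "Q x = B x x"

lemma add_right: "B z (x + y) = B z x + B z y"
  using add_left commute by metis

lemma scale_right: "B z (r *\<^sub>R x) = r * B z x"
  using scale_left commute by metis

lemma minus_left: "B (- x) z = - B x z"
  using scale_left[of "-1" x z] by simp

lemma minus_right: "B z (- x) = - B z x"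
  using minus_left commute by metis

lemma diff_left: "B (x - y) z = B x z - B y z"
  using add_left[of x "- y" z] by (simp add: minus_left)

lemma diff_right: "B z (x - y) = B z x - B z y"
  using diff_left commute by metis

lemma zero_left: "B 0 z = 0"
  using scale_left[of 0 0 z] by simp

lemma sum_left: "B (\<Sum>p\<in>A. f p) z = (\<Sum>p\<in>A. B (f p) z)"
  by (induction A rule: infinite_finite_induct) (simp_all add: zero_left add_left)

lemmas bilinear = add_left add_right scale_left scale_right diff_left diff_right minus_left minus_right

lemma Q_nonneg: "0 \<le> Q x"
  by (simp add: Q_def nonneg)

lemma Q_minus_commute: "Q (x - y) = Q (y - x)"
  by (simp add: Q_def bilinear)

lemma Q_scale: "Q (r *\<^sub>R x) = r\<^sup>2 * Q x"
  by (simp add: Q_def bilinear power2_eq_square)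

lemma Q_zero: "Q 0 = 0"
  by (simp add: Q_def zero_left)

text \<open>The parallelogram identity: the gap between the two sides is
  \<open>Q (x - y)\<close>.\<close>

lemma Q_add_le: "Q (x + y) \<le> 2 * Q x + 2 * Q y"
  using Q_nonneg[of "x - y"] by (simp add: Q_def bilinear)

lemma Q_diff_le: "Q (x - z) \<le> 2 * Q (x - y) + 2 * Q (y - z)"
  using Q_add_le[of "x - y" "y - z"] by simp

lemma Q_diff_le3: "Q (w - z) \<le> 3 * (Q (w - x) + Q (x - y) + Q (y - z))"
proof -
  \<comment> \<open>The gap is \<open>Q (a - b) + Q (b - c) + Q (a - c)\<close>.\<close>
  have "Q (a + b + c) \<le> 3 * (Q a + Q b + Q c)" for a b c
    using Q_nonneg[of "a - b"] Q_nonneg[of "b - c"] Q_nonneg[of "a - c"] commute[of a b]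
      commute[of b c] commute[of a c]
    by (simp add: Q_def bilinear)
  from this[of "w - x" "x - y" "y - z"] show ?thesis by simp
qed

text \<open>The parallel axis identity, or the split into variance and squared bias. The points are
  indexed by \<open>f\<close>, so that coinciding points keep their multiplicity.\<close>

lemma sum_Q_diff:
  fixes f :: "'b \<Rightarrow> 'a"
  assumes "finite A" "A \<noteq> {}"
  defines "m \<equiv> (1 / real (card A)) *\<^sub>R (\<Sum>p\<in>A. f p)"
  shows "(\<Sum>p\<in>A. Q (f p - z)) = (\<Sum>p\<in>A. Q (f p - m)) + card A * Q (m - z)"
proof -
  have n: "real (card A) > 0" using assms by (simp add: card_gt_0_iff)
  have s: "(\<Sum>p\<in>A. B (f p) x) = card A * B m x" for x
    using n by (simp add: m_def scale_left sum_left)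
  have e: "Q (f p - z) = Q (f p - m) + 2 * B (f p) m - 2 * B (f p) z + B z z - B m m" for p
    by (simp add: Q_def bilinear commute[of z "f p"] commute[of m "f p"])
  have "(\<Sum>p\<in>A. Q (f p - z)) = (\<Sum>p\<in>A. Q (f p - m)) + 2 * (card A * B m m) - 2 * (card A * B m z)
      + card A * B z z - card A * B m m"
    unfolding e by (simp add: sum.distrib sum_subtractf s sum_distrib_left[symmetric])
  also have "\<dots> = (\<Sum>p\<in>A. Q (f p - m)) + card A * Q (m - z)"
    by (simp add: Q_def bilinear commute[of z m] algebra_simps)
  finally show ?thesis .
qed

end

text \<open>Each sample is scaled as it is added, as in the program; \<open>c\<close> is kept apart
  from the number of summands so that partial sums can be treated by induction.\<close>

definition scaled_sum :: "real \<Rightarrow> 'a::real_vector pmf \<Rightarrow> nat \<Rightarrow> 'a pmf" where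
  "scaled_sum c q m = iter_pmf (\<lambda>_ v. map_pmf (\<lambda>x. v + c *\<^sub>R x) q) m 0"

lemma nn_integral_scaled_sum_Suc:
  "(\<integral>\<^sup>+v. f v \<partial>scaled_sum c q (Suc m)) = (\<integral>\<^sup>+v. \<integral>\<^sup>+x. f (v + c *\<^sub>R x) \<partial>q \<partial>scaled_sum c q m)"
  by (simp add: scaled_sum_def)

text \<open>If a draw from \<open>q\<close> dominates \<open>\<gamma>\<close> times a draw from
  \<open>u\<close>, then one factor is paid per draw. Quantifying over all integrands
  \<open>f\<close> lets the induction feed the inner integral of the last draw into the hypothesis
  for the earlier ones.\<close>

lemma nn_integral_scaled_sum_mono:
  fixes f :: "'a::real_vector \<Rightarrow> ennreal" and q u :: "'a pmf"
  assumes "\<And>f. ennreal \<gamma> * (\<integral>\<^sup>+x. f x \<partial>u) \<le> (\<integral>\<^sup>+x. f x \<partial>q)" "0 \<le> \<gamma>"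
  shows "ennreal (\<gamma> ^ m) * (\<integral>\<^sup>+v. f v \<partial>scaled_sum c u m) \<le> (\<integral>\<^sup>+v. f v \<partial>scaled_sum c q m)"
proof (induction m arbitrary: f)
  case 0
  then show ?case by (simp add: scaled_sum_def)
next
  case (Suc m)
  have "ennreal (\<gamma> ^ Suc m) * (\<integral>\<^sup>+v. f v \<partial>scaled_sum c u (Suc m))
      = ennreal (\<gamma> ^ m) * (\<integral>\<^sup>+v. ennreal \<gamma> * (\<integral>\<^sup>+x. f (v + c *\<^sub>R x) \<partial>u) \<partial>scaled_sum c u m)"
    using assms(2)
    by (simp add: nn_integral_scaled_sum_Suc nn_integral_cmult ennreal_mult mult_ac del: ennreal_power)
  also have "\<dots> \<le> ennreal (\<gamma> ^ m) * (\<integral>\<^sup>+v. (\<integral>\<^sup>+x. f (v + c *\<^sub>R x) \<partial>q) \<partial>scaled_sum c u m)"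
    by (intro mult_left_mono nn_integral_mono assms(1)) auto
  also have "\<dots> \<le> (\<integral>\<^sup>+v. (\<integral>\<^sup>+x. f (v + c *\<^sub>R x) \<partial>q) \<partial>scaled_sum c q m)"
    by (rule Suc.IH)
  finally show ?case by (simp add: nn_integral_scaled_sum_Suc)
qed

context semi_inner
begin

text \<open>The variance recursion: averaged over a fresh sample the cross term vanishes and
  \<open>c\<^sup>2 * \<sigma>\<close> is added, whatever \<open>v\<close> is. This is the parallel
  axis identity for the scaled points around the target
  \<open>z - v + c *\<^sub>R m'\<close>.\<close>

lemma nn_integral_uniform_shift:
  fixes \<pi> :: "'b \<Rightarrow> 'a"
  assumes "finite A" "A \<noteq> {}"
  defines "u \<equiv> map_pmf \<pi> (pmf_of_set A)"
    and "m' \<equiv> (1 / real (card A)) *\<^sub>R (\<Sum>p\<in>A. \<pi> p)"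
    and "\<sigma> \<equiv> (\<Sum>p\<in>A. Q (\<pi> p - (1 / real (card A)) *\<^sub>R (\<Sum>p\<in>A. \<pi> p))) / card A"
  shows "(\<integral>\<^sup>+x. ennreal (Q (v + c *\<^sub>R x - (z + c *\<^sub>R m'))) \<partial>u) = ennreal (Q (v - z) + c\<^sup>2 * \<sigma>)"
proof -
  have n: "real (card A) > 0" using assms(1,2) by (simp add: card_gt_0_iff)
  have "(\<Sum>p\<in>A. Q (c *\<^sub>R \<pi> p - (z - v + c *\<^sub>R m')))
      = (\<Sum>p\<in>A. Q (c *\<^sub>R \<pi> p - c *\<^sub>R m')) + card A * Q (c *\<^sub>R m' - (z - v + c *\<^sub>R m'))"
    using sum_Q_diff[OF assms(1,2), of "\<lambda>p. c *\<^sub>R \<pi> p" "z - v + c *\<^sub>R m'"]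
    by (simp add: m'_def scaleR_sum_right[symmetric] scaleR_left_commute)
  also have "c *\<^sub>R m' - (z - v + c *\<^sub>R m') = v - z" by simp
  also have "(\<Sum>p\<in>A. Q (c *\<^sub>R \<pi> p - c *\<^sub>R m')) = card A * (c\<^sup>2 * \<sigma>)"
    using n unfolding scaleR_diff_right[symmetric] Q_scale sum_distrib_left[symmetric]
    by (simp add: \<sigma>_def m'_def)
  finally have "(\<Sum>p\<in>A. Q (v + c *\<^sub>R \<pi> p - (z + c *\<^sub>R m'))) = card A * (c\<^sup>2 * \<sigma> + Q (v - z))"
    by (simp add: algebra_simps)
  then have "(\<integral>\<^sup>+x. ennreal (Q (v + c *\<^sub>R x - (z + c *\<^sub>R m'))) \<partial>u)
      = ennreal (real (card A) * (c\<^sup>2 * \<sigma> + Q (v - z))) / ennreal (real (card A))"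
    using assms(1,2)
    by (simp add: u_def nn_integral_pmf_of_set Q_nonneg sum_ennreal ennreal_of_nat_eq_real_of_nat)
  also have "\<dots> = ennreal (real (card A) * (c\<^sup>2 * \<sigma> + Q (v - z)) / real (card A))"
    using n by (intro divide_ennreal) (simp_all add: \<sigma>_def sum_nonneg Q_nonneg)
  finally show ?thesis using n by (simp add: add.commute)
qed

text \<open>The mean of \<open>M\<close> samples has variance \<open>\<sigma> / M\<close>, and
  Markov's inequality is applied at twice this value.\<close>

lemma scaled_sum_uniform_concentration:
  fixes \<pi> :: "'b \<Rightarrow> 'a"
  assumes "finite A" "A \<noteq> {}" "M > 0"
  defines "u \<equiv> map_pmf \<pi> (pmf_of_set A)"
    and "m' \<equiv> (1 / real (card A)) *\<^sub>R (\<Sum>p\<in>A. \<pi> p)"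
    and "\<sigma> \<equiv> (\<Sum>p\<in>A. Q (\<pi> p - (1 / real (card A)) *\<^sub>R (\<Sum>p\<in>A. \<pi> p))) / card A"
  shows "ennreal (1 / 2) \<le> (\<integral>\<^sup>+v. indicator {v. Q (v - m') \<le> 2 * \<sigma> / M} v \<partial>scaled_sum (1 / real M) u M)"
proof -
  have \<sigma>: "\<sigma> \<ge> 0" by (simp add: \<sigma>_def sum_nonneg Q_nonneg)
  \<comment> \<open>The vector \<open>(real m * c) *\<^sub>R m'\<close> is the expectation of the
    partial sum, so this is its variance after \<open>m\<close> draws.\<close>
  have E: "(\<integral>\<^sup>+v. ennreal (Q (v - (real m * c) *\<^sub>R m')) \<partial>scaled_sum c u m) = ennreal (real m * c\<^sup>2 * \<sigma>)" for m :: nat and c :: real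
  proof (induction m)
    case 0
    then show ?case by (simp add: scaled_sum_def Q_zero)
  next
    case (Suc m)
    have "(\<integral>\<^sup>+v. ennreal (Q (v - (real (Suc m) * c) *\<^sub>R m')) \<partial>scaled_sum c u (Suc m))
      = (\<integral>\<^sup>+v. \<integral>\<^sup>+x. ennreal (Q (v + c *\<^sub>R x - ((real m * c) *\<^sub>R m' + c *\<^sub>R m'))) \<partial>u \<partial>scaled_sum c u m)"
      unfolding nn_integral_scaled_sum_Suc by (simp add: algebra_simps)
    also have "\<dots> = (\<integral>\<^sup>+v. ennreal (Q (v - (real m * c) *\<^sub>R m')) + ennreal (c\<^sup>2 * \<sigma>) \<partial>scaled_sum c u m)"
      unfolding u_def m'_def \<sigma>_def nn_integral_uniform_shift[OF assms(1,2)]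
      by (simp add: Q_nonneg sum_nonneg ennreal_plus)
    also have "\<dots> = ennreal (real m * c\<^sup>2 * \<sigma>) + ennreal (c\<^sup>2 * \<sigma>)"
      by (simp add: nn_integral_add Suc)
    finally show ?case using \<sigma> by (simp add: ennreal_plus[symmetric] algebra_simps del: ennreal_plus)
  qed
  let ?p = "measure_pmf (scaled_sum (1 / real M) u M)"
  let ?e = "\<sigma> / M"
  have E': "(\<integral>\<^sup>+v. ennreal (Q (v - m')) \<partial>?p) = ennreal ?e"
    using E[where m = M and c = "1 / real M"] assms(3) by (simp add: power2_eq_square field_simps)
  define G where "G = {v. Q (v - m') \<le> 2 * ?e}"
  have "2 * emeasure ?p (- G) \<le> 1"
  \<comment> \<open>With zero variance there is nothing to divide by in Markov's inequality; the
    average then has distance 0 from \<open>m'\<close> almost surely.\<close>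
  proof (cases "?e = 0")
    case True
    then have "AE v in ?p. ennreal (Q (v - m')) = 0"
      using E' by (simp only: nn_integral_0_iff_AE[of _ ?p, simplified] ennreal_0)
    then have "AE v in ?p. indicator (- G) v = (0 :: ennreal)"
      by (rule AE_mp) (simp add: G_def True ennreal_eq_0_iff)
    then have "emeasure ?p (- G) = 0"
      by (subst nn_integral_indicator[symmetric], simp, subst nn_integral_0_iff_AE, simp_all)
    then show ?thesis by simp
  next
    case False
    moreover have "?e \<ge> 0" using \<sigma> by simp
    ultimately have e: "?e > 0" by linarith
    \<comment> \<open>Outside \<open>G\<close> the integrand exceeds twice its expectation.\<close>
    have "ennreal (2 * ?e) * emeasure ?p (- G) = (\<integral>\<^sup>+v. ennreal (2 * ?e) * indicator (- G) v \<partial>?p)"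
      by (simp add: nn_integral_cmult_indicator)
    also have "\<dots> \<le> (\<integral>\<^sup>+v. ennreal (Q (v - m')) \<partial>?p)"
      by (intro nn_integral_mono) (auto simp: G_def indicator_def intro!: ennreal_leI)
    finally have "ennreal (2 * ?e) * emeasure ?p (- G) \<le> ennreal ?e"
      by (simp only: E')
    moreover have "ennreal (2 * ?e) = ennreal ?e * 2"
      using ennreal_mult[of ?e 2] e by (simp only: ennreal_numeral mult.commute)
    ultimately have "ennreal ?e * (2 * emeasure ?p (- G)) \<le> ennreal ?e * 1"
      by (simp only: mult.assoc mult_1_right)
    then show ?thesis
      using e by (subst (asm) ennreal_mult_le_mult_iff) (auto simp: assms(3))
  qed
  then have "ennreal (2 * measure ?p (- G)) \<le> ennreal 1"
    by (simp add: ennreal_mult measure_pmf.emeasure_eq_measure)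
  then have "2 * measure ?p (- G) \<le> 1"
    by (subst (asm) ennreal_le_iff) auto
  moreover have "measure ?p (- G) = 1 - measure ?p G"
    using measure_pmf.prob_compl[of G] by (simp add: Compl_eq_Diff_UNIV)
  ultimately have "ennreal (1 / 2) \<le> emeasure ?p G"
    unfolding measure_pmf.emeasure_eq_measure by (intro ennreal_leI) linarith
  then show ?thesis by (simp add: G_def)
qed

end

section \<open>Covering an optimal cluster\<close>

definition mean :: "'a::real_vector set \<Rightarrow> 'a" where
  "mean A = (1 / real (card A)) *\<^sub>R (\<Sum>p\<in>A. p)"

definition nearest :: "('a \<Rightarrow> 'a \<Rightarrow> real) \<Rightarrow> 'a set \<Rightarrow> 'a \<Rightarrow> real" where
  "nearest D C p = Min ((\<lambda>c. D p c) ` C)"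

text \<open>By \<open>intra_le\<close> below, the optimal cost of \<open>A\<close> with a single
  center. An empty set costs 0, which admits empty clusters.\<close>

definition intra :: "('a::real_vector \<Rightarrow> 'a \<Rightarrow> real) \<Rightarrow> 'a set \<Rightarrow> real" where
  "intra D A = (\<Sum>p\<in>A. D p (mean A))"

lemma nearest_le: "finite C \<Longrightarrow> c \<in> C \<Longrightarrow> nearest D C p \<le> D p c"
  by (simp add: nearest_def)

lemma nearest_obtain:
  assumes "finite C" "C \<noteq> {}"
  obtains c where "c \<in> C" "nearest D C p = D p c"
proof -
  have "Min (D p ` C) \<in> D p ` C" using assms by (intro Min_in) auto
  then show thesis using that by (auto simp: nearest_def)
qed

lemma nearest_insert:
  "finite C \<Longrightarrow> C \<noteq> {} \<Longrightarrow> nearest D (insert c C) p = min (D p c) (nearest D C p)"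
  by (simp add: nearest_def)

text \<open>The analysis sees a Bregman divergence only through its comparison with \<open>Q\<close>
  and through the centroid identity; the latter makes the mean an optimal single center.\<close>

locale similar_divergence = semi_inner B for B :: "'a::real_vector \<Rightarrow> 'a \<Rightarrow> real" +
  fixes X :: "'a set" and D :: "'a \<Rightarrow> 'a \<Rightarrow> real" and \<mu> :: real
  assumes convex_X: "convex X"
    and D_lower: "p \<in> X \<Longrightarrow> q \<in> X \<Longrightarrow> \<mu> * Q (p - q) \<le> D p q"
    and D_upper: "p \<in> X \<Longrightarrow> q \<in> X \<Longrightarrow> D p q \<le> Q (p - q)"
    and centroid: "finite A \<Longrightarrow> A \<noteq> {} \<Longrightarrow> A \<subseteq> X \<Longrightarrow> c \<in> X \<Longrightarrow>
      (\<Sum>p\<in>A. D p c) = intra D A + card A * D (mean A) c"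
    and \<mu>: "0 < \<mu>" "\<mu> \<le> 1"
begin

lemma D_nonneg: "p \<in> X \<Longrightarrow> q \<in> X \<Longrightarrow> 0 \<le> D p q"
  using D_lower[of p q] mult_nonneg_nonneg[of \<mu> "Q (p - q)"] \<mu> Q_nonneg[of "p - q"] by linarith

lemma mean_in: "finite A \<Longrightarrow> A \<noteq> {} \<Longrightarrow> A \<subseteq> X \<Longrightarrow> mean A \<in> X"
  unfolding mean_def scaleR_sum_right
  by (rule convex_sum[OF _ convex_X]) (auto simp: card_gt_0_iff)

lemma nearest_nonneg: "finite C \<Longrightarrow> C \<noteq> {} \<Longrightarrow> C \<subseteq> X \<Longrightarrow> p \<in> X \<Longrightarrow> 0 \<le> nearest D C p"
  by (metis D_nonneg nearest_obtain subset_iff)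

lemma intra_nonneg: "finite A \<Longrightarrow> A \<subseteq> X \<Longrightarrow> 0 \<le> intra D A"
  unfolding intra_def by (intro sum_nonneg D_nonneg mean_in) auto

lemma intra_le: "finite A \<Longrightarrow> A \<subseteq> X \<Longrightarrow> c \<in> X \<Longrightarrow> intra D A \<le> (\<Sum>p\<in>A. D p c)"
  using centroid[of A c] D_nonneg[OF mean_in, of A c] by (cases "A = {}") (auto simp: intra_def)

lemma sum_Q_mean_le:
  assumes "finite A" "A \<noteq> {}" "A \<subseteq> X"
  shows "\<mu> * (\<Sum>p\<in>A. Q (p - mean A)) \<le> intra D A"
  unfolding intra_def sum_distrib_left using assms mean_in[OF assms]
  by (intro sum_mono D_lower) auto

text \<open>
  The points much closer to \<open>C\<close> than the average point of \<open>A\<close> have a negligible total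
  divergence to \<open>C\<close>, even relative to the cost of \<open>A\<close> with its own mean: if such a point is
  close to the mean, then so is \<open>C\<close>, which bounds the average divergence; if it is not, then it
  contributes to the cost of \<open>A\<close> itself.
\<close>

lemma near_points_negligible:
  assumes A: "finite A" "A \<noteq> {}" "A \<subseteq> X" and C: "finite C" "C \<noteq> {}" "C \<subseteq> X"
    and \<beta>: "0 < \<beta>" "6 * \<beta> \<le> \<mu>"
  shows "(\<Sum>p | p \<in> A \<and> nearest D C p * card A < \<beta> * (\<Sum>q\<in>A. nearest D C q). nearest D C p)
     \<le> 12 * \<beta> / \<mu> * intra D A"
proof -
  define n where "n = real (card A)"
  define S where "S = (\<Sum>p\<in>A. Q (p - mean A))"
  define \<Delta> where "\<Delta> = (\<Sum>q\<in>A. nearest D C q)"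
  define N where "N = {p \<in> A. nearest D C p * n < \<beta> * \<Delta>}"
  have n: "n > 0" using A by (simp add: n_def card_gt_0_iff)
  have S: "S \<ge> 0" by (simp add: S_def sum_nonneg Q_nonneg)
  have bound: "nearest D C p \<le> 6 * \<beta> * S / n + 6 * \<beta> * Q (p - mean A)" if p: "p \<in> N" for p
  proof -
    obtain c where c: "c \<in> C" "nearest D C p = D p c" using nearest_obtain[OF C(1,2)] .
    have pX: "p \<in> X" and cX: "c \<in> X" using p A c C by (auto simp: N_def)
    \<comment> \<open>Any point of \<open>A\<close> reaches \<open>c\<close> by way of the mean and
      of the near point \<open>p\<close>.\<close>
    have "\<Delta> \<le> (\<Sum>q\<in>A. 3 * (Q (q - mean A) + Q (mean A - p) + Q (p - c)))"
      unfolding \<Delta>_def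
    proof (rule sum_mono)
      fix q assume "q \<in> A"
      then have "nearest D C q \<le> Q (q - c)"
        using nearest_le[OF C(1) c(1)] D_upper[of q c] cX A(3) by (meson order_trans subsetD)
      then show "nearest D C q \<le> 3 * (Q (q - mean A) + Q (mean A - p) + Q (p - c))"
        using Q_diff_le3 order_trans by blast
    qed
    also have "\<dots> = 3 * S + 3 * n * Q (p - mean A) + 3 * (n * Q (p - c))"
      by (simp add: sum.distrib sum_distrib_left[symmetric] S_def n_def Q_minus_commute[of p "mean A"])
    finally have 1: "\<Delta> \<le> 3 * S + 3 * n * Q (p - mean A) + 3 * (n * Q (p - c))" .
    have "\<mu> * (n * Q (p - c)) = n * (\<mu> * Q (p - c))" by simp
    also have "\<dots> \<le> n * D p c" using D_lower[OF pX cX] n by (intro mult_left_mono) auto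
    also have "\<dots> \<le> \<beta> * \<Delta>" using p c by (simp add: N_def mult.commute)
    also have "\<dots> \<le> \<mu> / 6 * \<Delta>"
      using \<beta> nearest_nonneg[OF C] A by (intro mult_right_mono) (auto simp: \<Delta>_def intro!: sum_nonneg)
    finally have "6 * (n * Q (p - c)) \<le> \<Delta>" using \<mu> by simp
    \<comment> \<open>As \<open>p\<close> is near and \<open>6 * \<beta> \<le> \<mu>\<close>, the
      last summand of fact \<open>1\<close> is at most half of \<open>\<Delta>\<close> and is
      absorbed on the left.\<close>
    with 1 have "\<Delta> \<le> 6 * S + 6 * n * Q (p - mean A)" by simp
    then have "\<beta> * \<Delta> \<le> \<beta> * (6 * S + 6 * n * Q (p - mean A))" using \<beta> by simp
    moreover have "nearest D C p * n \<le> \<beta> * \<Delta>" using p by (simp add: N_def)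
    ultimately have "nearest D C p * n \<le> \<beta> * (6 * S + 6 * n * Q (p - mean A))" by linarith
    then have "nearest D C p \<le> \<beta> * (6 * S + 6 * n * Q (p - mean A)) / n"
      using n by (simp add: pos_le_divide_eq)
    also have "\<dots> = 6 * \<beta> * S / n + 6 * \<beta> * Q (p - mean A)"
      using n by (simp add: add_divide_distrib distrib_left)
    finally show ?thesis .
  qed
  have "(\<Sum>p\<in>N. nearest D C p) \<le> (\<Sum>p\<in>N. 6 * \<beta> * S / n + 6 * \<beta> * Q (p - mean A))"
    by (intro sum_mono bound)
  \<comment> \<open>Summed over all of \<open>A\<close>, each of the two terms of the bound
    contributes \<open>6 * \<beta> * S\<close>.\<close>
  also have "\<dots> \<le> (\<Sum>p\<in>A. 6 * \<beta> * S / n + 6 * \<beta> * Q (p - mean A))"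
    using A(1) S n \<beta> by (intro sum_mono2 add_nonneg_nonneg mult_nonneg_nonneg divide_nonneg_pos Q_nonneg)
      (auto simp: N_def)
  also have "\<dots> = 12 * \<beta> * S"
    using n by (simp add: sum.distrib sum_distrib_left[symmetric] S_def[symmetric] n_def[symmetric])
  also have "\<dots> \<le> 12 * \<beta> / \<mu> * intra D A"
  proof -
    have "S \<le> intra D A / \<mu>"
      using sum_Q_mean_le[OF A] \<mu> by (simp add: S_def pos_le_divide_eq mult.commute)
    then have "12 * \<beta> * S \<le> 12 * \<beta> * (intra D A / \<mu>)" using \<beta> by (intro mult_left_mono) auto
    then show ?thesis by simp
  qed
  finally show ?thesis by (simp add: N_def \<Delta>_def n_def)
qed

text \<open>With n = \<open>card A\<close> and \<open>m'\<close> the mean of the moved points, the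
  excess cost n \<open>D (mean A) v\<close> is at most 2 n \<open>Q (mean A - m')\<close> + 2 n
  \<open>Q (v - m')\<close>. The first distance is controlled by the total displacement, the second
  by the choice of \<open>M\<close>; n times either is at most \<open>\<epsilon> / 8\<close> of the
  cluster cost.\<close>

lemma cost_perturbed_mean:
  assumes A: "finite A" "A \<noteq> {}" "A \<subseteq> X" and \<pi>: "\<pi> ` A \<subseteq> X" and v: "v \<in> X" and \<epsilon>: "0 < \<epsilon>" "\<epsilon> \<le> 1 / 2"
    and \<rho>: "(\<Sum>p\<in>A. Q (p - \<pi> p)) \<le> \<epsilon> / 8 * intra D A" and M: "64 / (\<mu> * \<epsilon>) \<le> M"
    and Qv: "Q (v - (1 / real (card A)) *\<^sub>R (\<Sum>p\<in>A. \<pi> p))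
      \<le> 2 * ((\<Sum>p\<in>A. Q (\<pi> p - (1 / real (card A)) *\<^sub>R (\<Sum>p\<in>A. \<pi> p))) / card A) / M"
  shows "(\<Sum>p\<in>A. D p v) \<le> (1 + \<epsilon> / 2) * intra D A"
proof -
  define n where "n = real (card A)"
  define S where "S = (\<Sum>p\<in>A. Q (p - mean A))"
  define \<rho>' where "\<rho>' = (\<Sum>p\<in>A. Q (p - \<pi> p))"
  define m' where "m' = (1 / n) *\<^sub>R (\<Sum>p\<in>A. \<pi> p)"
  define \<sigma> where "\<sigma> = (\<Sum>p\<in>A. Q (\<pi> p - m'))"
  have n: "n > 0" using A by (simp add: n_def card_gt_0_iff)
  have I: "intra D A \<ge> 0" using A by (simp add: intra_nonneg)
  have "0 < 64 / (\<mu> * \<epsilon>)" using \<mu> \<epsilon> by simp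
  with M have M0: "M > 0" by linarith
  \<comment> \<open>The parallel axis identity with target 0 gives Jensen's inequality: the squared
    displacement of the mean is at most the average squared displacement of the points.\<close>
  have "(\<Sum>p\<in>A. Q ((p - \<pi> p) - 0)) \<ge> n * Q ((1 / n) *\<^sub>R (\<Sum>p\<in>A. p - \<pi> p) - 0)"
    unfolding n_def by (subst sum_Q_diff[OF A(1,2)]) (simp add: sum_nonneg Q_nonneg)
  moreover have "(1 / n) *\<^sub>R (\<Sum>p\<in>A. p - \<pi> p) = mean A - m'"
    by (simp add: mean_def m'_def n_def sum_subtractf scaleR_diff_right)
  ultimately have 1: "n * Q (mean A - m') \<le> \<rho>'" by (simp add: \<rho>'_def)
  \<comment> \<open>The mean \<open>m'\<close> minimises the sum of squares, so it may be exchanged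
    for \<open>mean A\<close>.\<close>
  have "\<sigma> \<le> (\<Sum>p\<in>A. Q (\<pi> p - mean A))"
    using sum_Q_diff[OF A(1,2), of \<pi> "mean A"] n Q_nonneg[of "m' - mean A"]
    by (simp add: \<sigma>_def m'_def n_def)
  also have "\<dots> \<le> (\<Sum>p\<in>A. 2 * Q (p - \<pi> p) + 2 * Q (p - mean A))"
    by (intro sum_mono) (metis Q_diff_le Q_minus_commute)
  also have "\<dots> = 2 * \<rho>' + 2 * S"
    by (simp add: sum.distrib sum_distrib_left[symmetric] \<rho>'_def S_def)
  finally have 2: "\<sigma> \<le> 2 * \<rho>' + 2 * S" .
  have "Q (v - m') \<le> 2 * (\<sigma> / n) / M" using Qv by (simp add: m'_def \<sigma>_def n_def)
  then have "n * Q (v - m') \<le> n * (2 * (\<sigma> / n) / M)" using n by (intro mult_left_mono) auto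
  then have "n * Q (v - m') \<le> 2 * \<sigma> / M" using n by simp
  also have "\<dots> \<le> 2 * (2 * \<rho>' + 2 * S) / M" using 2 M0 by (simp add: divide_right_mono)
  also have "\<dots> = (2 * (2 * \<rho>' + 2 * S)) * (1 / M)" by simp
  \<comment> \<open>The numerical factor 4 against the 64 in the sample count leaves
    \<open>\<epsilon> / 16\<close> for each of \<open>\<mu> * \<rho>'\<close> and
    \<open>\<mu> * S\<close>, both at most the cluster cost. The \<open>\<mu>\<close> in the sample
    count pays for comparing \<open>S\<close> with that cost.\<close>
  also have "\<dots> \<le> (2 * (2 * \<rho>' + 2 * S)) * (\<mu> * \<epsilon> / 64)"
  proof (rule mult_left_mono)
    show "1 / M \<le> \<mu> * \<epsilon> / 64" using M M0 \<mu> \<epsilon> by (simp add: field_simps)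
    show "0 \<le> 2 * (2 * \<rho>' + 2 * S)" by (simp add: \<rho>'_def S_def sum_nonneg Q_nonneg)
  qed
  also have "\<dots> = \<epsilon> / 16 * (\<mu> * \<rho>' + \<mu> * S)" by (simp add: algebra_simps)
  also have "\<dots> \<le> \<epsilon> / 16 * (intra D A + intra D A)"
  proof -
    have "\<mu> * \<rho>' \<le> 1 * \<rho>'"
      using \<mu> by (intro mult_right_mono) (auto simp: \<rho>'_def sum_nonneg Q_nonneg)
    moreover have "\<epsilon> / 8 * intra D A \<le> 1 * intra D A" using \<epsilon> I by (intro mult_right_mono) auto
    ultimately have "\<mu> * \<rho>' \<le> intra D A" using \<rho> by (simp add: \<rho>'_def)
    moreover have "\<mu> * S \<le> intra D A" using sum_Q_mean_le[OF A] by (simp add: S_def)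
    ultimately show ?thesis using \<epsilon> by simp
  qed
  finally have 3: "n * Q (v - m') \<le> \<epsilon> / 8 * intra D A" by simp
  have "D (mean A) v \<le> Q (mean A - v)" using D_upper mean_in[OF A] v by blast
  also have "\<dots> \<le> 2 * Q (mean A - m') + 2 * Q (v - m')"
    using Q_diff_le[of "mean A" v m'] by (simp add: Q_minus_commute[of v m'])
  finally have "n * D (mean A) v \<le> n * (2 * Q (mean A - m') + 2 * Q (v - m'))" using n by simp
  also have "\<dots> = 2 * (n * Q (mean A - m')) + 2 * (n * Q (v - m'))" by (simp add: algebra_simps)
  also have "\<dots> \<le> 2 * (\<epsilon> / 8 * intra D A) + 2 * (\<epsilon> / 8 * intra D A)"
    using 1 3 \<rho> by (simp add: \<rho>'_def)
  finally show ?thesis using centroid[OF A v] by (simp add: n_def algebra_simps)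
qed

end

section \<open>The sampling process\<close>

text \<open>Weighted reservoir sampling: item \<open>p\<close> replaces the held one with
  probability \<open>w p\<close> over the prefix sum, so one pass suffices and the total need not be
  known. While all weights are 0, the quotient 0/0 is 0 and index 0 stays.\<close>

definition pick_point :: "(nat \<Rightarrow> real) \<Rightarrow> nat \<Rightarrow> nat pmf" where
  "pick_point w n = iter_pmf (\<lambda>p j. bind_pmf (bernoulli_pmf (w p / (\<Sum>q<Suc p. w q)))
     (\<lambda>b. return_pmf (if b then p else j))) n 0"

text \<open>The reservoir goes on with \<open>j\<close> as its first item and the \<open>i\<close>
  centers as the others, all equally likely. Index \<open>n + l\<close> addresses center
  \<open>l\<close> in \<open>ps @ cs\<close>.\<close>

definition pick_center :: "nat \<Rightarrow> nat \<Rightarrow> nat \<Rightarrow> nat pmf" where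
  "pick_center n i j = iter_pmf (\<lambda>l j. bind_pmf (bernoulli_pmf (1 / (real l + 2)))
     (\<lambda>b. return_pmf (if b then n + l else j))) i j"

definition weight :: "('a \<Rightarrow> 'a \<Rightarrow> real) \<Rightarrow> 'a list \<Rightarrow> 'a \<Rightarrow> real" where
  "weight D cs p = (if cs = [] then 1 else nearest D (set cs) p)"

definition pick :: "('a \<Rightarrow> 'a \<Rightarrow> real) \<Rightarrow> 'a list \<Rightarrow> 'a list \<Rightarrow> nat pmf" where
  "pick D ps cs = bind_pmf (pick_point (\<lambda>i. weight D cs (ps ! i)) (length ps))
     (pick_center (length ps) (length cs))"

definition sample :: "('a \<Rightarrow> 'a \<Rightarrow> real) \<Rightarrow> 'a list \<Rightarrow> 'a list \<Rightarrow> 'a pmf" where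
  "sample D ps cs = map_pmf (nth (ps @ cs)) (pick D ps cs)"

definition add_center ::
  "('a::real_vector \<Rightarrow> 'a \<Rightarrow> real) \<Rightarrow> 'a list \<Rightarrow> nat \<Rightarrow> 'a list \<Rightarrow> 'a list pmf" where
  "add_center D ps M cs =
     map_pmf (\<lambda>v. cs @ [v]) (scaled_sum (1 / real M) (sample D ps cs) M)"

definition trial ::
  "('a::real_vector \<Rightarrow> 'a \<Rightarrow> real) \<Rightarrow> 'a list \<Rightarrow> nat \<Rightarrow> nat \<Rightarrow> 'a list pmf" where
  "trial D ps M k = iter_pmf (\<lambda>_. add_center D ps M) k []"

lemma set_pmf_pick_point: "n > 0 \<Longrightarrow> set_pmf (pick_point w n) \<subseteq> {..<n}"
proof -
  \<comment> \<open>Index 0 is held at the start, even if there are no points.\<close>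
  have "set_pmf (pick_point w n) \<subseteq> {..<n} \<union> {0}"
    by (induction n) (auto simp: pick_point_def)
  then show "n > 0 \<Longrightarrow> ?thesis" by auto
qed

lemma set_pmf_pick_center: "set_pmf (pick_center n i j) \<subseteq> {n..<n + i} \<union> {j}"
proof (induction i)
  case (Suc i)
  then show ?case
    by (fastforce simp: pick_center_def split: if_splits)
qed (simp add: pick_center_def)

lemma set_pmf_pick: "ps \<noteq> [] \<Longrightarrow> set_pmf (pick D ps cs) \<subseteq> {..<length (ps @ cs)}"
  using set_pmf_pick_point[of "length ps" "\<lambda>i. weight D cs (ps ! i)"]
    set_pmf_pick_center[of "length ps" "length cs"]
  by (fastforce simp: pick_def)

lemma set_pmf_sample: "ps \<noteq> [] \<Longrightarrow> set_pmf (sample D ps cs) \<subseteq> set ps \<union> set cs"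
  using set_pmf_pick[of ps D cs] nth_mem[of _ "ps @ cs"] by (fastforce simp: sample_def)

text \<open>Multiplying through by the total weight avoids a division, so that the case of vanishing
  weights is included.\<close>

lemma nn_integral_pick_point:
  assumes "\<And>q. q < n \<Longrightarrow> 0 \<le> w q"
  shows "(\<Sum>q<n. ennreal (w q) * f q) \<le> ennreal (\<Sum>q<n. w q) * (\<integral>\<^sup>+x. f x \<partial>pick_point w n)"
  using assms
proof (induction n)
  case 0
  then show ?case by simp
next
  case (Suc m)
  define W where "W = (\<Sum>q<m. w q)"
  have W: "W \<ge> 0" and w: "w m \<ge> 0" using Suc.prems by (auto simp: W_def intro!: sum_nonneg)
  show ?case
  proof (cases "W + w m = 0")
    case True
    then have "(\<Sum>q<Suc m. w q) = 0" by (simp add: W_def)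
    then have "\<forall>q\<in>{..<Suc m}. w q = 0"
      using Suc.prems by (subst (asm) sum_nonneg_eq_0_iff) auto
    then have "(\<Sum>q<Suc m. ennreal (w q) * f q) = 0" by (intro sum.neutral) auto
    then show ?thesis by (simp only: zero_le)
  next
    case False
    \<comment> \<open>The coin that admits item \<open>m\<close>; the factor \<open>1 - b\<close>
      rescales the earlier weights from total \<open>W\<close> to the new total.\<close>
    define b where "b = w m / (W + w m)"
    have pos: "W + w m > 0" using False W w by linarith
    have b: "0 \<le> b" "b \<le> 1" "(W + w m) * b = w m" "(W + w m) * (1 - b) = W"
      using pos W w by (auto simp: b_def field_simps)
    have "(\<Sum>q<Suc m. ennreal (w q) * f q)
        \<le> ennreal W * (\<integral>\<^sup>+x. f x \<partial>pick_point w m) + ennreal (w m) * f m"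
      using Suc by (simp add: W_def)
    also have "\<dots> = ennreal (W + w m) * (ennreal b * f m + ennreal (1 - b) * (\<integral>\<^sup>+x. f x \<partial>pick_point w m))"
      using pos b(1,2)
      by (simp add: distrib_left mult.assoc[symmetric] ennreal_mult[symmetric] b(3,4) add.commute)
    also have "ennreal b * f m + ennreal (1 - b) * (\<integral>\<^sup>+x. f x \<partial>pick_point w m)
        = (\<integral>\<^sup>+x. ennreal b * f m + ennreal (1 - b) * f x \<partial>pick_point w m)"
      by (simp add: nn_integral_add nn_integral_cmult)
    also have "\<dots> = (\<integral>\<^sup>+x. f x \<partial>pick_point w (Suc m))"
      unfolding pick_point_def iter_pmf.simps nn_integral_bind_pmf
      using b(1,2) by (simp add: b_def W_def mult.commute)
    finally show ?thesis by (simp add: W_def)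
  qed
qed

lemma nn_integral_pick_center:
  "(\<integral>\<^sup>+x. f x \<partial>pick_center n i j)
     = ennreal (1 / (real i + 1)) * f j + (\<Sum>l<i. ennreal (1 / (real i + 1)) * f (n + l))"
proof (induction i)
  case 0
  then show ?case by (simp add: pick_center_def)
next
  case (Suc i)
  define b where "b = 1 / (real i + 2)"
  have b: "0 \<le> b" "b \<le> 1" by (auto simp: b_def)
  have "(\<integral>\<^sup>+x. f x \<partial>pick_center n (Suc i) j)
      = (\<integral>\<^sup>+x. ennreal b * f (n + i) + ennreal (1 - b) * f x \<partial>pick_center n i j)"
    unfolding pick_center_def iter_pmf.simps nn_integral_bind_pmf
    using b by (simp add: b_def mult.commute)
  also have "\<dots> = ennreal b * f (n + i) + ennreal (1 - b) * (\<integral>\<^sup>+x. f x \<partial>pick_center n i j)"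
    by (simp add: nn_integral_add nn_integral_cmult)
  also have "\<dots> = ennreal b * f (n + i) + (ennreal b * f j + (\<Sum>l<i. ennreal b * f (n + l)))"
  proof -
    \<comment> \<open>An old item survives the new coin with probability (i + 1)/(i + 2), which
      brings all chances to 1/(i + 2).\<close>
    have "ennreal (1 - b) * ennreal (1 / (real i + 1)) = ennreal b"
      using b by (subst ennreal_mult'[symmetric]) (auto simp: b_def field_simps)
    then show ?thesis
      by (simp only: Suc.IH distrib_left sum_distrib_left mult.assoc[symmetric])
  qed
  finally show ?case by (simp add: b_def add_ac)
qed

text \<open>One part in \<open>i\<close> goes to the points, by weight, and one part to each center.
  Repeated centers are counted once in the sum over \<open>set cs\<close>, so only a lower bound is
  claimed.\<close>

lemma nn_integral_sample:
  fixes f :: "'a \<Rightarrow> ennreal"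
  assumes "distinct ps" and w: "\<And>p. p \<in> set ps \<Longrightarrow> 0 \<le> weight D cs p"
    and W: "0 < (\<Sum>p\<in>set ps. weight D cs p)"
  defines "i \<equiv> real (length cs) + 1"
  shows "(\<Sum>p\<in>set ps. ennreal (weight D cs p / (i * (\<Sum>p\<in>set ps. weight D cs p))) * f p)
      + ennreal (1 / i) * (\<Sum>c\<in>set cs. f c) \<le> (\<integral>\<^sup>+x. f x \<partial>sample D ps cs)"
proof -
  let ?w = "\<lambda>j. weight D cs (ps ! j)" and ?n = "length ps" and ?W = "\<Sum>p\<in>set ps. weight D cs p"
  have bij: "bij_betw ((!) ps) {..<?n} (set ps)" by (rule bij_betw_nth) (use assms in auto)
  have i: "i > 0" by (simp add: i_def add_nonneg_pos)
  have Wn: "(\<Sum>q<?n. ?w q) = ?W" by (rule sum.reindex_bij_betw[OF bij])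
  have "(\<Sum>q<?n. ennreal (?w q) * f (ps ! q)) \<le> ennreal ?W * (\<integral>\<^sup>+x. f ((ps @ cs) ! x) \<partial>pick_point ?w ?n)"
    using nn_integral_pick_point[of ?n ?w "\<lambda>x. f ((ps @ cs) ! x)"] w
    unfolding Wn by (simp add: nth_append)
  then have "ennreal (1 / (i * ?W)) * (\<Sum>q<?n. ennreal (?w q) * f (ps ! q))
      \<le> ennreal (1 / (i * ?W)) * (ennreal ?W * (\<integral>\<^sup>+x. f ((ps @ cs) ! x) \<partial>pick_point ?w ?n))"
    by (rule mult_left_mono) simp
  also have "\<dots> = ennreal (1 / i) * (\<integral>\<^sup>+x. f ((ps @ cs) ! x) \<partial>pick_point ?w ?n)"
    using W i by (simp add: mult.assoc[symmetric] ennreal_mult[symmetric])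
  also have "ennreal (1 / (i * ?W)) * (\<Sum>q<?n. ennreal (?w q) * f (ps ! q))
      = (\<Sum>q<?n. ennreal (?w q / (i * ?W)) * f (ps ! q))"
    unfolding sum_distrib_left[where r = "ennreal (1 / (i * ?W))"] mult.assoc[symmetric]
    using W i by (intro sum.cong refl arg_cong2[where f = "(*)"], subst ennreal_mult'[symmetric])
      (simp_all add: order_less_imp_le)
  also have "\<dots> = (\<Sum>p\<in>set ps. ennreal (weight D cs p / (i * ?W)) * f p)"
    by (rule sum.reindex_bij_betw[OF bij, of "\<lambda>p. ennreal (weight D cs p / (i * ?W)) * f p"])
  finally have 1: "(\<Sum>p\<in>set ps. ennreal (weight D cs p / (i * ?W)) * f p)
      \<le> ennreal (1 / i) * (\<integral>\<^sup>+x. f ((ps @ cs) ! x) \<partial>pick_point ?w ?n)" .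
  have "set cs = (!) cs ` {..<length cs}" by (auto simp: set_conv_nth)
  then have 2: "(\<Sum>c\<in>set cs. f c) \<le> (\<Sum>l<length cs. f (cs ! l))"
    using sum_image_le[of "{..<length cs}" f "(!) cs"] by simp
  have "(\<integral>\<^sup>+x. f x \<partial>sample D ps cs) = (\<integral>\<^sup>+x. (ennreal (1 / i) * f ((ps @ cs) ! x)
      + ennreal (1 / i) * (\<Sum>l<length cs. f (cs ! l))) \<partial>pick_point ?w ?n)"
    by (simp add: sample_def pick_def nn_integral_pick_center i_def sum_distrib_left add.commute nth_append)
  also have "\<dots> = ennreal (1 / i) * (\<integral>\<^sup>+x. f ((ps @ cs) ! x) \<partial>pick_point ?w ?n)
      + ennreal (1 / i) * (\<Sum>l<length cs. f (cs ! l))"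
    by (simp add: nn_integral_add nn_integral_cmult)
  finally show ?thesis using 1 2 by (simp add: add_mono mult_left_mono)
qed

text \<open>A partial sum need not lie in \<open>X\<close>, but rescaled by M/m it is a mean of m
  points of \<open>X\<close>; the induction runs on this.\<close>

lemma set_pmf_scaled_sum_convex:
  assumes "convex X" "set_pmf q \<subseteq> X" "M > 0"
  shows "set_pmf (scaled_sum (1 / real M) q M) \<subseteq> X"
proof -
  have "m > 0 \<longrightarrow> (real M / real m) *\<^sub>R v \<in> X" if "v \<in> set_pmf (scaled_sum (1 / real M) q m)" for m v
    using that
  proof (induction m arbitrary: v)
    case 0
    then show ?case by simp
  next
    case (Suc m)
    then obtain u x where u: "u \<in> set_pmf (scaled_sum (1 / real M) q m)" and x: "x \<in> X"
      and v: "v = u + (1 / real M) *\<^sub>R x"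
      using assms(2) by (auto simp: scaled_sum_def)
    show ?case
    proof (cases "m = 0")
      case True
      then have "u = 0" using u by (simp add: scaled_sum_def)
      then show ?thesis using True x v assms(3) by simp
    next
      case False
      \<comment> \<open>The mean of m + 1 points as a convex combination of the mean of m points and
        the new point.\<close>
      have "(real m / real (Suc m)) *\<^sub>R ((real M / real m) *\<^sub>R u) + (1 / real (Suc m)) *\<^sub>R x \<in> X"
        using Suc.IH[OF u] False x by (intro convexD[OF assms(1)]) (auto simp: field_simps)
      also have "(real m / real (Suc m)) *\<^sub>R ((real M / real m) *\<^sub>R u) + (1 / real (Suc m)) *\<^sub>R x
          = (real M / real (Suc m)) *\<^sub>R v"
        using False assms(3) by (simp add: v scaleR_add_right)
      finally show ?thesis by simp
    qed
  qed
  from this[of _ M] show ?thesis using assms(3) by auto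
qed

lemma set_pmf_trial_aux:
  assumes "convex X" "set ps \<subseteq> X" "ps \<noteq> []" "M > 0"
    and "cs \<in> set_pmf (iter_pmf (\<lambda>_. add_center D ps M) k [])"
  shows "length cs = k \<and> set cs \<subseteq> X"
  using assms(5)
proof (induction k arbitrary: cs)
  case 0
  then show ?case by simp
next
  case (Suc k)
  then obtain cs' where cs': "cs' \<in> set_pmf (iter_pmf (\<lambda>_. add_center D ps M) k [])"
    and "cs \<in> set_pmf (add_center D ps M cs')"
    by auto
  then obtain v where v: "v \<in> set_pmf (scaled_sum (1 / real M) (sample D ps cs') M)" and cs: "cs = cs' @ [v]"
    by (auto simp: add_center_def)
  have "set_pmf (sample D ps cs') \<subseteq> X"
    using set_pmf_sample[OF assms(3), of D cs'] Suc.IH[OF cs'] assms(2) by blast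
  then show ?case using set_pmf_scaled_sum_convex[OF assms(1) _ assms(4)] v Suc.IH[OF cs'] cs by auto
qed

lemma set_pmf_trial:
  assumes "convex X" "set ps \<subseteq> X" "ps \<noteq> []" "M > 0" "cs \<in> set_pmf (trial D ps M k)"
  shows "length cs = k" "set cs \<subseteq> X"
  using set_pmf_trial_aux[OF assms(1-4)] assms(5) by (auto simp: trial_def)

section \<open>Success probability of a trial\<close>

definition cost :: "('a \<Rightarrow> 'a \<Rightarrow> real) \<Rightarrow> 'a list \<Rightarrow> 'a list \<Rightarrow> real" where
  "cost D ps cs = (\<Sum>p\<in>set ps. nearest D (set cs) p)"

text \<open>Here \<open>asg\<close> is any assignment to \<open>k\<close> clusters; its optimality
  matters only when the clustering cost is compared with the true optimum. Bounding
  \<open>\<gamma>\<close> from above leaves room for a value that depends on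
  \<open>k\<^sup>2 / (\<mu> * \<epsilon>)\<close> alone.\<close>

locale kmedian_instance = similar_divergence B X D \<mu>
  for B :: "'a::real_vector \<Rightarrow> 'a \<Rightarrow> real" and X :: "'a set" and D :: "'a \<Rightarrow> 'a \<Rightarrow> real" and \<mu> :: real +
  fixes ps :: "'a list" and k M :: nat and \<epsilon> \<gamma> :: real and asg :: "'a \<Rightarrow> nat"
  assumes ps: "distinct ps" "set ps \<subseteq> X" "ps \<noteq> []"
    and \<epsilon>: "0 < \<epsilon>" "\<epsilon> \<le> 1 / 2"
    and M: "64 / (\<mu> * \<epsilon>) \<le> real M"
    and \<gamma>: "0 < \<gamma>" "\<gamma> \<le> \<epsilon>\<^sup>2 * \<mu>\<^sup>2 / (288 * (real k)\<^sup>2)"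
    and asg: "asg ` set ps \<subseteq> {..<k}"
begin

definition cl :: "nat \<Rightarrow> 'a set" where "cl j = {p \<in> set ps. asg p = j}"

definition opt :: real where "opt = (\<Sum>j<k. intra D (cl j))"

definition good :: "'a list \<Rightarrow> bool" where "good cs \<longleftrightarrow> cs \<noteq> [] \<and> cost D ps cs \<le> (1 + \<epsilon>) * opt"

text \<open>The slack \<open>\<epsilon> / 2\<close> is half of what is allowed overall; the rest
  pays for clusters that are not covered yet.\<close>

definition covered :: "nat \<Rightarrow> 'a list \<Rightarrow> bool" where
  "covered j cs \<longleftrightarrow> cs \<noteq> [] \<and>
     (\<Sum>p\<in>cl j. nearest D (set cs) p) \<le> (1 + \<epsilon> / 2) * intra D (cl j)"

text \<open>The invariant of a trial: unless the centers are good enough already, covered clusters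
  have kept pace with the number of centers. No matching between centers and clusters is
  recorded.\<close>

definition progress :: "'a list \<Rightarrow> bool" where
  "progress cs \<longleftrightarrow> good cs \<or>
     (\<exists>J\<subseteq>{..<k}. card J = length cs \<and> (\<forall>j\<in>J. covered j cs))"

lemma cl: "finite (cl j)" "cl j \<subseteq> set ps" "cl j \<subseteq> X"
  using ps by (auto simp: cl_def)

lemma sum_cl: "(\<Sum>j<k. \<Sum>p\<in>cl j. h p) = (\<Sum>p\<in>set ps. h p)"
  unfolding cl_def by (rule sum.group) (use asg in auto)

lemma k_pos: "k > 0"
  using ps(3) asg by (cases ps) auto

lemma M_pos: "M > 0"
proof -
  have "0 < 64 / (\<mu> * \<epsilon>)" using \<mu> \<epsilon> by simp
  with M show ?thesis by linarith
qed

lemma \<gamma>_le: "\<gamma> \<le> 1 / real k" "\<gamma> \<le> 1"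
proof -
  have "\<epsilon>\<^sup>2 * \<mu>\<^sup>2 \<le> 1 * 1" using \<epsilon> \<mu> by (intro mult_mono power_le_one) auto
  moreover have "real k \<le> 288 * (real k)\<^sup>2" using k_pos by (simp add: power2_eq_square)
  ultimately have "\<epsilon>\<^sup>2 * \<mu>\<^sup>2 / (288 * (real k)\<^sup>2) \<le> 1 / real k"
    using k_pos by (intro frac_le) auto
  with \<gamma> show "\<gamma> \<le> 1 / real k" by linarith
  moreover have "1 / real k \<le> 1" using k_pos by simp
  ultimately show "\<gamma> \<le> 1" by linarith
qed

lemma opt_nonneg: "0 \<le> opt"
  unfolding opt_def using cl by (intro sum_nonneg intra_nonneg) auto

lemma sum_nearest_append_le:
  "cs \<noteq> [] \<Longrightarrow> (\<Sum>p\<in>A. nearest D (set (cs @ [v])) p) \<le> (\<Sum>p\<in>A. nearest D (set cs) p)"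
  by (auto simp: nearest_insert intro!: sum_mono)

lemma good_append: "good cs \<Longrightarrow> good (cs @ [v])"
  using sum_nearest_append_le[of cs v "set ps"] by (auto simp: good_def cost_def)

lemma covered_append: "covered j cs \<Longrightarrow> covered j (cs @ [v])"
  using sum_nearest_append_le[of cs v "cl j"] by (auto simp: covered_def)

text \<open>Shared by all centers: \<open>\<pi>\<close> is the identity for the first center and
  later moves near points onto centers. Imitating uniform samples costs \<open>\<gamma> ^ M\<close>,
  concentration costs 1/2, and every mean within the concentration radius covers the
  cluster.\<close>

lemma sampled_mean_covers:
  assumes A: "cl j \<noteq> {}" and \<pi>: "\<pi> ` cl j \<subseteq> X" and q: "set_pmf q \<subseteq> X"
    and \<rho>: "(\<Sum>p\<in>cl j. Q (p - \<pi> p)) \<le> \<epsilon> / 8 * intra D (cl j)"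
    and dom: "\<And>f. (\<Sum>p\<in>cl j. ennreal (\<gamma> / card (cl j)) * f (\<pi> p)) \<le> (\<integral>\<^sup>+x. f x \<partial>measure_pmf q)"
  shows "ennreal (\<gamma> ^ M / 2)
    \<le> (\<integral>\<^sup>+v. indicator {v. covered j (cs @ [v])} v \<partial>scaled_sum (1 / real M) q M)"
proof -
  let ?A = "cl j" and ?u = "map_pmf \<pi> (pmf_of_set (cl j))"
  let ?m = "(1 / real (card (cl j))) *\<^sub>R (\<Sum>p\<in>cl j. \<pi> p)"
  let ?G = "{v. Q (v - ?m) \<le> 2 * ((\<Sum>p\<in>?A. Q (\<pi> p - ?m)) / card ?A) / M}"
  have n: "real (card ?A) > 0" using A cl(1) by (simp add: card_gt_0_iff)
  have "ennreal \<gamma> * (\<integral>\<^sup>+x. f x \<partial>?u) \<le> (\<integral>\<^sup>+x. f x \<partial>measure_pmf q)" for f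
  proof -
    have "ennreal \<gamma> * (\<integral>\<^sup>+x. f x \<partial>?u) = ennreal \<gamma> * ((\<Sum>p\<in>?A. f (\<pi> p)) / ennreal (card ?A))"
      using A cl(1) by (simp add: nn_integral_pmf_of_set ennreal_of_nat_eq_real_of_nat)
    also have "\<dots> = (ennreal \<gamma> / ennreal (card ?A)) * (\<Sum>p\<in>?A. f (\<pi> p))"
      by (simp add: divide_ennreal_def mult_ac)
    also have "\<dots> = (\<Sum>p\<in>?A. ennreal (\<gamma> / card ?A) * f (\<pi> p))"
      using n \<gamma> by (simp add: divide_ennreal sum_distrib_left)
    finally show ?thesis using dom by simp
  qed
  then have "ennreal (\<gamma> ^ M) * (\<integral>\<^sup>+v. indicator ?G v \<partial>scaled_sum (1 / real M) ?u M)
      \<le> (\<integral>\<^sup>+v. indicator ?G v \<partial>scaled_sum (1 / real M) q M)"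
    using \<gamma> by (intro nn_integral_scaled_sum_mono) auto
  moreover have "ennreal (\<gamma> ^ M / 2)
      \<le> ennreal (\<gamma> ^ M) * (\<integral>\<^sup>+v. indicator ?G v \<partial>scaled_sum (1 / real M) ?u M)"
  proof -
    have "ennreal (\<gamma> ^ M / 2) = ennreal (\<gamma> ^ M) * ennreal (1 / 2)"
      using \<gamma> by (subst ennreal_mult'[symmetric]) auto
    also have "\<dots> \<le> ennreal (\<gamma> ^ M) * (\<integral>\<^sup>+v. indicator ?G v \<partial>scaled_sum (1 / real M) ?u M)"
      by (intro mult_left_mono scaled_sum_uniform_concentration cl A M_pos) auto
    finally show ?thesis .
  qed
  moreover have "(\<integral>\<^sup>+v. indicator ?G v \<partial>scaled_sum (1 / real M) q M)
      \<le> (\<integral>\<^sup>+v. indicator {v. covered j (cs @ [v])} v \<partial>scaled_sum (1 / real M) q M)"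
  proof (rule nn_integral_mono_AE, rule AE_pmfI)
    fix v assume "v \<in> set_pmf (scaled_sum (1 / real M) q M)"
    then have v: "v \<in> X" using set_pmf_scaled_sum_convex[OF convex_X q M_pos] by blast
    have "covered j (cs @ [v])" if "v \<in> ?G"
    proof -
      have "(\<Sum>p\<in>?A. nearest D (set (cs @ [v])) p) \<le> (\<Sum>p\<in>?A. D p v)"
        by (intro sum_mono nearest_le) auto
      also have "\<dots> \<le> (1 + \<epsilon> / 2) * intra D ?A"
        using that cl by (intro cost_perturbed_mean[OF _ A _ \<pi> v \<epsilon> \<rho> M]) auto
      finally show ?thesis by (simp add: covered_def)
    qed
    then show "indicator ?G v \<le> (indicator {v. covered j (cs @ [v])} v :: ennreal)"
      by (simp add: indicator_def)
  qed
  ultimately show ?thesis by (meson order_trans)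
qed

lemma first_center_covers:
  obtains j where "j < k" "ennreal (\<gamma> ^ M / 2)
    \<le> (\<integral>\<^sup>+v. indicator {v. covered j ([] @ [v])} v \<partial>scaled_sum (1 / real M) (sample D ps []) M)"
proof -
  \<comment> \<open>Pigeonhole: some cluster has at least the average number of points, so uniform
    samples hit it with probability at least \<open>1 / k\<close>.\<close>
  have "\<exists>j<k. length ps \<le> k * card (cl j)"
  proof (rule ccontr)
    assume "\<not> ?thesis"
    then have "(\<Sum>j<k. k * card (cl j)) < (\<Sum>j<k. length ps)"
      using k_pos by (intro sum_strict_mono) (auto simp: not_le)
    moreover have "(\<Sum>j<k. card (cl j)) = length ps"
      using sum_cl[of "\<lambda>_. 1 :: nat"] ps(1) by (simp add: distinct_card)
    ultimately show False by (simp add: sum_distrib_left[symmetric])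
  qed
  then obtain j where j: "j < k" "length ps \<le> k * card (cl j)" by blast
  have n: "length ps > 0" using ps by simp
  then have A: "cl j \<noteq> {}" using j(2) by auto
  have card: "card (cl j) > 0" using A cl(1) by (simp add: card_gt_0_iff)
  have "real (length ps) \<le> real k * real (card (cl j))"
    using j(2) by (metis of_nat_le_iff of_nat_mult)
  then have "(1 / real k) / card (cl j) \<le> 1 / length ps"
    using n by (simp add: frac_le)
  then have le: "\<gamma> / card (cl j) \<le> 1 / length ps"
    using \<gamma>_le(1) card by (meson divide_right_mono of_nat_0_le_iff order_trans)
  have "(\<Sum>p\<in>cl j. ennreal (\<gamma> / card (cl j)) * f p) \<le> (\<integral>\<^sup>+x. f x \<partial>sample D ps [])" for f
  proof -
    have "(\<Sum>p\<in>cl j. ennreal (\<gamma> / card (cl j)) * f p) \<le> (\<Sum>p\<in>set ps. ennreal (1 / length ps) * f p)"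
      using le cl(2) by (intro order_trans[OF sum_mono sum_mono2]) (auto intro!: mult_right_mono ennreal_leI)
    also have "\<dots> \<le> (\<integral>\<^sup>+x. f x \<partial>sample D ps [])"
      using nn_integral_sample[of ps D "[]" f] ps(1) n by (simp add: weight_def distinct_card)
    finally show ?thesis .
  qed
  then have "ennreal (\<gamma> ^ M / 2)
    \<le> (\<integral>\<^sup>+v. indicator {v. covered j ([] @ [v])} v \<partial>scaled_sum (1 / real M) (sample D ps []) M)"
    using set_pmf_sample[of ps D "[]"] ps cl A \<epsilon>
    by (intro sampled_mean_covers[where \<pi> = "\<lambda>x. x"]) (auto simp: Q_zero intra_nonneg)
  then show ?thesis using that j(1) by blast
qed

text \<open>If every cluster outside \<open>J\<close> carried less than
  \<open>\<epsilon> / (3 * k)\<close> of the cost, all clusters together would cost at most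
  \<open>(1 + \<epsilon> / 2) * opt + \<epsilon> / 3 * cost D ps cs\<close>, and solving for the
  cost would make the centers good.\<close>

lemma expensive_uncovered_cluster:
  assumes cs: "cs \<noteq> []" "set cs \<subseteq> X" and "\<not> good cs" and J: "J \<subseteq> {..<k}" "\<forall>j\<in>J. covered j cs"
  obtains j where "j \<in> {..<k} - J" "\<epsilon> / (3 * k) * cost D ps cs \<le> (\<Sum>p\<in>cl j. nearest D (set cs) p)"
proof -
  have "\<exists>j\<in>{..<k} - J. \<epsilon> / (3 * k) * cost D ps cs \<le> (\<Sum>p\<in>cl j. nearest D (set cs) p)"
  proof (rule ccontr)
    assume *: "\<not> ?thesis"
    have c0: "0 \<le> cost D ps cs" unfolding cost_def using cs ps by (intro sum_nonneg nearest_nonneg) auto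
    have "cost D ps cs = (\<Sum>j<k. \<Sum>p\<in>cl j. nearest D (set cs) p)" by (simp add: cost_def sum_cl)
    also have "\<dots> \<le> (\<Sum>j<k. (1 + \<epsilon> / 2) * intra D (cl j) + \<epsilon> / (3 * k) * cost D ps cs)"
    proof (rule sum_mono)
      fix j assume j: "j \<in> {..<k}"
      have "0 \<le> (1 + \<epsilon> / 2) * intra D (cl j)" using \<epsilon> cl by (intro mult_nonneg_nonneg intra_nonneg) auto
      moreover have "0 \<le> \<epsilon> / (3 * k) * cost D ps cs" using \<epsilon> c0 by simp
      ultimately show "(\<Sum>p\<in>cl j. nearest D (set cs) p) \<le> (1 + \<epsilon> / 2) * intra D (cl j) + \<epsilon> / (3 * k) * cost D ps cs"
      proof (cases "j \<in> J")
        case True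
        then have "(\<Sum>p\<in>cl j. nearest D (set cs) p) \<le> (1 + \<epsilon> / 2) * intra D (cl j)"
          using J(2) by (simp add: covered_def)
        with \<open>0 \<le> \<epsilon> / (3 * k) * cost D ps cs\<close> show ?thesis by linarith
      next
        case False
        then have "\<not> \<epsilon> / (3 * k) * cost D ps cs \<le> (\<Sum>p\<in>cl j. nearest D (set cs) p)"
          using * j by blast
        with \<open>0 \<le> (1 + \<epsilon> / 2) * intra D (cl j)\<close> show ?thesis by linarith
      qed
    qed
    also have "\<dots> = (1 + \<epsilon> / 2) * opt + k * (\<epsilon> / (3 * k) * cost D ps cs)"
      by (simp add: sum.distrib opt_def sum_distrib_left)
    also have "k * (\<epsilon> / (3 * k) * cost D ps cs) = \<epsilon> / 3 * cost D ps cs" using k_pos by simp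
    finally have "(1 - \<epsilon> / 3) * cost D ps cs \<le> (1 + \<epsilon> / 2) * opt" by (simp add: algebra_simps)
    also have "\<dots> \<le> ((1 - \<epsilon> / 3) * (1 + \<epsilon>)) * opt"
    proof (rule mult_right_mono[OF _ opt_nonneg])
      \<comment> \<open>For positive \<open>\<epsilon>\<close> the claimed inequality amounts to
        \<open>\<epsilon> \<le> 1 / 2\<close>.\<close>
      have "\<epsilon> * \<epsilon> \<le> \<epsilon> * (1 / 2)" using \<epsilon> by (intro mult_left_mono) auto
      moreover have "(1 - \<epsilon> / 3) * (1 + \<epsilon>) = 1 + 2 / 3 * \<epsilon> - \<epsilon> * \<epsilon> / 3" by (simp add: field_simps)
      ultimately show "1 + \<epsilon> / 2 \<le> (1 - \<epsilon> / 3) * (1 + \<epsilon>)" by linarith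
    qed
    finally have "(1 - \<epsilon> / 3) * cost D ps cs \<le> (1 - \<epsilon> / 3) * ((1 + \<epsilon>) * opt)" by (simp add: mult.assoc)
    then have "cost D ps cs \<le> (1 + \<epsilon>) * opt" using \<epsilon> by (subst (asm) mult_le_cancel_left_pos) auto
    then show False using assms(3) cs by (simp add: good_def)
  qed
  then show ?thesis using that by blast
qed

lemma next_center_covers:
  assumes cs: "cs \<noteq> []" "set cs \<subseteq> X" "length cs < k" and c0: "0 < cost D ps cs"
    and j: "\<epsilon> / (3 * k) * cost D ps cs \<le> (\<Sum>p\<in>cl j. nearest D (set cs) p)"
  shows "ennreal (\<gamma> ^ M / 2)
    \<le> (\<integral>\<^sup>+v. indicator {v. covered j (cs @ [v])} v \<partial>scaled_sum (1 / real M) (sample D ps cs) M)"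
proof -
  define A where "A = cl j"
  define C where "C = set cs"
  \<comment> \<open>Makes \<open>12 * \<beta> / \<mu>\<close> equal to
    \<open>\<mu> * \<epsilon> / 8\<close>; the factor \<open>\<mu>\<close> is lost on passing from
    divergences to \<open>Q\<close>.\<close>
  define \<beta> where "\<beta> = \<epsilon> * \<mu>\<^sup>2 / 96"
  define \<Delta> where "\<Delta> = (\<Sum>p\<in>A. nearest D C p)"
  define N where "N = {p. p \<in> A \<and> nearest D C p * card A < \<beta> * \<Delta>}"
  define ct where "ct p = (SOME c. c \<in> C \<and> nearest D C p = D p c)" for p
  define \<pi> where "\<pi> p = (if p \<in> N then ct p else p)" for p
  define i where "i = real (length cs) + 1"
  have C: "finite C" "C \<noteq> {}" "C \<subseteq> X" using cs by (auto simp: C_def)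
  have ct: "ct p \<in> C" "nearest D C p = D p (ct p)" for p
    using someI_ex[of "\<lambda>c. c \<in> C \<and> nearest D C p = D p c"] nearest_obtain[OF C(1,2)]
    unfolding ct_def by metis+
  have "0 < \<epsilon> / (3 * k) * cost D ps cs" using \<epsilon> k_pos c0 by simp
  then have \<Delta>0: "\<Delta> > 0" using j by (simp add: \<Delta>_def A_def C_def)
  then have A: "A \<noteq> {}" "finite A" "A \<subseteq> X" "A \<subseteq> set ps" using cl by (auto simp: \<Delta>_def A_def)
  have n: "card A > 0" using A by (simp add: card_gt_0_iff)
  have i: "0 < i" "i \<le> k" using cs(3) by (simp_all add: i_def)
  have \<beta>: "0 < \<beta>" "6 * \<beta> \<le> \<mu>"
  proof -
    show "0 < \<beta>" using \<epsilon> \<mu> by (simp add: \<beta>_def)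
    have "\<epsilon> * \<mu>\<^sup>2 \<le> 1 * \<mu>" unfolding power2_eq_square
      using \<epsilon> \<mu> by (intro mult_mono) (auto intro: mult_left_le)
    then show "6 * \<beta> \<le> \<mu>" using \<mu> by (simp add: \<beta>_def)
  qed
  have "\<mu> * (\<Sum>p\<in>A. Q (p - \<pi> p)) = (\<Sum>p\<in>N. \<mu> * Q (p - \<pi> p))"
    unfolding sum_distrib_left using A(2) by (intro sum.mono_neutral_right) (auto simp: N_def \<pi>_def Q_zero)
  also have "\<dots> \<le> (\<Sum>p\<in>N. nearest D C p)"
  proof (rule sum_mono)
    fix p assume "p \<in> N"
    then show "\<mu> * Q (p - \<pi> p) \<le> nearest D C p"
      using D_lower[of p "ct p"] ct[of p] A(3) C(3) by (auto simp: \<pi>_def N_def)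
  qed
  also have "\<dots> \<le> 12 * \<beta> / \<mu> * intra D A"
    using near_points_negligible[OF A(2,1,3) C \<beta>] by (simp add: N_def \<Delta>_def)
  also have "\<dots> = \<mu> * (\<epsilon> / 8 * intra D A)" using \<mu> by (simp add: \<beta>_def power2_eq_square)
  finally have \<rho>: "(\<Sum>p\<in>A. Q (p - \<pi> p)) \<le> \<epsilon> / 8 * intra D A" using \<mu> by simp
  \<comment> \<open>A far point has divergence at least \<open>\<beta> * \<Delta> / card A\<close>,
    \<open>\<Delta>\<close> is at least \<open>\<epsilon> / (3 * k)\<close> of the cost, and
    \<open>i \<le> k\<close>. The product of these factors is the bound on \<open>\<gamma>\<close>,
    with 288 = 96 * 3.\<close>
  have far: "\<gamma> / card A \<le> nearest D C p / (i * cost D ps cs)" if "p \<in> A" "p \<notin> N" for p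
  proof -
    have "\<beta> * (\<epsilon> / (3 * k) * cost D ps cs) \<le> \<beta> * \<Delta>"
      using j \<beta> by (intro mult_left_mono) (auto simp: \<Delta>_def A_def C_def)
    also have "\<dots> \<le> nearest D C p * card A" using that by (simp add: N_def)
    finally have 1: "\<beta> * (\<epsilon> / (3 * k) * cost D ps cs) \<le> nearest D C p * card A" .
    have "\<gamma> * (i * cost D ps cs) \<le> \<epsilon>\<^sup>2 * \<mu>\<^sup>2 / (288 * (real k)\<^sup>2) * (k * cost D ps cs)"
      using \<gamma> i c0 by (intro mult_mono) auto
    also have "\<dots> = \<beta> * (\<epsilon> / (3 * k) * cost D ps cs)"
      using k_pos by (simp add: \<beta>_def power2_eq_square)
    finally have "\<gamma> * (i * cost D ps cs) \<le> nearest D C p * card A" using 1 by simp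
    then show ?thesis using n i c0 by (simp add: divide_simps)
  qed
  have dom: "(\<Sum>p\<in>A. ennreal (\<gamma> / card A) * f (\<pi> p)) \<le> (\<integral>\<^sup>+x. f x \<partial>sample D ps cs)" for f
  proof -
    have w: "weight D cs p = nearest D C p" for p using cs by (simp add: weight_def C_def)
    have W: "(\<Sum>p\<in>set ps. nearest D C p) = cost D ps cs" by (simp add: cost_def C_def)
    have "(\<Sum>p\<in>A. ennreal (\<gamma> / card A) * f (\<pi> p))
        = (\<Sum>p\<in>A - N. ennreal (\<gamma> / card A) * f (\<pi> p)) + (\<Sum>p\<in>N. ennreal (\<gamma> / card A) * f (\<pi> p))"
      by (rule sum.subset_diff) (use A in \<open>auto simp: N_def\<close>)
    also have "\<dots> \<le> (\<Sum>p\<in>set ps. ennreal (nearest D C p / (i * cost D ps cs)) * f p)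
        + ennreal (1 / i) * (\<Sum>c\<in>C. f c)"
    proof (rule add_mono)
      have "(\<Sum>p\<in>A - N. ennreal (\<gamma> / card A) * f (\<pi> p))
          \<le> (\<Sum>p\<in>A - N. ennreal (nearest D C p / (i * cost D ps cs)) * f p)"
        using far by (intro sum_mono) (auto simp: \<pi>_def intro!: mult_right_mono ennreal_leI)
      also have "\<dots> \<le> (\<Sum>p\<in>set ps. ennreal (nearest D C p / (i * cost D ps cs)) * f p)"
        using A(4) by (intro sum_mono2) auto
      finally show "(\<Sum>p\<in>A - N. ennreal (\<gamma> / card A) * f (\<pi> p))
          \<le> (\<Sum>p\<in>set ps. ennreal (nearest D C p / (i * cost D ps cs)) * f p)" .
      \<comment> \<open>All near points might be moved onto one and the same center, so each center
        is charged the full mass \<open>\<gamma>\<close>; the share \<open>1 / i\<close> of every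
        center is at least that large.\<close>
      have "(\<Sum>p\<in>N. ennreal (\<gamma> / card A) * f (\<pi> p)) \<le> (\<Sum>p\<in>N. ennreal (\<gamma> / card A) * (\<Sum>c\<in>C. f c))"
        using ct C(1) by (intro sum_mono mult_left_mono) (auto simp: \<pi>_def intro!: member_le_sum)
      also have "\<dots> \<le> (\<Sum>p\<in>A. ennreal (\<gamma> / card A) * (\<Sum>c\<in>C. f c))"
        using A(2) by (intro sum_mono2) (auto simp: N_def)
      also have "\<dots> = ennreal (real (card A)) * ennreal (\<gamma> / card A) * (\<Sum>c\<in>C. f c)"
        by (simp add: ennreal_of_nat_eq_real_of_nat mult.assoc)
      also have "ennreal (real (card A)) * ennreal (\<gamma> / card A) = ennreal \<gamma>"
        using n by (subst ennreal_mult'[symmetric]) auto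
      also have "ennreal \<gamma> * (\<Sum>c\<in>C. f c) \<le> ennreal (1 / i) * (\<Sum>c\<in>C. f c)"
      proof (intro mult_right_mono ennreal_leI)
        show "\<gamma> \<le> 1 / i" using \<gamma>_le(1) i by (smt (verit) frac_le)
      qed simp
      finally show "(\<Sum>p\<in>N. ennreal (\<gamma> / card A) * f (\<pi> p)) \<le> ennreal (1 / i) * (\<Sum>c\<in>C. f c)" .
    qed
    also have "\<dots> \<le> (\<integral>\<^sup>+x. f x \<partial>sample D ps cs)"
      using nn_integral_sample[of ps D cs f] ps(1,2) nearest_nonneg[OF C] c0
      unfolding w W i_def[symmetric] C_def[symmetric] by (auto simp: subset_iff)
    finally show ?thesis .
  qed
  show ?thesis
  proof (rule sampled_mean_covers[where \<pi> = \<pi>])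
    show "\<pi> ` cl j \<subseteq> X" using A C ct by (auto simp: \<pi>_def A_def)
    show "set_pmf (sample D ps cs) \<subseteq> X" using set_pmf_sample[of ps D cs] ps cs by blast
  qed (use A \<rho> dom in \<open>auto simp: A_def\<close>)
qed

lemma add_center_progress:
  assumes cs: "set cs \<subseteq> X" "length cs < k" and "progress cs"
  shows "ennreal (\<gamma> ^ M / 2) \<le> (\<integral>\<^sup>+cs'. indicator {cs'. progress cs'} cs' \<partial>add_center D ps M cs)"
proof (cases "good cs")
  case True
  \<comment> \<open>Good centers stay good, so progress is certain in this case.\<close>
  have "\<gamma> ^ M \<le> 1" using \<gamma> \<gamma>_le by (intro power_le_one) auto
  then have "ennreal (\<gamma> ^ M / 2) \<le> 1" by (simp add: ennreal_le_1)
  also have "1 = (\<integral>\<^sup>+cs'. indicator {cs'. progress cs'} cs' \<partial>add_center D ps M cs)"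
    using True by (simp add: add_center_def progress_def good_append indicator_def)
  finally show ?thesis .
next
  case False
  then obtain J where J: "J \<subseteq> {..<k}" "card J = length cs" "\<forall>j\<in>J. covered j cs"
    using assms(3) by (auto simp: progress_def)
  obtain j where j: "j \<in> {..<k} - J" "ennreal (\<gamma> ^ M / 2)
    \<le> (\<integral>\<^sup>+v. indicator {v. covered j (cs @ [v])} v \<partial>scaled_sum (1 / real M) (sample D ps cs) M)"
  proof (cases "cs = []")
    case True
    then show ?thesis using that first_center_covers J finite_subset[OF J(1)] by auto
  next
    case c: False
    obtain j where j: "j \<in> {..<k} - J" "\<epsilon> / (3 * k) * cost D ps cs \<le> (\<Sum>p\<in>cl j. nearest D (set cs) p)"
      using expensive_uncovered_cluster[OF c cs(1) False J(1,3)] .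
    \<comment> \<open>Centers of cost 0 would be good, so the divergences that determine the next
      draw do not all vanish.\<close>
    have "0 \<le> (1 + \<epsilon>) * opt" using opt_nonneg \<epsilon> by simp
    then have "0 < cost D ps cs" using False c by (simp add: good_def)
    then show ?thesis using that j next_center_covers[OF c cs] by blast
  qed
  note j(2)
  also have "(\<integral>\<^sup>+v. indicator {v. covered j (cs @ [v])} v \<partial>scaled_sum (1 / real M) (sample D ps cs) M)
      \<le> (\<integral>\<^sup>+v. indicator {cs'. progress cs'} (cs @ [v]) \<partial>scaled_sum (1 / real M) (sample D ps cs) M)"
  proof (intro nn_integral_mono)
    fix v
    have "progress (cs @ [v])" if "covered j (cs @ [v])"
      unfolding progress_def
    proof (intro disjI2 exI[of _ "insert j J"] conjI)
      show "card (insert j J) = length (cs @ [v])"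
        using j(1) J finite_subset[OF J(1)] by simp
    qed (use that j(1) J covered_append in auto)
    then show "indicator {v. covered j (cs @ [v])} v \<le> (indicator {cs'. progress cs'} (cs @ [v]) :: ennreal)"
      by (simp add: indicator_def)
  qed
  finally show ?thesis by (simp add: add_center_def)
qed

text \<open>As there are only \<open>k\<close> clusters, \<open>k\<close> covered ones are all of
  them, which gives even the factor \<open>1 + \<epsilon> / 2\<close>.\<close>

lemma progress_complete: "progress cs \<Longrightarrow> length cs = k \<Longrightarrow> good cs"
proof -
  assume "progress cs" "length cs = k"
  moreover have "good cs" if "J \<subseteq> {..<k}" "card J = k" "\<forall>j\<in>J. covered j cs" for J
  proof -
    have J: "J = {..<k}" using that by (intro card_subset_eq) auto
    then have "covered 0 cs" using that k_pos by auto
    then have "cs \<noteq> []" by (simp add: covered_def)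
    moreover have "cost D ps cs \<le> (\<Sum>j<k. (1 + \<epsilon> / 2) * intra D (cl j))"
      unfolding cost_def sum_cl[symmetric] using that J by (intro sum_mono) (auto simp: covered_def)
    moreover have "(\<Sum>j<k. (1 + \<epsilon> / 2) * intra D (cl j)) \<le> (1 + \<epsilon>) * opt"
      unfolding opt_def sum_distrib_left using \<epsilon> cl
      by (intro sum_mono mult_right_mono intra_nonneg) auto
    ultimately show ?thesis by (simp add: good_def)
  qed
  ultimately show ?thesis by (auto simp: progress_def)
qed

theorem trial_success:
  "ennreal ((\<gamma> ^ M / 2) ^ k) \<le> emeasure (trial D ps M k) {cs. good cs}"
proof -
  have "m \<le> k \<Longrightarrow> ennreal ((\<gamma> ^ M / 2) ^ m)
      \<le> (\<integral>\<^sup>+cs. indicator {cs. progress cs} cs \<partial>iter_pmf (\<lambda>_. add_center D ps M) m [])" for m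
  proof (induction m)
    case 0
    have "progress []" unfolding progress_def by (intro disjI2 exI[of _ "{}"]) auto
    then show ?case by simp
  next
    case (Suc m)
    have "ennreal ((\<gamma> ^ M / 2) ^ Suc m) = ennreal (\<gamma> ^ M / 2) * ennreal ((\<gamma> ^ M / 2) ^ m)"
      using \<gamma> by (subst ennreal_mult'[symmetric]) auto
    also have "\<dots> \<le> ennreal (\<gamma> ^ M / 2) *
        (\<integral>\<^sup>+cs. indicator {cs. progress cs} cs \<partial>iter_pmf (\<lambda>_. add_center D ps M) m [])"
      using Suc by (intro mult_left_mono) auto
    also have "\<dots> = (\<integral>\<^sup>+cs. ennreal (\<gamma> ^ M / 2) * indicator {cs. progress cs} cs
        \<partial>iter_pmf (\<lambda>_. add_center D ps M) m [])"
      by (simp add: nn_integral_cmult)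
    also have "\<dots> \<le> (\<integral>\<^sup>+cs. (\<integral>\<^sup>+cs'. indicator {cs'. progress cs'} cs' \<partial>add_center D ps M cs)
        \<partial>iter_pmf (\<lambda>_. add_center D ps M) m [])"
    proof (rule nn_integral_mono_AE, rule AE_pmfI)
      fix cs assume "cs \<in> set_pmf (iter_pmf (\<lambda>_. add_center D ps M) m [])"
      then have "length cs = m" "set cs \<subseteq> X"
        using set_pmf_trial_aux[OF convex_X ps(2,3) M_pos] by auto
      then show "ennreal (\<gamma> ^ M / 2) * indicator {cs. progress cs} cs
          \<le> (\<integral>\<^sup>+cs'. indicator {cs'. progress cs'} cs' \<partial>add_center D ps M cs)"
        using add_center_progress[of cs] Suc.prems by (cases "progress cs") auto
    qed
    finally show ?case by simp
  qed
  from this[of k] have "ennreal ((\<gamma> ^ M / 2) ^ k)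
      \<le> (\<integral>\<^sup>+cs. indicator {cs. progress cs} cs \<partial>trial D ps M k)"
    by (simp add: trial_def)
  also have "\<dots> \<le> (\<integral>\<^sup>+cs. indicator {cs. good cs} cs \<partial>trial D ps M k)"
    using set_pmf_trial(1)[OF convex_X ps(2,3) M_pos] progress_complete
    by (intro nn_integral_mono_AE AE_pmfI) (auto simp: indicator_def)
  finally show ?thesis by simp
qed

end

text \<open>The empty list means that no trial has been made yet; the outcome of the first trial
  always replaces it.\<close>

definition search ::
  "('a::real_vector \<Rightarrow> 'a \<Rightarrow> real) \<Rightarrow> 'a list \<Rightarrow> nat \<Rightarrow> nat \<Rightarrow> nat \<Rightarrow> 'a list pmf" where
  "search D ps M k N = iter_pmf (\<lambda>_ b. map_pmf
     (\<lambda>cs. if b = [] \<or> cost D ps cs < cost D ps b then cs else b) (trial D ps M k)) N []"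

lemma set_pmf_search:
  assumes "convex X" "set ps \<subseteq> X" "ps \<noteq> []" "M > 0" "k > 0" "b \<in> set_pmf (search D ps M k N)"
  shows "set b \<subseteq> X" "if N = 0 then b = [] else length b = k"
proof -
  have "set b \<subseteq> X \<and> (if N = 0 then b = [] else length b = k)"
    using assms(6)
  proof (induction N arbitrary: b)
    case 0
    then show ?case by (simp add: search_def)
  next
    case (Suc N)
    then obtain b' cs where "b' \<in> set_pmf (search D ps M k N)" "cs \<in> set_pmf (trial D ps M k)"
      and b: "b = (if b' = [] \<or> cost D ps cs < cost D ps b' then cs else b')"
      by (auto simp: search_def)
    with Suc.IH[of b'] set_pmf_trial[OF assms(1-4), of cs D k] assms(5) show ?case
      by (auto split: if_splits)
  qed
  then show "set b \<subseteq> X" "if N = 0 then b = [] else length b = k" by auto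
qed

context kmedian_instance
begin

text \<open>The list kept is good as soon as one trial was good, so failure requires all
  \<open>N\<close> independent trials to fail.\<close>

lemma search_failure:
  "emeasure (search D ps M k N) {b. \<not> good b} \<le> ennreal ((1 - (\<gamma> ^ M / 2) ^ k) ^ N)"
proof (induction N)
  case 0
  then show ?case by (simp add: search_def good_def)
next
  case (Suc N)
  define r where "r = (\<gamma> ^ M / 2) ^ k"
  have "\<gamma> ^ M \<le> 1" using \<gamma> \<gamma>_le by (intro power_le_one) auto
  then have r: "0 \<le> r" "r \<le> 1" using \<gamma> unfolding r_def by (auto intro!: power_le_one)
  let ?t = "measure_pmf (trial D ps M k)"
  have "r \<le> measure ?t {cs. good cs}"
    using trial_success by (simp add: measure_pmf.emeasure_eq_measure r_def)
  moreover have "measure ?t {cs. \<not> good cs} = 1 - measure ?t {cs. good cs}"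
    using measure_pmf.prob_compl[of "{cs. good cs}" "trial D ps M k"]
    by (simp add: Compl_eq_Diff_UNIV[symmetric] Collect_neg_eq[symmetric])
  ultimately have fail: "emeasure ?t {cs. \<not> good cs} \<le> ennreal (1 - r)"
    by (simp add: measure_pmf.emeasure_eq_measure ennreal_leI)
  have "emeasure (search D ps M k (Suc N)) {b. \<not> good b}
      = (\<integral>\<^sup>+b. indicator {b. \<not> good b} b \<partial>search D ps M k (Suc N))"
    by simp
  also have "\<dots> = (\<integral>\<^sup>+b. (\<integral>\<^sup>+cs. indicator {b. \<not> good b}
      (if b = [] \<or> cost D ps cs < cost D ps b then cs else b) \<partial>trial D ps M k) \<partial>search D ps M k N)"
    unfolding search_def by (simp only: iter_pmf.simps nn_integral_bind_pmf nn_integral_map_pmf)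
  also have "\<dots> \<le> (\<integral>\<^sup>+b. ennreal (1 - r) * indicator {b. \<not> good b} b \<partial>search D ps M k N)"
  proof (rule nn_integral_mono)
    fix b
    \<comment> \<open>Since \<open>good\<close> demands non-emptiness, replacing a good list by a
      cheaper one preserves it because trials return non-empty lists.\<close>
    have len: "AE cs in ?t. cs \<noteq> []"
      using set_pmf_trial(1)[OF convex_X ps(2,3) M_pos] k_pos by (intro AE_pmfI) fastforce
    show "(\<integral>\<^sup>+cs. indicator {b. \<not> good b}
        (if b = [] \<or> cost D ps cs < cost D ps b then cs else b) \<partial>trial D ps M k)
      \<le> ennreal (1 - r) * indicator {b. \<not> good b} b"
    proof (cases "good b")
      case True
      have "(\<integral>\<^sup>+cs. indicator {b. \<not> good b}
        (if b = [] \<or> cost D ps cs < cost D ps b then cs else b) \<partial>trial D ps M k)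
        \<le> (\<integral>\<^sup>+cs. 0 \<partial>trial D ps M k)"
        by (rule nn_integral_mono_AE, rule AE_mp[OF len], rule AE_I2)
          (use True in \<open>auto simp: good_def indicator_def\<close>)
      then show ?thesis by simp
    next
      case False
      have "(\<integral>\<^sup>+cs. indicator {b. \<not> good b}
        (if b = [] \<or> cost D ps cs < cost D ps b then cs else b) \<partial>trial D ps M k)
        \<le> (\<integral>\<^sup>+cs. indicator {b. \<not> good b} cs \<partial>trial D ps M k)"
        by (intro nn_integral_mono) (auto simp: good_def indicator_def)
      then show ?thesis using fail False by simp
    qed
  qed
  also have "\<dots> = ennreal (1 - r) * emeasure (search D ps M k N) {b. \<not> good b}"
    by (simp add: nn_integral_cmult)
  also have "\<dots> \<le> ennreal (1 - r) * ennreal ((1 - r) ^ N)"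
    using Suc by (intro mult_left_mono) (auto simp: r_def)
  also have "\<dots> = ennreal ((1 - r) ^ Suc N)" using r by (subst ennreal_mult'[symmetric]) auto
  finally show ?case by (simp add: r_def)
qed

lemma search_success:
  "1 - (1 - (\<gamma> ^ M / 2) ^ k) ^ N \<le> measure_pmf.prob (search D ps M k N) {b. good b}"
proof -
  have "\<gamma> ^ M \<le> 1" using \<gamma> \<gamma>_le by (intro power_le_one) auto
  then have "(\<gamma> ^ M / 2) ^ k \<le> 1" using \<gamma> by (auto intro!: power_le_one)
  then have "measure_pmf.prob (search D ps M k N) {b. \<not> good b} \<le> (1 - (\<gamma> ^ M / 2) ^ k) ^ N"
    using search_failure[of N] by (simp add: measure_pmf.emeasure_eq_measure)
  then show ?thesis
    using measure_pmf.prob_compl[of "{b. good b}" "search D ps M k N"]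
    by (simp add: Compl_eq_Diff_UNIV[symmetric] Collect_neg_eq[symmetric])
qed

end

section \<open>The program\<close>

lemma nreg_set_nreg [simp]: "nreg (set_nreg x m s) = (nreg s)(x := m)"
  and rarr_set_nreg [simp]: "rarr (set_nreg x m s) = rarr s"
  and nreg_set_cell [simp]: "nreg (set_cell A i r s) = nreg s"
  and rarr_set_cell [simp]: "rarr (set_cell A i r s) = (rarr s)(A := (rarr s A)(i := r))"
  by (simp_all add: set_nreg_def set_cell_def)

definition same :: "string set \<Rightarrow> string set \<Rightarrow> state \<Rightarrow> state \<Rightarrow> bool" where
  "same R A s s' \<longleftrightarrow> (\<forall>x. x \<notin> R \<longrightarrow> nreg s' x = nreg s x) \<and> (\<forall>x. x \<notin> A \<longrightarrow> rarr s' x = rarr s x)"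

lemma same_refl [simp]: "same R A s s"
  by (simp add: same_def)

lemma same_set_nreg [simp]: "same R A s s' \<Longrightarrow> x \<in> R \<Longrightarrow> same R A s (set_nreg x m s')"
  and same_set_cell [simp]: "same R A s s' \<Longrightarrow> B \<in> A \<Longrightarrow> same R A s (set_cell B i r s')"
  by (auto simp: same_def)

lemma same_nreg: "same R A s s' \<Longrightarrow> x \<notin> R \<Longrightarrow> nreg s' x = nreg s x"
  and same_rarr: "same R A s s' \<Longrightarrow> B \<notin> A \<Longrightarrow> rarr s' B = rarr s B"
  by (auto simp: same_def)

lemma same_trans:
  "same R A s s' \<Longrightarrow> same R' A' s' s'' \<Longrightarrow> R' \<subseteq> R \<Longrightarrow> A' \<subseteq> A \<Longrightarrow> same R A s s''"
  by (fastforce simp: same_def)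

lemma sim_Assign:
  "Q (set_nreg x (nval e s) s) a \<Longrightarrow> 1 + ncost e \<le> \<tau> \<Longrightarrow> sim (exec D d (Assign x e) s) \<tau> (return_pmf a) Q"
  by (auto intro: sim_return)

lemma sim_Skip: "Q s a \<Longrightarrow> 1 \<le> \<tau> \<Longrightarrow> sim (exec D d Skip s) \<tau> (return_pmf a) Q"
  by (auto intro: sim_return)

lemma surely_Assign:
  "Q (set_nreg x (nval e s) s) \<Longrightarrow> 1 + ncost e \<le> \<tau> \<Longrightarrow> surely (exec D d (Assign x e) s) \<tau> Q"
  by (auto intro: surely_return)

lemma surely_Skip: "Q s \<Longrightarrow> 1 \<le> \<tau> \<Longrightarrow> surely (exec D d Skip s) \<tau> Q"
  by (auto intro: surely_return)

lemma surely_Store: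
  "Q (set_cell A (nval i s) (rval D d r s) s) \<Longrightarrow> 1 + ncost i + rcost d r \<le> \<tau> \<Longrightarrow>
    surely (exec D d (Store A i r) s) \<tau> Q"
  by (auto intro: surely_return)

lemma andthen_return: "andthen (return_pmf (s, t)) f = tick t (f s)"
  by (simp add: andthen_def bind_return_pmf)

lemma sim_Assign_Seq:
  assumes "sim (exec D d c (set_nreg x (nval e s) s)) \<tau> F Q" "1 + ncost e + \<tau> \<le> \<tau>'"
  shows "sim (exec D d (Seq (Assign x e) c) s) \<tau>' F Q"
  using sim_mono[OF sim_tick[OF assms(1)] assms(2)] by (simp add: andthen_return)

lemma sim_Store_Seq:
  assumes "sim (exec D d c (set_cell A (nval i s) (rval D d r s) s)) \<tau> F Q"
    "1 + ncost i + rcost d r + \<tau> \<le> \<tau>'"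
  shows "sim (exec D d (Seq (Store A i r) c) s) \<tau>' F Q"
  using sim_mono[OF sim_tick[OF assms(1)] assms(2)] by (simp add: andthen_return)

lemma surely_Store_Seq:
  assumes "surely (exec D d c (set_cell A (nval i s) (rval D d r s) s)) \<tau> Q"
    "1 + ncost i + rcost d r + \<tau> \<le> \<tau>'"
  shows "surely (exec D d (Seq (Store A i r) c) s) \<tau>' Q"
  using surely_mono[OF surely_tick[OF assms(1)] assms(2)] by (simp add: andthen_return)

lemma sim_Coin':
  assumes "rval D d r s = x" "\<And>b. sim (exec D d (if b then c1 else c2) s) \<tau> (G b) Q"
    "1 + rcost d r + \<tau> \<le> \<tau>'"
  shows "sim (exec D d (Coin r c1 c2) s) \<tau>' (bind_pmf (bernoulli_pmf x) G) Q"
proof -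
  have "sim (exec D d (Coin r c1 c2) s) (1 + rcost d r + \<tau>) (bind_pmf (bernoulli_pmf x) G) Q"
    unfolding assms(1)[symmetric] by (rule sim_Coin) (fact assms)
  then show ?thesis by (rule sim_mono) (fact assms)+
qed

lemma sim_For':
  assumes "nat \<lceil>rval D d r s\<rceil> = m" "Q 0 s a"
    and "\<And>i s a. i < m \<Longrightarrow> Q i s a \<Longrightarrow> sim (exec D d c (set_nreg x i s)) \<tau> (G i a) (Q (Suc i))"
    and "1 + rcost d r + m * (1 + \<tau>) \<le> \<tau>'" "\<And>s a. Q m s a \<Longrightarrow> Q' s a"
  shows "sim (exec D d (For x r c) s) \<tau>' (iter_pmf G m a) Q'"
proof -
  have "sim (exec D d (For x r c) s) (1 + rcost d r + m * (1 + \<tau>)) (iter_pmf G m a) (Q m)"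
    by (rule sim_For; fact assms)
  then show ?thesis by (rule sim_mono) (use assms(4,5) in blast)+
qed

lemma surely_For':
  assumes "nat \<lceil>rval D d r s\<rceil> = m" "Q 0 s"
    and "\<And>i s. i < m \<Longrightarrow> Q i s \<Longrightarrow> surely (exec D d c (set_nreg x i s)) \<tau> (Q (Suc i))"
    and "1 + rcost d r + m * (1 + \<tau>) \<le> \<tau>'" "\<And>s. Q m s \<Longrightarrow> Q' s"
  shows "surely (exec D d (For x r c) s) \<tau>' Q'"
  using surely_mono[OF surely_For[OF assms(1,2,3)] assms(4)] assms(5) by blast

lemma sim_map: "sim p \<tau> F (\<lambda>s a. Q s (g a)) \<Longrightarrow> sim p \<tau> (map_pmf g F) Q"
  unfolding sim_def pmf.rel_map
  by (erule pmf.rel_mono_strong) auto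

text \<open>Register \<open>s\<close> is the reservoir and cell 0 of \<open>S\<close> the prefix
  sum. The sum is updated before the coin is flipped, so that it includes the current
  weight.\<close>

definition pick_com :: com where
  "pick_com =
    Seq (Assign ''s'' (NConst 0))
    (Seq (Store ''S'' (NConst 0) (OfNat (NConst 0)))
    (Seq (For ''p'' (OfNat (NVar ''n''))
      (Seq (Store ''S'' (NConst 0) (RAdd (Cell ''S'' (NConst 0)) (Cell ''W'' (NVar ''p''))))
        (Coin (RDiv (Cell ''W'' (NVar ''p'')) (Cell ''S'' (NConst 0)))
          (Assign ''s'' (NVar ''p'')) Skip)))
    (For ''l'' (OfNat (NVar ''i''))
      (Coin (RDiv (OfNat (NConst 1)) (OfNat (NAdd (NVar ''l'') (NConst 2))))
        (Assign ''s'' (NAdd (NVar ''n'') (NVar ''l''))) Skip))))"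

lemma sim_pick:
  assumes "nreg s ''n'' = n" "nreg s ''i'' = i" "\<And>p. p < n \<Longrightarrow> rarr s ''W'' p = w p"
  shows "sim (exec D d pick_com s) (30 * (n + i + 1))
    (bind_pmf (pick_point w n) (pick_center n i))
    (\<lambda>s' j. same {''s'', ''p'', ''l''} {''S''} s s' \<and> nreg s' ''s'' = j)"
proof -
  let ?same = "same {''s'', ''p'', ''l''} {''S''} s"
  have points: "sim (exec D d (For ''p'' (OfNat (NVar ''n''))
      (Seq (Store ''S'' (NConst 0) (RAdd (Cell ''S'' (NConst 0)) (Cell ''W'' (NVar ''p''))))
        (Coin (RDiv (Cell ''W'' (NVar ''p'')) (Cell ''S'' (NConst 0)))
          (Assign ''s'' (NVar ''p'')) Skip))) s1) (3 + 17 * n) (pick_point w n)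
      (\<lambda>s' j. ?same s' \<and> nreg s' ''s'' = j)"
    if s1: "?same s1" "nreg s1 ''s'' = 0" "rarr s1 ''S'' 0 = 0" for s1
    unfolding pick_point_def
  proof (rule sim_For'[where \<tau> = 16 and
        Q = "\<lambda>m s' j. ?same s' \<and> nreg s' ''s'' = j \<and> rarr s' ''S'' 0 = (\<Sum>q<m. w q)"])
    show "nat \<lceil>rval D d (OfNat (NVar ''n'')) s1\<rceil> = n" using assms(1) by (simp add: same_nreg[OF s1(1)])
  next
    fix m s' j
    assume m: "m < n" and I: "?same s' \<and> nreg s' ''s'' = j \<and> rarr s' ''S'' 0 = (\<Sum>q<m. w q)"
    then have W: "rarr s' ''W'' m = w m" using assms(3)[OF m] by (auto simp: same_def)
    show "sim (exec D d (Seq (Store ''S'' (NConst 0) (RAdd (Cell ''S'' (NConst 0)) (Cell ''W'' (NVar ''p''))))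
        (Coin (RDiv (Cell ''W'' (NVar ''p'')) (Cell ''S'' (NConst 0)))
          (Assign ''s'' (NVar ''p'')) Skip)) (set_nreg ''p'' m s')) 16
      (bind_pmf (bernoulli_pmf (w m / (\<Sum>q<Suc m. w q))) (\<lambda>b. return_pmf (if b then m else j)))
      (\<lambda>s' j. ?same s' \<and> nreg s' ''s'' = j \<and> rarr s' ''S'' 0 = (\<Sum>q<Suc m. w q))"
    proof (rule sim_Store_Seq, rule sim_Coin')
      fix b
      show "sim (exec D d (if b then Assign ''s'' (NVar ''p'') else Skip)
         (set_cell ''S'' (nval (NConst 0) (set_nreg ''p'' m s'))
           (rval D d (RAdd (Cell ''S'' (NConst 0)) (Cell ''W'' (NVar ''p''))) (set_nreg ''p'' m s'))
           (set_nreg ''p'' m s'))) 2 (return_pmf (if b then m else j))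
        (\<lambda>s' j. ?same s' \<and> nreg s' ''s'' = j \<and> rarr s' ''S'' 0 = (\<Sum>q<Suc m. w q))"
        using I W by (cases b) (auto intro!: sim_Assign sim_Skip simp del: exec.simps)
    qed (use I W in auto)
  qed (use s1 in auto)
  have centers: "sim (exec D d (For ''l'' (OfNat (NVar ''i''))
      (Coin (RDiv (OfNat (NConst 1)) (OfNat (NAdd (NVar ''l'') (NConst 2))))
        (Assign ''s'' (NAdd (NVar ''n'') (NVar ''l''))) Skip)) s1) (3 + 17 * i) (pick_center n i j)
      (\<lambda>s' j. ?same s' \<and> nreg s' ''s'' = j)"
    if s1: "?same s1" "nreg s1 ''s'' = j" for s1 j
    unfolding pick_center_def
  proof (rule sim_For'[where \<tau> = 16 and Q = "\<lambda>m s' j. ?same s' \<and> nreg s' ''s'' = j"])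
    show "nat \<lceil>rval D d (OfNat (NVar ''i'')) s1\<rceil> = i" using assms(2) by (simp add: same_nreg[OF s1(1)])
  next
    fix m s' j
    assume I: "?same s' \<and> nreg s' ''s'' = j"
    then have n: "nreg s' ''n'' = n" using assms(1) by (auto simp: same_def)
    show "sim (exec D d (Coin (RDiv (OfNat (NConst 1)) (OfNat (NAdd (NVar ''l'') (NConst 2))))
        (Assign ''s'' (NAdd (NVar ''n'') (NVar ''l''))) Skip) (set_nreg ''l'' m s')) 16
      (bind_pmf (bernoulli_pmf (1 / (real m + 2))) (\<lambda>b. return_pmf (if b then n + m else j)))
      (\<lambda>s' j. ?same s' \<and> nreg s' ''s'' = j)"
    proof (rule sim_Coin')
      fix b
      show "sim (exec D d (if b then Assign ''s'' (NAdd (NVar ''n'') (NVar ''l'')) else Skip)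
          (set_nreg ''l'' m s')) 4 (return_pmf (if b then n + m else j))
        (\<lambda>s' j. ?same s' \<and> nreg s' ''s'' = j)"
        using I n by (cases b) (auto intro!: sim_Assign sim_Skip simp del: exec.simps)
    qed auto
  qed (use s1 in auto)
  show ?thesis
    unfolding pick_com_def
    by (rule sim_Assign_Seq, rule sim_Store_Seq, rule sim_Seq[OF points centers]) auto
qed

section \<open>Vectors in memory\<close>

definition stored :: "nat \<Rightarrow> (nat \<Rightarrow> real) \<Rightarrow> rvec list \<Rightarrow> bool" where
  "stored d a vs \<longleftrightarrow> (\<forall>m<length vs. \<forall>j<d. a (m * d + j) = Poly_Mapping.lookup (vs ! m) j)"

lemma lookup_scaleR_rvec [simp]: "Poly_Mapping.lookup (r *\<^sub>R x :: rvec) i = r * Poly_Mapping.lookup x i"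
proof -
  have "finite {i. r *\<^sub>R Poly_Mapping.lookup x i \<noteq> 0}"
    by (rule finite_subset[OF _ finite_lookup[of x]]) auto
  then show ?thesis by (simp add: scaleR_poly_mapping_def)
qed

lemma lookup_vec_of: "Poly_Mapping.lookup (vec_of d f) j = (if j < d then f j else 0)"
proof -
  have "finite {j. (if j < d then f j else 0) \<noteq> 0}"
    by (rule finite_subset[of _ "{..<d}"]) auto
  then show ?thesis by (simp add: vec_of_def)
qed

text \<open>Reading memory yields the first \<open>d\<close> coordinates only; membership in
  \<open>Rspace d\<close> says that these determine the vector.\<close>

lemma vec_at_stored:
  assumes "stored d (rarr s A) vs" "m < length vs" "vs ! m \<in> Rspace d"
  shows "vec_at d s A (m * d) = vs ! m"
  using assms by (intro poly_mapping_eqI) (auto simp: vec_at_def lookup_vec_of stored_def Rspace_def)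

lemma mult_add_less: "m < N \<Longrightarrow> j < d \<Longrightarrow> m * d + j < N * (d :: nat)"
proof -
  assume "m < N" "j < d"
  then have "m * d + j < Suc m * d" by simp
  also have "\<dots> \<le> N * d" using \<open>m < N\<close> by (intro mult_right_mono) auto
  finally show ?thesis .
qed

lemma stored_appendD: "stored d a (vs @ ws) \<Longrightarrow> stored d a vs"
  by (auto simp: stored_def nth_append)

lemma convex_Rspace: "convex (Rspace d)"
  by (auto simp: convex_def Rspace_def lookup_add)

text \<open>Centers are stored right behind the points in \<open>P\<close>, so that an index from
  \<open>pick\<close> addresses points and centers alike. The slot behind the finished centers
  collects the one under construction.\<close>

definition center_cell :: nexp where
  "center_cell = NAdd (NMul (NAdd (NVar ''n'') (NVar ''i'')) (NVar ''d'')) (NVar ''j'')"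

definition clear_com :: com where
  "clear_com = For ''j'' (OfNat (NVar ''d'')) (Store ''P'' center_cell (OfNat (NConst 0)))"

definition accumulate_com :: com where
  "accumulate_com = For ''j'' (OfNat (NVar ''d''))
    (Store ''P'' center_cell
      (RAdd (Cell ''P'' center_cell)
        (RDiv (Cell ''P'' (NAdd (NMul (NVar ''s'') (NVar ''d'')) (NVar ''j''))) (OfNat (NVar ''M'')))))"

text \<open>The weights are maintained incrementally, with one divergence per point and new center.
  The test \<open>i < 1\<close> discards the initial weight 1, which is not a divergence.\<close>

definition update_com :: com where
  "update_com = For ''p'' (OfNat (NVar ''n''))
    (Seq (Store ''V'' (NConst 0)
        (Diverg ''P'' (NMul (NVar ''p'') (NVar ''d''))
          ''P'' (NMul (NAdd (NVar ''n'') (NVar ''i'')) (NVar ''d''))))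
      (IfLess (OfNat (NVar ''i'')) (OfNat (NConst 1))
        (Store ''W'' (NVar ''p'') (Cell ''V'' (NConst 0)))
        (IfLess (Cell ''V'' (NConst 0)) (Cell ''W'' (NVar ''p''))
          (Store ''W'' (NVar ''p'') (Cell ''V'' (NConst 0))) Skip)))"

definition center_com :: com where
  "center_com = Seq clear_com
    (Seq (For ''m'' (OfNat (NVar ''M'')) (Seq pick_com accumulate_com)) update_com)"

definition trial_com :: com where
  "trial_com =
    Seq (For ''p'' (OfNat (NVar ''n'')) (Store ''W'' (NVar ''p'') (OfNat (NConst 1))))
      (For ''i'' (OfNat (NVar ''k'')) center_com)"

text \<open>
  The reciprocal \<open>1 / (1 + cost)\<close> of the best cost so far is stored in place of the cost, since
  the initial content \<open>0\<close> of the cell then represents an infinite cost.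
\<close>

definition keep_best_com :: com where
  "keep_best_com =
    Seq (Store ''R'' (NConst 0) (OfNat (NConst 0)))
    (Seq (For ''p'' (OfNat (NVar ''n''))
      (Store ''R'' (NConst 0) (RAdd (Cell ''R'' (NConst 0)) (Cell ''W'' (NVar ''p'')))))
    (IfLess (Cell ''B'' (NConst 0))
        (RDiv (OfNat (NConst 1)) (RAdd (OfNat (NConst 1)) (Cell ''R'' (NConst 0))))
      (Seq (Store ''B'' (NConst 0)
          (RDiv (OfNat (NConst 1)) (RAdd (OfNat (NConst 1)) (Cell ''R'' (NConst 0)))))
        (For ''j'' (OfNat (NMul (NVar ''k'') (NVar ''d'')))
          (Store ''C'' (NVar ''j'')
            (Cell ''P'' (NAdd (NMul (NVar ''n'') (NVar ''d'')) (NVar ''j''))))))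
      Skip))"

section \<open>Correctness and cost of the subroutines\<close>

lemma surely_clear:
  assumes "nreg s ''n'' = length ps" "nreg s ''i'' = length cs" "nreg s ''d'' = d"
    and st: "stored d (rarr s ''P'') (ps @ cs)"
  shows "surely (exec D d clear_com s) (3 + 11 * d)
    (\<lambda>s'. same {''j''} {''P''} s s' \<and> stored d (rarr s' ''P'') (ps @ cs @ [0]))"
proof -
  define N where "N = length ps + length cs"
  show ?thesis
    unfolding clear_com_def
  \<comment> \<open>Describing every cell of the array shows that the vectors stored earlier
    survive.\<close>
  proof (rule surely_For'[where \<tau> = 10 and Q = "\<lambda>m s'. same {''j''} {''P''} s s' \<and>
      (\<forall>c. rarr s' ''P'' c = (if N * d \<le> c \<and> c < N * d + m then 0 else rarr s ''P'' c))"])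
    fix m s'
    assume I: "same {''j''} {''P''} s s' \<and>
      (\<forall>c. rarr s' ''P'' c = (if N * d \<le> c \<and> c < N * d + m then 0 else rarr s ''P'' c))"
    then have S: "same {''j''} {''P''} s s'" by blast
    show "surely (exec D d (Store ''P'' center_cell (OfNat (NConst 0))) (set_nreg ''j'' m s')) 10
      (\<lambda>s'. same {''j''} {''P''} s s' \<and>
        (\<forall>c. rarr s' ''P'' c = (if N * d \<le> c \<and> c < N * d + Suc m then 0 else rarr s ''P'' c)))"
      by (rule surely_Store)
        (use I assms in \<open>auto simp: center_cell_def same_nreg[OF S] N_def less_Suc_eq\<close>)
  next
    fix s'
    assume I: "same {''j''} {''P''} s s' \<and>
      (\<forall>c. rarr s' ''P'' c = (if N * d \<le> c \<and> c < N * d + d then 0 else rarr s ''P'' c))"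
    have "stored d (rarr s' ''P'') ((ps @ cs) @ [0])"
      unfolding stored_def
    proof (intro allI impI)
      fix m j assume m: "m < length ((ps @ cs) @ [0])" and j: "j < d"
      show "rarr s' ''P'' (m * d + j) = Poly_Mapping.lookup (((ps @ cs) @ [0]) ! m) j"
      proof (cases "m = N")
        case True
        then show ?thesis using I j by (simp add: N_def nth_append)
      next
        case False
        then have mN: "m < length (ps @ cs)" using m by (simp add: N_def)
        then have "rarr s ''P'' (m * d + j) = Poly_Mapping.lookup ((ps @ cs) ! m) j"
          using st j unfolding stored_def by blast
        moreover have "((ps @ cs) @ [0]) ! m = (ps @ cs) ! m" using mN by (rule nth_append_left)
        moreover have "m * d + j < N * d" using mN by (intro mult_add_less j) (simp add: N_def)
        ultimately show ?thesis using I by simp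
      qed
    qed
    with I show "same {''j''} {''P''} s s' \<and> stored d (rarr s' ''P'') (ps @ cs @ [0])" by simp
  qed (use assms in auto)
qed

lemma surely_accumulate:
  assumes "nreg s ''n'' = length ps" "nreg s ''i'' = length cs" "nreg s ''d'' = d" "nreg s ''M'' = M"
    and r: "nreg s ''s'' = r" "r < length (ps @ cs)"
    and st: "stored d (rarr s ''P'') (ps @ cs @ [v])"
  shows "surely (exec D d accumulate_com s) (3 + 31 * d)
    (\<lambda>s'. same {''j''} {''P''} s s' \<and>
      stored d (rarr s' ''P'') (ps @ cs @ [v + (1 / real M) *\<^sub>R ((ps @ cs) ! r)]))"
proof -
  define N where "N = length ps + length cs"
  have rN: "r < N" using r by (simp add: N_def)
  let ?f = "\<lambda>m c. if N * d \<le> c \<and> c < N * d + m then rarr s ''P'' c + rarr s ''P'' (r * d + (c - N * d)) / real M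
    else rarr s ''P'' c"
  show ?thesis
    unfolding accumulate_com_def
  proof (rule surely_For'[where \<tau> = 30 and Q = "\<lambda>m s'. same {''j''} {''P''} s s' \<and>
      (\<forall>c. rarr s' ''P'' c = ?f m c)"])
    fix m s'
    assume m: "m < d" and I: "same {''j''} {''P''} s s' \<and> (\<forall>c. rarr s' ''P'' c = ?f m c)"
    then have S: "same {''j''} {''P''} s s'" by blast
    \<comment> \<open>The cell that is read lies before the slot being written, so it still holds
      its original value.\<close>
    have "r * d + m < N * d" using mult_add_less[OF rN m] .
    then show "surely (exec D d (Store ''P'' center_cell
      (RAdd (Cell ''P'' center_cell)
        (RDiv (Cell ''P'' (NAdd (NMul (NVar ''s'') (NVar ''d'')) (NVar ''j''))) (OfNat (NVar ''M'')))))
        (set_nreg ''j'' m s')) 30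
      (\<lambda>s'. same {''j''} {''P''} s s' \<and> (\<forall>c. rarr s' ''P'' c = ?f (Suc m) c))"
      by (intro surely_Store)
        (use I assms in \<open>auto simp: center_cell_def same_nreg[OF S] N_def less_Suc_eq\<close>)
  next
    fix s'
    assume I: "same {''j''} {''P''} s s' \<and> (\<forall>c. rarr s' ''P'' c = ?f d c)"
    let ?v = "v + (1 / real M) *\<^sub>R ((ps @ cs) ! r)"
    have st': "rarr s ''P'' (m * d + j) = Poly_Mapping.lookup (((ps @ cs) @ [v]) ! m) j"
      if "m \<le> N" "j < d" for m j
      using st that by (simp add: stored_def N_def)
    have "stored d (rarr s' ''P'') ((ps @ cs) @ [?v])"
      unfolding stored_def
    proof (intro allI impI)
      fix m j assume m: "m < length ((ps @ cs) @ [?v])" and j: "j < d"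
      show "rarr s' ''P'' (m * d + j) = Poly_Mapping.lookup (((ps @ cs) @ [?v]) ! m) j"
      proof (cases "m = N")
        case True
        then have "rarr s' ''P'' (m * d + j) = rarr s ''P'' (N * d + j) + rarr s ''P'' (r * d + j) / real M"
          using I j by simp
        then show ?thesis using st'[of N j] st'[of r j] j True rN
          by (simp add: N_def nth_append lookup_add del: append_assoc)
      next
        case False
        then have "m < N" using m by (simp add: N_def)
        then show ?thesis using I st'[of m j] j mult_add_less[of m N j d]
          by (simp add: nth_append N_def del: append_assoc)
      qed
    qed
    with I show "same {''j''} {''P''} s s' \<and> stored d (rarr s' ''P'') (ps @ cs @ [?v])" by simp
  qed (use assms in auto)
qed

lemma sim_sum:
  assumes "nreg s ''n'' = length ps" "nreg s ''i'' = length cs" "nreg s ''d'' = d" "nreg s ''M'' = M"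
    and "ps \<noteq> []" and st: "stored d (rarr s ''P'') (ps @ cs @ [0])"
    and W: "\<And>p. p < length ps \<Longrightarrow> rarr s ''W'' p = weight D cs (ps ! p)"
  shows "sim (exec D d (For ''m'' (OfNat (NVar ''M'')) (Seq pick_com accumulate_com)) s)
    (3 + M * (34 + 30 * (length ps + length cs + 1) + 31 * d))
    (scaled_sum (1 / real M) (sample D ps cs) M)
    (\<lambda>s' v. same {''m'', ''s'', ''p'', ''l'', ''j''} {''S'', ''P''} s s' \<and>
      stored d (rarr s' ''P'') (ps @ cs @ [v]))"
proof -
  let ?same = "same {''m'', ''s'', ''p'', ''l'', ''j''} {''S'', ''P''}"
  show ?thesis
    unfolding scaled_sum_def
  proof (rule sim_For'[where \<tau> = "30 * (length ps + length cs + 1) + (3 + 31 * d)" and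
        Q = "\<lambda>m s' v. ?same s s' \<and> stored d (rarr s' ''P'') (ps @ cs @ [v])"])
    fix m s' v
    assume I: "?same s s' \<and> stored d (rarr s' ''P'') (ps @ cs @ [v])"
    then have S: "?same s s'" by blast
    show "sim (exec D d (Seq pick_com accumulate_com) (set_nreg ''m'' m s'))
      (30 * (length ps + length cs + 1) + (3 + 31 * d))
      (map_pmf (\<lambda>x. v + (1 / real M) *\<^sub>R x) (sample D ps cs))
      (\<lambda>s' v. ?same s s' \<and> stored d (rarr s' ''P'') (ps @ cs @ [v]))"
      unfolding sample_def
    proof (rule sim_map, rule sim_map, rule sim_Seq_surely_right)
      show "sim (exec D d pick_com (set_nreg ''m'' m s')) (30 * (length ps + length cs + 1)) (pick D ps cs)
        (\<lambda>s'' j. same {''s'', ''p'', ''l''} {''S''} (set_nreg ''m'' m s') s'' \<and> nreg s'' ''s'' = j)"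
        unfolding pick_def
        by (rule sim_pick) (use assms in \<open>auto simp: same_nreg[OF S] same_rarr[OF S]\<close>)
    next
      fix s'' j
      assume j: "j \<in> set_pmf (pick D ps cs)"
        and *: "same {''s'', ''p'', ''l''} {''S''} (set_nreg ''m'' m s') s'' \<and> nreg s'' ''s'' = j"
      then have S': "same {''s'', ''p'', ''l''} {''S''} (set_nreg ''m'' m s') s''" by blast
      have S2: "?same s s''" by (rule same_trans[OF _ S']) (use S in auto)
      have "j < length (ps @ cs)" using set_pmf_pick[OF assms(5), of D cs] j by auto
      then have "surely (exec D d accumulate_com s'') (3 + 31 * d)
        (\<lambda>s'. same {''j''} {''P''} s'' s' \<and>
          stored d (rarr s' ''P'') (ps @ cs @ [v + (1 / real M) *\<^sub>R ((ps @ cs) ! j)]))"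
        using assms * I
        by (intro surely_accumulate) (auto simp: same_nreg[OF S2] same_rarr[OF S'])
      then show "surely (exec D d accumulate_com s'') (3 + 31 * d)
        (\<lambda>s'. ?same s s' \<and> stored d (rarr s' ''P'') (ps @ cs @ [v + (1 / real M) *\<^sub>R ((ps @ cs) ! j)]))"
        by (rule surely_mono) (auto intro: same_trans[OF S2])
    qed
  qed (use assms in auto)
qed

lemma surely_update:
  assumes "nreg s ''n'' = length ps" "nreg s ''i'' = length cs" "nreg s ''d'' = d"
    and R: "set ps \<subseteq> Rspace d" "v \<in> Rspace d" and st: "stored d (rarr s ''P'') (ps @ cs @ [v])"
    and W: "\<And>p. p < length ps \<Longrightarrow> rarr s ''W'' p = weight D cs (ps ! p)"
  shows "surely (exec D d update_com s) (3 + length ps * (31 + d))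
    (\<lambda>s'. same {''p''} {''V'', ''W''} s s' \<and>
      (\<forall>p<length ps. rarr s' ''W'' p = weight D (cs @ [v]) (ps ! p)))"
proof -
  define V where "V p = D (ps ! p) v" for p
  let ?same = "same {''p''} {''V'', ''W''} s"
  \<comment> \<open>Before the first center the stored weight is 1, and taking a minimum with it
    would be wrong.\<close>
  have new: "weight D (cs @ [v]) p = (if cs = [] then D p v else min (D p v) (weight D cs p))" for p
    by (simp add: weight_def nearest_insert) (simp add: nearest_def)
  have single: "weight D [v] p = D p v" for p
    by (simp add: weight_def nearest_def)
  let ?f = "\<lambda>m p. if p < m then weight D (cs @ [v]) (ps ! p) else weight D cs (ps ! p)"
  show ?thesis
    unfolding update_com_def
  proof (rule surely_For'[where \<tau> = "d + 30" and Q = "\<lambda>m s'. ?same s' \<and>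
      (\<forall>p<length ps. rarr s' ''W'' p = ?f m p)"])
    fix m s'
    assume m: "m < length ps" and I: "?same s' \<and> (\<forall>p<length ps. rarr s' ''W'' p = ?f m p)"
    then have S: "?same s'" by blast
    have P: "vec_at d s'' ''P'' (m * d) = ps ! m" "vec_at d s'' ''P'' ((length ps + length cs) * d) = v"
      if "rarr s'' = rarr s'" for s''
      using vec_at_stored[of d s'' "''P''" "ps @ cs @ [v]" m]
        vec_at_stored[of d s'' "''P''" "(ps @ cs) @ [v]" "length ps + length cs"]
        st m R(2) subsetD[OF R(1) nth_mem[OF m]] that by (auto simp: nth_append same_rarr[OF S])
    let ?s = "set_cell ''V'' 0 (V m) (set_nreg ''p'' m s')"
    have I': "?same ?s" "rarr ?s ''W'' m = weight D cs (ps ! m)" using I m by auto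
    show "surely (exec D d (Seq (Store ''V'' (NConst 0)
        (Diverg ''P'' (NMul (NVar ''p'') (NVar ''d''))
          ''P'' (NMul (NAdd (NVar ''n'') (NVar ''i'')) (NVar ''d''))))
      (IfLess (OfNat (NVar ''i'')) (OfNat (NConst 1))
        (Store ''W'' (NVar ''p'') (Cell ''V'' (NConst 0)))
        (IfLess (Cell ''V'' (NConst 0)) (Cell ''W'' (NVar ''p''))
          (Store ''W'' (NVar ''p'') (Cell ''V'' (NConst 0))) Skip))) (set_nreg ''p'' m s')) (d + 30)
      (\<lambda>s'. ?same s' \<and> (\<forall>p<length ps. rarr s' ''W'' p = ?f (Suc m) p))"
    proof (rule surely_Store_Seq)
      have "set_cell ''V'' (nval (NConst 0) (set_nreg ''p'' m s'))
          (rval D d (Diverg ''P'' (NMul (NVar ''p'') (NVar ''d''))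
            ''P'' (NMul (NAdd (NVar ''n'') (NVar ''i'')) (NVar ''d''))) (set_nreg ''p'' m s'))
          (set_nreg ''p'' m s') = ?s"
        using assms(1-3) P by (simp add: same_nreg[OF S] V_def)
      moreover have "surely (exec D d (IfLess (OfNat (NVar ''i'')) (OfNat (NConst 1))
          (Store ''W'' (NVar ''p'') (Cell ''V'' (NConst 0)))
          (IfLess (Cell ''V'' (NConst 0)) (Cell ''W'' (NVar ''p''))
            (Store ''W'' (NVar ''p'') (Cell ''V'' (NConst 0))) Skip)) ?s) (1 + 2 + 2 + (1 + 2 + 2 + 4))
        (\<lambda>s'. ?same s' \<and> (\<forall>p<length ps. rarr s' ''W'' p = ?f (Suc m) p))"
        using assms(2) I I' m
        by (auto simp: surely_def tick_def same_nreg[OF S] new single V_def less_Suc_eq)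
      ultimately show "surely (exec D d (IfLess (OfNat (NVar ''i'')) (OfNat (NConst 1))
          (Store ''W'' (NVar ''p'') (Cell ''V'' (NConst 0)))
          (IfLess (Cell ''V'' (NConst 0)) (Cell ''W'' (NVar ''p''))
            (Store ''W'' (NVar ''p'') (Cell ''V'' (NConst 0))) Skip))
          (set_cell ''V'' (nval (NConst 0) (set_nreg ''p'' m s'))
          (rval D d (Diverg ''P'' (NMul (NVar ''p'') (NVar ''d''))
            ''P'' (NMul (NAdd (NVar ''n'') (NVar ''i'')) (NVar ''d''))) (set_nreg ''p'' m s'))
          (set_nreg ''p'' m s'))) (1 + 2 + 2 + (1 + 2 + 2 + 4))
        (\<lambda>s'. ?same s' \<and> (\<forall>p<length ps. rarr s' ''W'' p = ?f (Suc m) p))"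
        by simp
    qed simp
  qed (use assms in auto)
qed

lemma sim_add_center:
  assumes "nreg s ''n'' = length ps" "nreg s ''i'' = length cs" "nreg s ''d'' = d" "nreg s ''M'' = M"
    and "ps \<noteq> []" "M > 0" and R: "set ps \<subseteq> Rspace d" "set cs \<subseteq> Rspace d"
    and st: "stored d (rarr s ''P'') (ps @ cs)"
    and W: "\<And>p. p < length ps \<Longrightarrow> rarr s ''W'' p = weight D cs (ps ! p)"
  shows "sim (exec D d center_com s)
    ((3 + 11 * d) + ((3 + M * (34 + 30 * (length ps + length cs + 1) + 31 * d)) + (3 + length ps * (31 + d))))
    (add_center D ps M cs)
    (\<lambda>s' cs'. same {''m'', ''s'', ''p'', ''l'', ''j''} {''S'', ''P'', ''V'', ''W''} s s' \<and>
      stored d (rarr s' ''P'') (ps @ cs') \<and> length cs' = Suc (length cs) \<and> set cs' \<subseteq> Rspace d \<and>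
      (\<forall>p<length ps. rarr s' ''W'' p = weight D cs' (ps ! p)))"
  unfolding center_com_def add_center_def
proof (rule sim_map, rule sim_Seq_surely_left[OF surely_clear], (fact assms)+, rule sim_Seq_surely_right)
  let ?same = "same {''m'', ''s'', ''p'', ''l'', ''j''} {''S'', ''P'', ''V'', ''W''}"
  fix s1
  assume *: "same {''j''} {''P''} s s1 \<and> stored d (rarr s1 ''P'') (ps @ cs @ [0])"
  then have S1: "same {''j''} {''P''} s s1" by blast
  show "sim (exec D d (For ''m'' (OfNat (NVar ''M'')) (Seq pick_com accumulate_com)) s1)
    (3 + M * (34 + 30 * (length ps + length cs + 1) + 31 * d))
    (scaled_sum (1 / real M) (sample D ps cs) M)
    (\<lambda>s' v. same {''m'', ''s'', ''p'', ''l'', ''j''} {''S'', ''P''} s1 s' \<and>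
      stored d (rarr s' ''P'') (ps @ cs @ [v]))"
    using * assms by (intro sim_sum) (auto simp: same_nreg[OF S1] same_rarr[OF S1])
  fix s2 v
  assume v: "v \<in> set_pmf (scaled_sum (1 / real M) (sample D ps cs) M)"
    and **: "same {''m'', ''s'', ''p'', ''l'', ''j''} {''S'', ''P''} s1 s2 \<and>
      stored d (rarr s2 ''P'') (ps @ cs @ [v])"
  then have S2: "same {''m'', ''s'', ''p'', ''l'', ''j''} {''S'', ''P''} s1 s2" by blast
  \<comment> \<open>Means of vectors in \<open>Rspace d\<close> stay there, so the program reads
    back exactly \<open>v\<close> when it evaluates divergences.\<close>
  have vR: "v \<in> Rspace d"
    using set_pmf_scaled_sum_convex[OF convex_Rspace, of "sample D ps cs" d M]
      set_pmf_sample[OF assms(5), of D cs] R v assms(6) by blast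
  have "surely (exec D d update_com s2) (3 + length ps * (31 + d))
    (\<lambda>s'. same {''p''} {''V'', ''W''} s2 s' \<and>
      (\<forall>p<length ps. rarr s' ''W'' p = weight D (cs @ [v]) (ps ! p)))"
    using ** assms vR
    by (intro surely_update)
      (auto simp: same_nreg[OF S2] same_rarr[OF S2] same_nreg[OF S1] same_rarr[OF S1])
  then show "surely (exec D d update_com s2) (3 + length ps * (31 + d))
    (\<lambda>s'. ?same s s' \<and> stored d (rarr s' ''P'') (ps @ (cs @ [v])) \<and>
      length (cs @ [v]) = Suc (length cs) \<and> set (cs @ [v]) \<subseteq> Rspace d \<and>
      (\<forall>p<length ps. rarr s' ''W'' p = weight D (cs @ [v]) (ps ! p)))"
  proof (rule surely_mono)
    fix s3
    assume ***: "same {''p''} {''V'', ''W''} s2 s3 \<and>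
      (\<forall>p<length ps. rarr s3 ''W'' p = weight D (cs @ [v]) (ps ! p))"
    have "?same s s2" by (rule same_trans[OF _ S2]) (use S1 in \<open>auto simp: same_def\<close>)
    then have "?same s s3" by (rule same_trans) (use *** in auto)
    then show "?same s s3 \<and> stored d (rarr s3 ''P'') (ps @ (cs @ [v])) \<and>
      length (cs @ [v]) = Suc (length cs) \<and> set (cs @ [v]) \<subseteq> Rspace d \<and>
      (\<forall>p<length ps. rarr s3 ''W'' p = weight D (cs @ [v]) (ps ! p))"
      using ** *** vR R by (auto simp: same_def)
  qed simp
qed

lemma sim_trial:
  assumes "nreg s ''n'' = length ps" "nreg s ''k'' = k" "nreg s ''d'' = d" "nreg s ''M'' = M"
    and "ps \<noteq> []" "M > 0" and R: "set ps \<subseteq> Rspace d" and st: "stored d (rarr s ''P'') ps"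
  shows "sim (exec D d trial_com s)
    ((3 + length ps * 5) + (3 + k * (1 + ((3 + 11 * d) +
      ((3 + M * (34 + 30 * (length ps + k + 1) + 31 * d)) + (3 + length ps * (31 + d)))))))
    (trial D ps M k)
    (\<lambda>s' cs. same {''i'', ''m'', ''s'', ''p'', ''l'', ''j''} {''S'', ''P'', ''V'', ''W''} s s' \<and>
      stored d (rarr s' ''P'') (ps @ cs) \<and>
      (\<forall>p<length ps. rarr s' ''W'' p = weight D cs (ps ! p)))"
  unfolding trial_com_def
proof (rule sim_Seq_surely_left)
  show "surely (exec D d (For ''p'' (OfNat (NVar ''n'')) (Store ''W'' (NVar ''p'') (OfNat (NConst 1)))) s)
    (3 + length ps * 5) (\<lambda>s'. same {''p''} {''W''} s s' \<and> (\<forall>p<length ps. rarr s' ''W'' p = 1))"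
    by (rule surely_For'[where \<tau> = 4 and Q = "\<lambda>m s'. same {''p''} {''W''} s s' \<and> (\<forall>p<m. rarr s' ''W'' p = 1)"])
      (use assms(1) in \<open>auto intro!: surely_return simp: less_Suc_eq\<close>)
next
  let ?same = "same {''i'', ''m'', ''s'', ''p'', ''l'', ''j''} {''S'', ''P'', ''V'', ''W''}"
  fix s1
  assume *: "same {''p''} {''W''} s s1 \<and> (\<forall>p<length ps. rarr s1 ''W'' p = 1)"
  then have S1: "same {''p''} {''W''} s s1" by blast
  show "sim (exec D d (For ''i'' (OfNat (NVar ''k'')) center_com) s1)
    (3 + k * (1 + ((3 + 11 * d) +
      ((3 + M * (34 + 30 * (length ps + k + 1) + 31 * d)) + (3 + length ps * (31 + d))))))
    (trial D ps M k)
    (\<lambda>s' cs. ?same s s' \<and> stored d (rarr s' ''P'') (ps @ cs) \<and>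
      (\<forall>p<length ps. rarr s' ''W'' p = weight D cs (ps ! p)))"
    unfolding trial_def
  proof (rule sim_For'[where \<tau> = "(3 + 11 * d) +
      ((3 + M * (34 + 30 * (length ps + k + 1) + 31 * d)) + (3 + length ps * (31 + d)))" and
      Q = "\<lambda>m s' cs. ?same s s' \<and> stored d (rarr s' ''P'') (ps @ cs) \<and> length cs = m \<and> set cs \<subseteq> Rspace d \<and>
        (\<forall>p<length ps. rarr s' ''W'' p = weight D cs (ps ! p))"])
    fix m s' cs
    assume m: "m < k" and I: "?same s s' \<and> stored d (rarr s' ''P'') (ps @ cs) \<and> length cs = m \<and>
      set cs \<subseteq> Rspace d \<and> (\<forall>p<length ps. rarr s' ''W'' p = weight D cs (ps ! p))"
    then have S: "?same s s'" by blast
    have "sim (exec D d center_com (set_nreg ''i'' m s'))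
      ((3 + 11 * d) + ((3 + M * (34 + 30 * (length ps + length cs + 1) + 31 * d)) + (3 + length ps * (31 + d))))
      (add_center D ps M cs)
      (\<lambda>s'' cs'. same {''m'', ''s'', ''p'', ''l'', ''j''} {''S'', ''P'', ''V'', ''W''} (set_nreg ''i'' m s') s'' \<and>
        stored d (rarr s'' ''P'') (ps @ cs') \<and> length cs' = Suc (length cs) \<and> set cs' \<subseteq> Rspace d \<and>
        (\<forall>p<length ps. rarr s'' ''W'' p = weight D cs' (ps ! p)))"
      using assms I by (intro sim_add_center) (auto simp: same_nreg[OF S])
    then show "sim (exec D d center_com (set_nreg ''i'' m s'))
      ((3 + 11 * d) + ((3 + M * (34 + 30 * (length ps + k + 1) + 31 * d)) + (3 + length ps * (31 + d))))
      (add_center D ps M cs)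
      (\<lambda>s' cs. ?same s s' \<and> stored d (rarr s' ''P'') (ps @ cs) \<and> length cs = Suc m \<and> set cs \<subseteq> Rspace d \<and>
        (\<forall>p<length ps. rarr s' ''W'' p = weight D cs (ps ! p)))"
    \<comment> \<open>Charging every round as if there were \<open>k\<close> centers already gives
      the loop a uniform bound.\<close>
    proof (rule sim_mono)
      show "(3 + 11 * d) + ((3 + M * (34 + 30 * (length ps + length cs + 1) + 31 * d)) + (3 + length ps * (31 + d)))
        \<le> (3 + 11 * d) + ((3 + M * (34 + 30 * (length ps + k + 1) + 31 * d)) + (3 + length ps * (31 + d)))"
        using I m by (intro add_mono mult_left_mono) auto
    next
      fix s'' cs'
      assume *: "same {''m'', ''s'', ''p'', ''l'', ''j''} {''S'', ''P'', ''V'', ''W''} (set_nreg ''i'' m s') s'' \<and>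
        stored d (rarr s'' ''P'') (ps @ cs') \<and> length cs' = Suc (length cs) \<and> set cs' \<subseteq> Rspace d \<and>
        (\<forall>p<length ps. rarr s'' ''W'' p = weight D cs' (ps ! p))"
      have "?same s (set_nreg ''i'' m s')" using S by simp
      then have "?same s s''" by (rule same_trans) (use * in auto)
      with * I show "?same s s'' \<and> stored d (rarr s'' ''P'') (ps @ cs') \<and> length cs' = Suc m \<and>
        set cs' \<subseteq> Rspace d \<and> (\<forall>p<length ps. rarr s'' ''W'' p = weight D cs' (ps ! p))" by simp
    qed
  next
    have "?same s s1" using S1 by (auto simp: same_def)
    then show "?same s s1 \<and> stored d (rarr s1 ''P'') (ps @ []) \<and> length [] = 0 \<and> set [] \<subseteq> Rspace d \<and>
        (\<forall>p<length ps. rarr s1 ''W'' p = weight D [] (ps ! p))"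
      using * st by (simp add: weight_def same_rarr[OF S1])
  qed (use assms(2) in \<open>auto simp: same_nreg[OF S1]\<close>)
qed

definition score :: "('a \<Rightarrow> 'a \<Rightarrow> real) \<Rightarrow> 'a list \<Rightarrow> 'a list \<Rightarrow> real" where
  "score D ps b = (if b = [] then 0 else 1 / (1 + cost D ps b))"

lemma surely_keep_best:
  assumes "nreg s ''n'' = length ps" "nreg s ''k'' = k" "nreg s ''d'' = d"
    and ps: "distinct ps" and cs: "length cs = k" "k > 0" and st: "stored d (rarr s ''P'') (ps @ cs)"
    and W: "\<And>p. p < length ps \<Longrightarrow> rarr s ''W'' p = weight D cs (ps ! p)"
    and B: "rarr s ''B'' 0 = score D ps b" and C: "b \<noteq> [] \<Longrightarrow> stored d (rarr s ''C'') b"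
    and nonneg: "0 \<le> cost D ps cs" "b \<noteq> [] \<Longrightarrow> 0 \<le> cost D ps b"
  defines "b' \<equiv> if b = [] \<or> cost D ps cs < cost D ps b then cs else b"
  shows "surely (exec D d keep_best_com s) (33 + 8 * length ps + 9 * (k * d))
    (\<lambda>s'. same {''p'', ''j''} {''R'', ''B'', ''C''} s s' \<and>
      rarr s' ''B'' 0 = score D ps b' \<and> (b' \<noteq> [] \<longrightarrow> stored d (rarr s' ''C'') b'))"
proof -
  let ?same = "same {''p'', ''j''} {''R'', ''B'', ''C''} s"
  let ?post = "\<lambda>s'. ?same s' \<and> rarr s' ''B'' 0 = score D ps b' \<and> (b' \<noteq> [] \<longrightarrow> stored d (rarr s' ''C'') b')"
  have ne: "cs \<noteq> []" using cs by auto
  \<comment> \<open>After the last center \<open>W\<close> holds the divergences to the nearest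
    center, so the cost of the trial is a plain sum without further oracle calls.\<close>
  have "bij_betw ((!) ps) {..<length ps} (set ps)" by (rule bij_betw_nth) (use ps in auto)
  from sum.reindex_bij_betw[OF this, of "weight D cs"]
  have cost: "(\<Sum>p<length ps. rarr s ''W'' p) = cost D ps cs"
    using W ne by (simp add: cost_def weight_def)
  \<comment> \<open>Passing to reciprocals of 1 + cost reverses the order of nonnegative costs, and
    the score 0 of the empty list lies below all of them.\<close>
  have better: "score D ps b < 1 / (1 + cost D ps cs) \<longleftrightarrow> b = [] \<or> cost D ps cs < cost D ps b"
    using nonneg by (cases "b = []") (auto simp: score_def divide_simps)
  have total: "surely (exec D d (For ''p'' (OfNat (NVar ''n''))
      (Store ''R'' (NConst 0) (RAdd (Cell ''R'' (NConst 0)) (Cell ''W'' (NVar ''p''))))) s1) (3 + 8 * length ps)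
    (\<lambda>s'. same {''p''} {''R''} s s' \<and> rarr s' ''R'' 0 = cost D ps cs)"
    if s1: "same {} {''R''} s s1" "rarr s1 ''R'' 0 = 0" for s1
  proof (rule surely_For'[where \<tau> = 7 and Q = "\<lambda>m s'. same {''p''} {''R''} s s' \<and>
      rarr s' ''R'' 0 = (\<Sum>p<m. rarr s ''W'' p)"])
    fix m s' assume I: "same {''p''} {''R''} s s' \<and> rarr s' ''R'' 0 = (\<Sum>p<m. rarr s ''W'' p)"
    then have S: "same {''p''} {''R''} s s'" by blast
    show "surely (exec D d (Store ''R'' (NConst 0) (RAdd (Cell ''R'' (NConst 0)) (Cell ''W'' (NVar ''p''))))
        (set_nreg ''p'' m s')) 7
      (\<lambda>s'. same {''p''} {''R''} s s' \<and> rarr s' ''R'' 0 = (\<Sum>p<Suc m. rarr s ''W'' p))"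
      by (rule surely_Store) (use I in \<open>auto simp: same_rarr[OF S]\<close>)
  next
    show "same {''p''} {''R''} s s1 \<and> rarr s1 ''R'' 0 = (\<Sum>p<0. rarr s ''W'' p)"
      using s1 by (auto simp: same_def)
  qed (use assms(1) cost in \<open>auto simp: same_nreg[OF s1(1)]\<close>)
  have copy: "surely (exec D d (For ''j'' (OfNat (NMul (NVar ''k'') (NVar ''d'')))
          (Store ''C'' (NVar ''j'') (Cell ''P'' (NAdd (NMul (NVar ''n'') (NVar ''d'')) (NVar ''j''))))) s1)
      (5 + 9 * (k * d)) (\<lambda>s'. ?same s' \<and> rarr s' ''B'' 0 = rarr s1 ''B'' 0 \<and> stored d (rarr s' ''C'') cs)"
    if s1: "?same s1" for s1
  proof (rule surely_For'[where \<tau> = 8 and Q = "\<lambda>m s'. ?same s' \<and> rarr s' ''B'' 0 = rarr s1 ''B'' 0 \<and>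
      (\<forall>c<m. rarr s' ''C'' c = rarr s ''P'' (length ps * d + c))"])
    fix m s' assume I: "?same s' \<and> rarr s' ''B'' 0 = rarr s1 ''B'' 0 \<and>
      (\<forall>c<m. rarr s' ''C'' c = rarr s ''P'' (length ps * d + c))"
    then have S: "?same s'" by blast
    show "surely (exec D d (Store ''C'' (NVar ''j'') (Cell ''P'' (NAdd (NMul (NVar ''n'') (NVar ''d'')) (NVar ''j''))))
        (set_nreg ''j'' m s')) 8
      (\<lambda>s'. ?same s' \<and> rarr s' ''B'' 0 = rarr s1 ''B'' 0 \<and>
        (\<forall>c<Suc m. rarr s' ''C'' c = rarr s ''P'' (length ps * d + c)))"
      by (rule surely_Store)
        (use I assms(1-3) in \<open>auto simp: same_rarr[OF S] same_nreg[OF S] less_Suc_eq\<close>)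
  next
    fix s' assume I: "?same s' \<and> rarr s' ''B'' 0 = rarr s1 ''B'' 0 \<and>
      (\<forall>c<k * d. rarr s' ''C'' c = rarr s ''P'' (length ps * d + c))"
    have "stored d (rarr s' ''C'') cs"
      unfolding stored_def
    proof (intro allI impI)
      fix m j assume m: "m < length cs" and j: "j < d"
      then have "rarr s' ''C'' (m * d + j) = rarr s ''P'' ((length ps + m) * d + j)"
        using I mult_add_less[of m k j d] cs by (simp add: add_mult_distrib add.assoc)
      also have "\<dots> = Poly_Mapping.lookup ((ps @ cs) ! (length ps + m)) j"
        using st m j by (simp add: stored_def)
      finally show "rarr s' ''C'' (m * d + j) = Poly_Mapping.lookup (cs ! m) j" by simp
    qed
    with I show "?same s' \<and> rarr s' ''B'' 0 = rarr s1 ''B'' 0 \<and> stored d (rarr s' ''C'') cs" by simp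
  qed (use assms(2,3) s1 in \<open>auto simp: same_nreg[OF s1] of_nat_mult[symmetric] simp del: of_nat_mult\<close>)
  show ?thesis
    unfolding keep_best_com_def
  proof (rule surely_Store_Seq)
    show "surely (exec D d (Seq (For ''p'' (OfNat (NVar ''n''))
        (Store ''R'' (NConst 0) (RAdd (Cell ''R'' (NConst 0)) (Cell ''W'' (NVar ''p'')))))
      (IfLess (Cell ''B'' (NConst 0))
        (RDiv (OfNat (NConst 1)) (RAdd (OfNat (NConst 1)) (Cell ''R'' (NConst 0))))
      (Seq (Store ''B'' (NConst 0)
          (RDiv (OfNat (NConst 1)) (RAdd (OfNat (NConst 1)) (Cell ''R'' (NConst 0)))))
        (For ''j'' (OfNat (NMul (NVar ''k'') (NVar ''d'')))
          (Store ''C'' (NVar ''j'')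
            (Cell ''P'' (NAdd (NMul (NVar ''n'') (NVar ''d'')) (NVar ''j''))))))
      Skip)) (set_cell ''R'' (nval (NConst 0) s) (rval D d (OfNat (NConst 0)) s) s))
      ((3 + 8 * length ps) + (1 + 2 + 8 + (10 + (5 + 9 * (k * d))))) ?post"
    proof (rule surely_Seq[OF total])
      fix s2 assume *: "same {''p''} {''R''} s s2 \<and> rarr s2 ''R'' 0 = cost D ps cs"
      then have S: "same {''p''} {''R''} s s2" by blast
      have S': "?same s2" using S by (auto simp: same_def)
      let ?r = "RDiv (OfNat (NConst 1)) (RAdd (OfNat (NConst 1)) (Cell ''R'' (NConst 0)))"
      have r: "rval D d ?r s2 = 1 / (1 + cost D ps cs)" "rval D d (Cell ''B'' (NConst 0)) s2 = score D ps b"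
        using * B by (auto simp: same_rarr[OF S])
      show "surely (exec D d (IfLess (Cell ''B'' (NConst 0)) ?r
        (Seq (Store ''B'' (NConst 0) ?r)
          (For ''j'' (OfNat (NMul (NVar ''k'') (NVar ''d'')))
            (Store ''C'' (NVar ''j'')
              (Cell ''P'' (NAdd (NMul (NVar ''n'') (NVar ''d'')) (NVar ''j'')))))) Skip) s2)
        (1 + 2 + 8 + (10 + (5 + 9 * (k * d)))) ?post"
      proof (rule surely_mono[OF surely_IfLess[where \<tau> = "10 + (5 + 9 * (k * d))" and Q = ?post]])
        assume "rval D d (Cell ''B'' (NConst 0)) s2 < rval D d ?r s2"
        then have b': "b' = cs" using better unfolding r b'_def by simp
        have sB: "?same (set_cell ''B'' (nval (NConst 0) s2) (rval D d ?r s2) s2)" using S' by simp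
        show "surely (exec D d (Seq (Store ''B'' (NConst 0) ?r)
          (For ''j'' (OfNat (NMul (NVar ''k'') (NVar ''d'')))
            (Store ''C'' (NVar ''j'')
              (Cell ''P'' (NAdd (NMul (NVar ''n'') (NVar ''d'')) (NVar ''j'')))))) s2)
          (10 + (5 + 9 * (k * d))) ?post"
          by (rule surely_Store_Seq, rule surely_mono[OF copy[OF sB] order_refl])
            (use r ne in \<open>auto simp: b' score_def\<close>)
      next
        assume "\<not> rval D d (Cell ''B'' (NConst 0)) s2 < rval D d ?r s2"
        then have b': "b' = b" using better unfolding r b'_def by simp
        show "surely (exec D d Skip s2) (10 + (5 + 9 * (k * d))) ?post"
          by (rule surely_Skip) (use S' B C in \<open>auto simp: b' same_rarr[OF S]\<close>)
      qed auto
    qed auto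
  qed simp
qed

section \<open>Computing the numbers of samples and trials, and the whole program\<close>

definition similarity_ratio :: rexp where
  "similarity_ratio = RDiv (RMul (OfNat (NVar ''k'')) (OfNat (NVar ''k'')))
     (RMul (Cell ''mu'' (NConst 0)) (Cell ''eps'' (NConst 0)))"

text \<open>Counting the rounds of a loop with a real bound yields the ceiling of
  \<open>64 / (\<mu> * \<epsilon>)\<close>, although the machine cannot round.\<close>

definition count_samples_com :: com where
  "count_samples_com = For ''x'' (RDiv (OfNat (NConst 64)) (RMul (Cell ''mu'' (NConst 0)) (Cell ''eps'' (NConst 0))))
     (Assign ''M'' (NAdd (NVar ''M'') (NConst 1)))"

text \<open>Cell 0 of \<open>T\<close> ends up as the reciprocal of
  \<open>(\<gamma> ^ M / 2) ^ k\<close>, the guaranteed success probability of a trial, for \<gamma>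
  = 1/(288 x^2) with x the similarity ratio.\<close>

definition count_trials_com :: com where
  "count_trials_com = Seq (Store ''T'' (NConst 0) (OfNat (NConst 1)))
    (For ''i'' (OfNat (NVar ''k''))
      (Seq (For ''j'' (OfNat (NVar ''M''))
          (Store ''T'' (NConst 0) (RMul (Cell ''T'' (NConst 0))
            (RMul (OfNat (NConst 288)) (RMul similarity_ratio similarity_ratio)))))
        (Store ''T'' (NConst 0) (RMul (OfNat (NConst 2)) (Cell ''T'' (NConst 0))))))"

text \<open>The constant \<open>L\<close> accounts for the failure probability; the loop rounds its
  real bound up by itself.\<close>

definition kmedian_com :: "nat \<Rightarrow> com" where
  "kmedian_com L = Seq count_samples_com (Seq count_trials_com
    (For ''t'' (RMul (OfNat (NConst L)) (Cell ''T'' (NConst 0))) (Seq trial_com keep_best_com)))"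

lemma surely_count_samples:
  assumes "nreg s ''M'' = 0" "rarr s ''mu'' 0 = \<mu>" "rarr s ''eps'' 0 = \<epsilon>"
  defines "M \<equiv> nat \<lceil>64 / (\<mu> * \<epsilon>)\<rceil>"
  shows "surely (exec D d count_samples_com s) (9 + 5 * M) (\<lambda>s'. same {''x'', ''M''} {} s s' \<and> nreg s' ''M'' = M)"
  unfolding count_samples_com_def
proof (rule surely_For'[where \<tau> = 4 and Q = "\<lambda>m s'. same {''x'', ''M''} {} s s' \<and> nreg s' ''M'' = m"])
  fix m s' assume I: "same {''x'', ''M''} {} s s' \<and> nreg s' ''M'' = m"
  show "surely (exec D d (Assign ''M'' (NAdd (NVar ''M'') (NConst 1))) (set_nreg ''x'' m s')) 4
    (\<lambda>s'. same {''x'', ''M''} {} s s' \<and> nreg s' ''M'' = Suc m)"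
    by (rule surely_Assign) (use I in auto)
qed (use assms in auto)

lemma surely_count_trials:
  assumes "nreg s ''M'' = M" "nreg s ''k'' = k" "rarr s ''mu'' 0 = \<mu>" "rarr s ''eps'' 0 = \<epsilon>"
  defines "G \<equiv> 288 * ((real k)\<^sup>2 / (\<mu> * \<epsilon>))\<^sup>2"
  shows "surely (exec D d count_trials_com s) (7 + k * (11 + 36 * M))
    (\<lambda>s'. same {''i'', ''j''} {''T''} s s' \<and> rarr s' ''T'' 0 = (2 * G ^ M) ^ k)"
  unfolding count_trials_com_def
proof (rule surely_Store_Seq)
  let ?same = "same {''i'', ''j''} {''T''} s"
  show "surely (exec D d (For ''i'' (OfNat (NVar ''k''))
      (Seq (For ''j'' (OfNat (NVar ''M''))
          (Store ''T'' (NConst 0) (RMul (Cell ''T'' (NConst 0))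
            (RMul (OfNat (NConst 288)) (RMul similarity_ratio similarity_ratio)))))
        (Store ''T'' (NConst 0) (RMul (OfNat (NConst 2)) (Cell ''T'' (NConst 0))))))
      (set_cell ''T'' (nval (NConst 0) s) (rval D d (OfNat (NConst 1)) s) s))
    (3 + k * (1 + ((3 + M * 36) + 7))) (\<lambda>s'. ?same s' \<and> rarr s' ''T'' 0 = (2 * G ^ M) ^ k)"
  proof (rule surely_For'[where \<tau> = "(3 + M * 36) + 7" and
        Q = "\<lambda>i s'. ?same s' \<and> rarr s' ''T'' 0 = (2 * G ^ M) ^ i"])
    fix i s' assume I: "?same s' \<and> rarr s' ''T'' 0 = (2 * G ^ M) ^ i"
    then have S: "?same s'" by blast
    show "surely (exec D d (Seq (For ''j'' (OfNat (NVar ''M''))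
          (Store ''T'' (NConst 0) (RMul (Cell ''T'' (NConst 0))
            (RMul (OfNat (NConst 288)) (RMul similarity_ratio similarity_ratio)))))
        (Store ''T'' (NConst 0) (RMul (OfNat (NConst 2)) (Cell ''T'' (NConst 0))))) (set_nreg ''i'' i s'))
      ((3 + M * 36) + 7) (\<lambda>s'. ?same s' \<and> rarr s' ''T'' 0 = (2 * G ^ M) ^ Suc i)"
    proof (rule surely_Seq)
      show "surely (exec D d (For ''j'' (OfNat (NVar ''M''))
          (Store ''T'' (NConst 0) (RMul (Cell ''T'' (NConst 0))
            (RMul (OfNat (NConst 288)) (RMul similarity_ratio similarity_ratio))))) (set_nreg ''i'' i s'))
        (3 + M * 36) (\<lambda>s'. ?same s' \<and> rarr s' ''T'' 0 = (2 * G ^ M) ^ i * G ^ M)"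
      proof (rule surely_For'[where \<tau> = 35 and
            Q = "\<lambda>m s'. ?same s' \<and> rarr s' ''T'' 0 = (2 * G ^ M) ^ i * G ^ m"])
        fix m s'' assume I: "?same s'' \<and> rarr s'' ''T'' 0 = (2 * G ^ M) ^ i * G ^ m"
        then have S': "?same s''" by blast
        show "surely (exec D d (Store ''T'' (NConst 0) (RMul (Cell ''T'' (NConst 0))
            (RMul (OfNat (NConst 288)) (RMul similarity_ratio similarity_ratio)))) (set_nreg ''j'' m s'')) 35
          (\<lambda>s'. ?same s' \<and> rarr s' ''T'' 0 = (2 * G ^ M) ^ i * G ^ Suc m)"
          by (rule surely_Store)
            (use I assms(2-4) in \<open>auto simp: similarity_ratio_def same_nreg[OF S'] same_rarr[OF S'] G_def power2_eq_square\<close>)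
      qed (use I assms(1) in \<open>auto simp: same_nreg[OF S]\<close>)
    next
      fix s'' assume "?same s'' \<and> rarr s'' ''T'' 0 = (2 * G ^ M) ^ i * G ^ M"
      then show "surely (exec D d (Store ''T'' (NConst 0) (RMul (OfNat (NConst 2)) (Cell ''T'' (NConst 0)))) s'') 7
        (\<lambda>s'. ?same s' \<and> rarr s' ''T'' 0 = (2 * G ^ M) ^ Suc i)"
        by (intro surely_Store) auto
    qed
  qed (use assms(2) in auto)
qed simp

definition trial_time :: "nat \<Rightarrow> nat \<Rightarrow> nat \<Rightarrow> nat \<Rightarrow> nat" where
  "trial_time n d k M = ((3 + n * 5) + (3 + k * (1 + ((3 + 11 * d) +
      ((3 + M * (34 + 30 * (n + k + 1) + 31 * d)) + (3 + n * (31 + d))))))) +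
    (33 + 8 * n + 9 * (k * d))"

lemma stored_input:
  assumes "set ps \<subseteq> Rspace d"
  shows "stored d (rarr (input_state d k \<mu> \<epsilon> ps) ''P'') ps"
  unfolding stored_def
proof (intro allI impI)
  fix m j assume "m < length ps" "j < d"
  with mult_add_less[OF this] show "rarr (input_state d k \<mu> \<epsilon> ps) ''P'' (m * d + j) = Poly_Mapping.lookup (ps ! m) j"
    by (simp add: input_state_def)
qed

lemma sim_kmedian:
  fixes L :: nat
  assumes X: "convex X" "X \<subseteq> Rspace d" and ps: "distinct ps" "set ps \<subseteq> X" "ps \<noteq> []"
    and D: "\<And>p q. p \<in> X \<Longrightarrow> q \<in> X \<Longrightarrow> 0 \<le> D p q" and k: "k > 0" and pos: "0 < \<mu>" "0 < \<epsilon>"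
  defines "M \<equiv> nat \<lceil>64 / (\<mu> * \<epsilon>)\<rceil>"
  defines "N \<equiv> nat \<lceil>real L * (2 * (288 * ((real k)\<^sup>2 / (\<mu> * \<epsilon>))\<^sup>2) ^ M) ^ k\<rceil>"
  shows "sim (exec D d (kmedian_com L) (input_state d k \<mu> \<epsilon> ps))
    ((9 + 5 * M) + ((7 + k * (11 + 36 * M)) + (6 + N * (1 + trial_time (length ps) d k M))))
    (search D ps M k N) (\<lambda>s b. b \<noteq> [] \<longrightarrow> stored d (rarr s ''C'') b)"
proof -
  define s0 where "s0 = input_state d k \<mu> \<epsilon> ps"
  have s0: "nreg s0 ''n'' = length ps" "nreg s0 ''d'' = d" "nreg s0 ''k'' = k" "nreg s0 ''M'' = 0"
    "rarr s0 ''mu'' 0 = \<mu>" "rarr s0 ''eps'' 0 = \<epsilon>" "rarr s0 ''B'' 0 = 0"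
    by (simp_all add: s0_def input_state_def)
  have st0: "stored d (rarr s0 ''P'') ps" unfolding s0_def using X ps by (intro stored_input) auto
  have R: "set ps \<subseteq> Rspace d" using ps X by auto
  have "0 < 64 / (\<mu> * \<epsilon>)" using pos by simp
  then have M: "M > 0" by (simp add: M_def)
  have cost: "0 \<le> cost D ps cs" if ne: "cs \<noteq> []" and sub: "set cs \<subseteq> X" for cs
    unfolding cost_def
  proof (rule sum_nonneg)
    fix p assume p: "p \<in> set ps"
    obtain c where "c \<in> set cs" "nearest D (set cs) p = D p c"
      using nearest_obtain[of "set cs" D p] ne by auto
    then show "0 \<le> nearest D (set cs) p" using D p ps sub by (auto simp: subset_iff)
  qed
  show ?thesis
    unfolding kmedian_com_def s0_def[symmetric]
  proof (rule sim_Seq_surely_left[OF surely_count_samples[OF s0(4-6), folded M_def]])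
    fix s1 assume *: "same {''x'', ''M''} {} s0 s1 \<and> nreg s1 ''M'' = M"
    then have S1: "same {''x'', ''M''} {} s0 s1" by blast
    show "sim (exec D d (Seq count_trials_com
        (For ''t'' (RMul (OfNat (NConst L)) (Cell ''T'' (NConst 0))) (Seq trial_com keep_best_com))) s1)
      ((7 + k * (11 + 36 * M)) + (6 + N * (1 + trial_time (length ps) d k M)))
      (search D ps M k N) (\<lambda>s b. b \<noteq> [] \<longrightarrow> stored d (rarr s ''C'') b)"
    proof (rule sim_Seq_surely_left[OF surely_count_trials[of s1 M k \<mu> \<epsilon>]])
      fix s2
      assume **: "same {''i'', ''j''} {''T''} s1 s2 \<and>
        rarr s2 ''T'' 0 = (2 * (288 * ((real k)\<^sup>2 / (\<mu> * \<epsilon>))\<^sup>2) ^ M) ^ k"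
      then have S2: "same {''i'', ''j''} {''T''} s1 s2" by blast
      let ?I = "\<lambda>s :: state. nreg s ''n'' = length ps \<and> nreg s ''d'' = d \<and> nreg s ''k'' = k \<and> nreg s ''M'' = M \<and>
        stored d (rarr s ''P'') ps"
      have I2: "?I s2" "rarr s2 ''B'' 0 = 0"
        using s0 st0 * by (auto simp: same_nreg[OF S1] same_nreg[OF S2] same_rarr[OF S1] same_rarr[OF S2])
      show "sim (exec D d (For ''t'' (RMul (OfNat (NConst L)) (Cell ''T'' (NConst 0)))
          (Seq trial_com keep_best_com)) s2) (6 + N * (1 + trial_time (length ps) d k M))
        (search D ps M k N) (\<lambda>s b. b \<noteq> [] \<longrightarrow> stored d (rarr s ''C'') b)"
        unfolding search_def
      \<comment> \<open>The invariant keeps \<open>set b \<subseteq> X\<close> because comparing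
        reciprocals requires nonnegative costs. At the start cell 0 of \<open>B\<close> is 0, the
        score of the empty list.\<close>
      proof (rule sim_For'[where \<tau> = "trial_time (length ps) d k M" and
            Q = "\<lambda>m s b. ?I s \<and> rarr s ''B'' 0 = score D ps b \<and> (b \<noteq> [] \<longrightarrow> stored d (rarr s ''C'') b) \<and>
              set b \<subseteq> X"])
        fix t s3 b
        assume I: "?I s3 \<and> rarr s3 ''B'' 0 = score D ps b \<and> (b \<noteq> [] \<longrightarrow> stored d (rarr s3 ''C'') b) \<and>
          set b \<subseteq> X"
        let ?b = "\<lambda>cs. if b = [] \<or> cost D ps cs < cost D ps b then cs else b"
        show "sim (exec D d (Seq trial_com keep_best_com) (set_nreg ''t'' t s3)) (trial_time (length ps) d k M)
          (map_pmf ?b (trial D ps M k))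
          (\<lambda>s b. ?I s \<and> rarr s ''B'' 0 = score D ps b \<and> (b \<noteq> [] \<longrightarrow> stored d (rarr s ''C'') b) \<and>
              set b \<subseteq> X)"
          unfolding trial_time_def
        proof (rule sim_map, rule sim_Seq_surely_right[OF sim_trial])
          fix s4 cs
          assume cs: "cs \<in> set_pmf (trial D ps M k)"
            and *: "same {''i'', ''m'', ''s'', ''p'', ''l'', ''j''} {''S'', ''P'', ''V'', ''W''}
              (set_nreg ''t'' t s3) s4 \<and> stored d (rarr s4 ''P'') (ps @ cs) \<and>
              (\<forall>p<length ps. rarr s4 ''W'' p = weight D cs (ps ! p))"
          then have S4: "same {''i'', ''m'', ''s'', ''p'', ''l'', ''j''} {''S'', ''P'', ''V'', ''W''}
              (set_nreg ''t'' t s3) s4" by blast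
          have csX: "length cs = k" "set cs \<subseteq> X" using set_pmf_trial[OF X(1) ps(2,3) M cs] by auto
          have "cs \<noteq> []" using csX k by auto
          then have "surely (exec D d keep_best_com s4) (33 + 8 * length ps + 9 * (k * d))
            (\<lambda>s'. same {''p'', ''j''} {''R'', ''B'', ''C''} s4 s' \<and>
              rarr s' ''B'' 0 = score D ps (?b cs) \<and> (?b cs \<noteq> [] \<longrightarrow> stored d (rarr s' ''C'') (?b cs)))"
            using I * csX cost ps k
            by (intro surely_keep_best) (auto simp: same_nreg[OF S4] same_rarr[OF S4])
          then show "surely (exec D d keep_best_com s4) (33 + 8 * length ps + 9 * (k * d))
            (\<lambda>s. ?I s \<and> rarr s ''B'' 0 = score D ps (?b cs) \<and>
              (?b cs \<noteq> [] \<longrightarrow> stored d (rarr s ''C'') (?b cs)) \<and> set (?b cs) \<subseteq> X)"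
          proof (rule surely_mono)
            fix s5
            assume ***: "same {''p'', ''j''} {''R'', ''B'', ''C''} s4 s5 \<and>
              rarr s5 ''B'' 0 = score D ps (?b cs) \<and> (?b cs \<noteq> [] \<longrightarrow> stored d (rarr s5 ''C'') (?b cs))"
            then have S5: "same {''p'', ''j''} {''R'', ''B'', ''C''} s4 s5" by blast
            have "stored d (rarr s5 ''P'') ps"
              using * stored_appendD[of d _ ps cs] by (simp add: same_rarr[OF S5])
            moreover have "set (?b cs) \<subseteq> X" using I csX by simp
            moreover have "nreg s5 ''n'' = length ps" "nreg s5 ''d'' = d" "nreg s5 ''k'' = k" "nreg s5 ''M'' = M"
              using I by (auto simp: same_nreg[OF S5] same_nreg[OF S4])
            ultimately show "?I s5 \<and> rarr s5 ''B'' 0 = score D ps (?b cs) \<and>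
              (?b cs \<noteq> [] \<longrightarrow> stored d (rarr s5 ''C'') (?b cs)) \<and> set (?b cs) \<subseteq> X" using *** by blast
          qed simp
        qed (use I ps M R in auto)
      next
        show "nat \<lceil>rval D d (RMul (OfNat (NConst L)) (Cell ''T'' (NConst 0))) s2\<rceil> = N"
          using ** by (simp add: N_def)
      qed (use I2 in \<open>auto simp: score_def\<close>)
    qed (use * s0 in \<open>auto simp: same_nreg[OF S1] same_rarr[OF S1]\<close>)
  qed
qed

section \<open>Optimal clusterings\<close>

text \<open>Among the finitely many assignments a cheapest one exists at once, which avoids asking
  whether some center set is optimal. It is at least as good as any \<open>C\<close>: assign each
  point to a nearest center, then replacing centers by the means of their classes does not raise the
  cost.\<close>

lemma (in similar_divergence) optimal_assignment:
  assumes P: "finite P" "P \<subseteq> X" and k: "k > 0"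
  obtains asg where "asg ` P \<subseteq> {..<k}"
    "\<And>C. C \<subseteq> X \<Longrightarrow> finite C \<Longrightarrow> C \<noteq> {} \<Longrightarrow> card C \<le> k \<Longrightarrow>
      (\<Sum>j<k. intra D {p \<in> P. asg p = j}) \<le> (\<Sum>p\<in>P. nearest D C p)"
proof -
  define F where "F = P \<rightarrow>\<^sub>E {..<k}"
  define f where "f asg = (\<Sum>j<k. intra D {p \<in> P. asg p = j})" for asg
  have "finite F" unfolding F_def using P by (intro finite_PiE) auto
  moreover have "F \<noteq> {}" unfolding F_def using k by (auto simp: PiE_eq_empty_iff lessThan_empty_iff)
  ultimately have "Min (f ` F) \<in> f ` F" by (intro Min_in) auto
  then obtain asg where asg: "asg \<in> F" "f asg = Min (f ` F)" by auto
  have "f asg \<le> (\<Sum>p\<in>P. nearest D C p)" if C: "C \<subseteq> X" "finite C" "C \<noteq> {}" "card C \<le> k" for C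
  proof -
    obtain h where h: "h ` C \<subseteq> {..<k}" "inj_on h C"
      using card_le_inj[of C "{..<k}"] C by auto
    define ct where "ct p = (SOME c. c \<in> C \<and> nearest D C p = D p c)" for p
    have ct: "ct p \<in> C" "nearest D C p = D p (ct p)" for p
      using someI_ex[of "\<lambda>c. c \<in> C \<and> nearest D C p = D p c"] nearest_obtain[OF C(2,3)]
      unfolding ct_def by metis+
    define a where "a = restrict (h \<circ> ct) P"
    have "h (ct p) < k" for p using h(1) ct(1)[of p] by auto
    then have aF: "a \<in> F" by (auto simp: F_def a_def)
    have "f asg \<le> f a" unfolding asg(2) using aF \<open>finite F\<close> by (intro Min_le) auto
    also have "\<dots> \<le> (\<Sum>j<k. \<Sum>p\<in>{p \<in> P. a p = j}. nearest D C p)"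
      unfolding f_def
    proof (rule sum_mono)
      fix j assume "j \<in> {..<k}"
      show "intra D {p \<in> P. a p = j} \<le> (\<Sum>p\<in>{p \<in> P. a p = j}. nearest D C p)"
      proof (cases "{p \<in> P. a p = j} = {}")
        case True
        show ?thesis unfolding True by (simp add: intra_def)
      next
        case False
        then obtain q where q: "q \<in> P" "a q = j" by auto
        \<comment> \<open>By injectivity of the numbering a class has one common nearest center,
          against which its mean is compared.\<close>
        have "ct p = ct q" if "p \<in> P" "a p = j" for p
          using that q ct inj_onD[OF h(2)] by (simp add: a_def)
        then have "(\<Sum>p\<in>{p \<in> P. a p = j}. nearest D C p) = (\<Sum>p\<in>{p \<in> P. a p = j}. D p (ct q))"
          by (intro sum.cong) (auto simp: ct(2))
        moreover have "intra D {p \<in> P. a p = j} \<le> (\<Sum>p\<in>{p \<in> P. a p = j}. D p (ct q))"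
          using P C ct by (intro intra_le) auto
        ultimately show ?thesis by simp
      qed
    qed
    also have "\<dots> = (\<Sum>p\<in>P. nearest D C p)"
      by (rule sum.group) (use P aF in \<open>auto simp: F_def\<close>)
    finally show ?thesis .
  qed
  moreover have "asg ` P \<subseteq> {..<k}" using asg(1) by (auto simp: F_def)
  ultimately show ?thesis using that unfolding f_def by blast
qed

section \<open>Bregman divergences as an instance of the abstract setting\<close>

definition bilinear_form :: "nat \<Rightarrow> (nat \<Rightarrow> nat \<Rightarrow> real) \<Rightarrow> rvec \<Rightarrow> rvec \<Rightarrow> real" where
  "bilinear_form d U x y =
     (\<Sum>i<d. \<Sum>j<d. Poly_Mapping.lookup x i * U i j * Poly_Mapping.lookup y j)"

lemma semi_inner_bilinear_form:
  assumes "sym_pos_def d U"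
  shows "semi_inner (bilinear_form d U)"
proof
  fix x y z :: rvec and r :: real
  show "bilinear_form d U (x + y) z = bilinear_form d U x z + bilinear_form d U y z"
    by (simp add: bilinear_form_def lookup_add algebra_simps sum.distrib)
  show "bilinear_form d U (r *\<^sub>R x) z = r * bilinear_form d U x z"
    by (simp add: bilinear_form_def sum_distrib_left mult.assoc)
  have "bilinear_form d U x y = (\<Sum>j<d. \<Sum>i<d. Poly_Mapping.lookup x i * U i j * Poly_Mapping.lookup y j)"
    unfolding bilinear_form_def by (rule sum.swap)
  also have "\<dots> = bilinear_form d U y x"
    unfolding bilinear_form_def using assms
    by (intro sum.cong refl) (auto simp: sym_pos_def_def mult_ac)
  finally show "bilinear_form d U x y = bilinear_form d U y x" .
  \<comment> \<open>\<open>U\<close> is positive definite on \<open>Rspace d\<close> only, so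
    \<open>x\<close> is cut down to its first \<open>d\<close> coordinates, which does not change
    the value of the form.\<close>
  let ?x = "vec_of d (Poly_Mapping.lookup x)"
  have "quad_form d U ?x \<ge> 0"
  proof (cases "?x = 0")
    case True
    then show ?thesis by (simp add: quad_form_def)
  next
    case False
    moreover have "?x \<in> Rspace d" by (simp add: Rspace_def lookup_vec_of)
    ultimately show ?thesis using assms by (simp add: sym_pos_def_def order_less_imp_le)
  qed
  also have "quad_form d U ?x = bilinear_form d U x x"
    by (simp add: quad_form_def bilinear_form_def lookup_vec_of)
  finally show "0 \<le> bilinear_form d U x x" .
qed

lemma dot_diff: "dot d x (y - z) = dot d x y - dot d x z"
  by (simp add: dot_def lookup_minus algebra_simps sum_subtractf)

lemma dot_scaleR: "dot d x (r *\<^sub>R y) = r * dot d x y"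
  by (simp add: dot_def sum_distrib_left mult_ac)

lemma dot_sum: "dot d x (\<Sum>p\<in>A. f p) = (\<Sum>p\<in>A. dot d x (f p))"
  unfolding dot_def by (simp add: lookup_sum sum_distrib_left) (rule sum.swap)

text \<open>The terms involving \<open>c\<close> see the points only through their number and their
  sum, so there the points may be replaced by copies of their mean; at the mean itself the linear
  terms cancel.\<close>

lemma sum_bregman:
  assumes "finite A" "A \<noteq> {}"
  shows "(\<Sum>p\<in>A. bregman d \<phi> g p c)
    = intra (bregman d \<phi> g) A + card A * bregman d \<phi> g (mean A) c"
proof -
  have n: "real (card A) > 0" using assms by (simp add: card_gt_0_iff)
  have m: "(\<Sum>p\<in>A. dot d x p) = card A * dot d x (mean A)" for x
    using n by (simp add: mean_def dot_scaleR dot_sum)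
  have e: "(\<Sum>p\<in>A. bregman d \<phi> g p c)
      = (\<Sum>p\<in>A. \<phi> p) - card A * \<phi> c - card A * dot d (g c) (mean A) + card A * dot d (g c) c" for c
    by (simp add: bregman_def dot_diff sum_subtractf m)
  show ?thesis
    unfolding intra_def e by (simp add: bregman_def dot_diff algebra_simps)
qed

lemma similar_divergence_bregman:
  assumes "bregman_generator d X \<phi> g" "sym_pos_def d U" "0 < \<mu>" "\<mu> \<le> 1"
    and U: "\<forall>p\<in>X. \<forall>q\<in>X. \<mu> * quad_form d U (p - q) \<le> bregman d \<phi> g p q \<and>
      bregman d \<phi> g p q \<le> quad_form d U (p - q)"
  shows "similar_divergence (bilinear_form d U) X (bregman d \<phi> g) \<mu>"
proof -
  interpret semi_inner "bilinear_form d U" using semi_inner_bilinear_form[OF assms(2)] .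
  have Q: "Q x = quad_form d U x" for x by (simp add: Q_def bilinear_form_def quad_form_def)
  show ?thesis
    by unfold_locales (use assms in \<open>auto simp: Q bregman_generator_def intro: sum_bregman\<close>)
qed

section \<open>Running time and success probability\<close>

lemma sim_time: "sim p \<tau> F Q \<Longrightarrow> (s, t) \<in> set_pmf p \<Longrightarrow> t \<le> \<tau>"
  unfolding sim_def using rel_pmf_imp_rel_set by (fastforce simp: rel_set_def)

text \<open>A coupling transfers probabilities: whenever the process succeeds, so does every run
  coupled with it.\<close>

lemma sim_prob:
  assumes "sim p \<tau> F Q" "\<And>s a. a \<in> set_pmf F \<Longrightarrow> Q s a \<Longrightarrow> G a \<Longrightarrow> H s"
  shows "measure_pmf.prob F {a. G a} \<le> measure_pmf.prob p {(s, t). H s}"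
proof -
  have "rel_pmf (\<lambda>a (s, t). a \<in> set_pmf F \<and> Q s a) F p"
    using sim_mono[OF assms(1) order_refl, of "\<lambda>s a. a \<in> set_pmf F \<and> Q s a"]
    unfolding sim_def by (subst pmf.rel_flip[symmetric]) (auto elim!: pmf.rel_mono_strong)
  then have "measure_pmf.prob F {a. G a}
      \<le> measure_pmf.prob p {y. \<exists>a\<in>{a. G a}. (case y of (s, t) \<Rightarrow> a \<in> set_pmf F \<and> Q s a)}"
    by (rule rel_pmf_measureD)
  also have "\<dots> \<le> measure_pmf.prob p {(s, t). H s}"
    using assms(2) by (intro measure_pmf.finite_measure_mono) auto
  finally show ?thesis .
qed

text \<open>The constant splits into 270 for each of the \<open>N\<close> trials and 74 for
  everything else.\<close>

lemma running_time_le: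
  assumes "n > 0" "d > 0" "k > 0" "M > 0" "N > 0"
  shows "(9 + 5 * M) + ((7 + k * (11 + 36 * M)) + (6 + N * (1 + trial_time n d k M)))
    \<le> 344 * (N * (n * d * (k * k) * M))"
proof -
  define Z where "Z = n * d * (k * k) * M"
  have Z: "Z > 0" using assms by (simp add: Z_def)
  \<comment> \<open>Every monomial of the time bound divides \<open>Z\<close>, hence is at most
    \<open>Z\<close>.\<close>
  have le: "a \<le> Z" if "a * b = Z" for a b
    using that Z by (cases b) auto
  have b: "n \<le> Z" "d \<le> Z" "k \<le> Z" "M \<le> Z" "k * d \<le> Z" "k * M \<le> Z" "k * (M * n) \<le> Z"
    "k * (M * k) \<le> Z" "k * (M * d) \<le> Z" "k * n \<le> Z" "k * (n * d) \<le> Z"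
    using le[of n "d * (k * k) * M"] le[of d "n * (k * k) * M"] le[of k "n * d * k * M"]
      le[of M "n * d * k * k"] le[of "k * d" "n * k * M"] le[of "k * M" "n * k * d"]
      le[of "k * (M * n)" "k * d"] le[of "k * (M * k)" "n * d"] le[of "k * (M * d)" "k * n"]
      le[of "k * n" "k * d * M"] le[of "k * (n * d)" "k * M"]
    by (simp_all add: Z_def mult_ac)
  have "trial_time n d k M \<le> 269 * Z"
  proof -
    have "trial_time n d k M = 39 + 13 * n + 10 * k + 20 * (k * d) + 64 * (k * M) + 30 * (k * (M * n))
      + 30 * (k * (M * k)) + 31 * (k * (M * d)) + 31 * (k * n) + k * (n * d)"
      by (simp add: trial_time_def algebra_simps)
    with b Z show ?thesis by linarith
  qed
  then have "1 + trial_time n d k M \<le> 270 * Z" using Z by simp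
  then have "N * (1 + trial_time n d k M) \<le> N * (270 * Z)" by (rule mult_left_mono) simp
  moreover have "9 + 5 * M + 7 + k * (11 + 36 * M) + 6 \<le> 74 * Z"
  proof -
    have "k * (11 + 36 * M) = 11 * k + 36 * (k * M)" by (simp add: algebra_simps)
    with b Z show ?thesis by linarith
  qed
  moreover have "74 * Z \<le> 74 * (N * Z)" using assms(5) by simp
  moreover have "N * (270 * Z) = 270 * (N * Z)" by simp
  ultimately show ?thesis unfolding Z_def[symmetric] by linarith
qed

text \<open>Since 1 - u is at most exp(-u), the failure probability is at most exp(-N/T), hence at
  most exp(-L).\<close>

lemma trials_suffice:
  assumes T: "1 \<le> (T :: real)" and N: "L * T \<le> real N" and L: "ln (1 / \<delta>) \<le> L" and \<delta>: "0 < \<delta>"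
  shows "(1 - 1 / T) ^ N \<le> \<delta>"
proof -
  have "(1 - 1 / T) ^ N \<le> exp (- 1 / T) ^ N"
    using T exp_ge_add_one_self[of "- 1 / T"] by (intro power_mono) auto
  also have "\<dots> = exp (- (real N / T))" by (simp add: exp_of_nat_mult[symmetric])
  also have "\<dots> \<le> exp (- L)" using N T by (simp add: field_simps)
  also have "\<dots> \<le> exp (- ln (1 / \<delta>))" using L by simp
  also have "\<dots> = \<delta>" using \<delta> by (simp add: ln_div)
  finally show ?thesis .
qed

text \<open>The binary logarithm of \<open>T\<close> is k + k M log(288 x^2). Here k M is at most 65
  x and log(288 x^2) at most 11 log x, so the exponent is O(x log x), which also absorbs the
  polynomial factors of the running time.\<close>

lemma exponential_bound:
  fixes k M L :: nat and y :: real
  assumes y: "2 \<le> y" and k: "k \<ge> 1" and L: "L \<ge> 1"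
  defines "x \<equiv> (real k)\<^sup>2 * y" and "M \<equiv> nat \<lceil>64 * y\<rceil>"
  defines "T \<equiv> (2 * (288 * x\<^sup>2) ^ M) ^ k"
  shows "1 \<le> T" "0 < nat \<lceil>real L * T\<rceil>"
    "344 * (real (nat \<lceil>real L * T\<rceil>) * ((real k)\<^sup>2 * real M))
      \<le> 44720 * real L * 2 powr (718 * x * log 2 x)"
proof -
  have k2: "1 \<le> (real k)\<^sup>2" "real k \<le> (real k)\<^sup>2" using k self_le_power[of "real k" 2] by auto
  have "1 * 2 \<le> (real k)\<^sup>2 * y" using y k2 by (intro mult_mono) auto
  then have x: "2 \<le> x" by (simp add: x_def)
  define l where "l = log 2 x"
  have l: "1 \<le> l" using x by (simp add: l_def)
  have xl: "x = 2 powr l" using x by (simp add: l_def)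
  \<comment> \<open>Rounding up adds less than 1, which the additional \<open>y\<close>
    covers.\<close>
  have M: "real M \<le> 65 * y" using y unfolding M_def by linarith
  have kx: "(real k)\<^sup>2 \<le> x" using mult_left_mono[of 1 y "(real k)\<^sup>2"] y by (simp add: x_def)
  have Mx: "real M \<le> 65 * x"
  proof -
    have "1 * y \<le> (real k)\<^sup>2 * y" using k2(1) y by (intro mult_right_mono) auto
    with M show ?thesis unfolding x_def by linarith
  qed
  have Mkx: "real (M * k) \<le> 65 * x"
  proof -
    have "real M * real k \<le> 65 * y * (real k)\<^sup>2" using M k2 y by (intro mult_mono) auto
    then show ?thesis by (simp add: x_def mult_ac)
  qed
  have "1 * 1 \<le> x * x" using x by (intro mult_mono) auto
  then have G: "1 \<le> 288 * x\<^sup>2" by (simp add: power2_eq_square)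
  \<comment> \<open>288 is below \<open>2 powr 9\<close>, and \<open>1 \<le> l\<close> turns the 9
    into \<open>9 * l\<close>.\<close>
  have G2: "288 * x\<^sup>2 \<le> 2 powr (11 * l)"
  proof -
    have "288 * x\<^sup>2 \<le> 2 powr 9 * 2 powr (2 * l)"
      unfolding xl by (simp add: powr_realpow[symmetric] powr_powr mult.commute powr_numeral)
    also have "\<dots> = 2 powr (9 + 2 * l)" by (simp add: powr_add)
    also have "\<dots> \<le> 2 powr (11 * l)" using l by (intro powr_mono) auto
    finally show ?thesis .
  qed
  have T: "T = 2 ^ k * (288 * x\<^sup>2) ^ (M * k)" by (simp add: T_def power_mult_distrib power_mult)
  have "1 \<le> 2 * (288 * x\<^sup>2) ^ M" using one_le_power[OF G, of M] by linarith
  then show T1: "1 \<le> T" unfolding T_def by (rule one_le_power)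
  have LT: "1 \<le> real L * T" using L T1 mult_mono[of 1 "real L" 1 T] by simp
  then show "0 < nat \<lceil>real L * T\<rceil>" by linarith
  have N: "real (nat \<lceil>real L * T\<rceil>) \<le> 2 * (real L * T)" using LT by linarith
  have "T \<le> 2 powr x * 2 powr (715 * (l * x))"
    unfolding T
  proof (rule mult_mono)
    show "2 ^ k \<le> 2 powr x" using order_trans[OF k2(2) kx] by (simp add: powr_realpow[symmetric])
    have "(288 * x\<^sup>2) ^ (M * k) \<le> (2 powr (11 * l)) ^ (M * k)" using G G2 by (intro power_mono) auto
    also have "\<dots> = 2 powr (11 * l * real (M * k))" by (simp add: powr_realpow[symmetric] powr_powr)
    also have "\<dots> \<le> 2 powr (11 * l * (65 * x))" using Mkx l by (intro powr_mono mult_left_mono) auto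
    finally show "(288 * x\<^sup>2) ^ (M * k) \<le> 2 powr (715 * (l * x))" by (simp add: mult_ac)
  qed (use G in auto)
  also have "\<dots> = 2 powr (x + 715 * (l * x))" by (simp add: powr_add)
  finally have T2: "T \<le> 2 powr (x + 715 * (l * x))" .
  have "x\<^sup>2 * T \<le> 2 powr (2 * l) * 2 powr (x + 715 * (l * x))"
  proof (rule mult_mono[OF _ T2])
    show "x\<^sup>2 \<le> 2 powr (2 * l)" unfolding xl by (simp add: powr_realpow[symmetric] powr_powr mult.commute powr_numeral)
  qed (use T1 in auto)
  also have "2 powr (2 * l) * 2 powr (x + 715 * (l * x)) = 2 powr (2 * l + x + 715 * (l * x))"
    by (simp add: powr_add)
  \<comment> \<open>Here 715 = 11 * 65, and a further \<open>3 * (x * l)\<close> makes room for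
    \<open>2 * l\<close> and \<open>x\<close>.\<close>
  also have "\<dots> \<le> 2 powr (718 * x * l)"
  proof (rule powr_mono)
    have "2 * l \<le> x * l" using x l by (intro mult_right_mono) auto
    moreover have "x * 1 \<le> x * l" using x l by (intro mult_left_mono) auto
    moreover have "718 * x * l = 715 * (l * x) + 3 * (x * l)" by simp
    ultimately show "2 * l + x + 715 * (l * x) \<le> 718 * x * l" using l by linarith
  qed simp
  finally have key: "x\<^sup>2 * T \<le> 2 powr (718 * x * l)" .
  \<comment> \<open>The constant is 44720 = 344 * 2 * 65: the factor 2 comes from rounding the
    number of trials, the 65 from \<open>M\<close>.\<close>
  have "344 * (real (nat \<lceil>real L * T\<rceil>) * ((real k)\<^sup>2 * real M))
      \<le> 344 * (2 * (real L * T) * (x * (65 * x)))"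
    using N kx Mx T1 x by (intro mult_left_mono mult_mono) auto
  also have "\<dots> = 44720 * real L * (x\<^sup>2 * T)" by (simp add: power2_eq_square)
  also have "\<dots> \<le> 44720 * real L * 2 powr (718 * x * l)"
    using key by (intro mult_left_mono) auto
  finally show "344 * (real (nat \<lceil>real L * T\<rceil>) * ((real k)\<^sup>2 * real M))
      \<le> 44720 * real L * 2 powr (718 * x * log 2 x)"
    by (simp only: l_def)
qed

lemma kmedian_com_correct:
  fixes L n d k :: nat and X :: "rvec set"
  assumes pos: "d \<ge> 1" "k \<ge> 1" "0 < \<mu>" "\<mu> \<le> 1" "0 < \<epsilon>" "\<epsilon> \<le> 1 / 2"
    and \<phi>: "bregman_generator d X \<phi> g" "mu_similar d \<mu> X (bregman d \<phi> g)"
    and ps: "set ps \<subseteq> X" "distinct ps" "ps \<noteq> []"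
    and L: "L \<ge> 1" "ln (1 / \<delta>) \<le> real L" and \<delta>: "0 < \<delta>"
  defines "D \<equiv> bregman d \<phi> g" and "x \<equiv> (real k)\<^sup>2 / (\<mu> * \<epsilon>)"
  defines "run \<equiv> exec D d (kmedian_com L) (input_state d k \<mu> \<epsilon> ps)"
  shows "(s, t) \<in> set_pmf run \<Longrightarrow>
      real t \<le> 44720 * real L * (real (length ps) * real d) * 2 powr (718 * x * log 2 x)"
    and "1 - \<delta> \<le> measure_pmf.prob run {(s, t). kmedian_approx D X k \<epsilon> (set ps) (output_centers d k s)}"
proof -
  obtain U where U: "sym_pos_def d U" "\<forall>p\<in>X. \<forall>q\<in>X. \<mu> * quad_form d U (p - q) \<le> D p q \<and> D p q \<le> quad_form d U (p - q)"
    using \<phi>(2) by (auto simp: mu_similar_def D_def)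
  interpret sd: similar_divergence "bilinear_form d U" X D \<mu>
    using similar_divergence_bregman[OF \<phi>(1) U(1) pos(3,4)] U(2) by (simp add: D_def)
  have XR: "X \<subseteq> Rspace d" using \<phi>(1) by (simp add: bregman_generator_def)
  obtain asg where asg: "asg ` set ps \<subseteq> {..<k}"
    "\<And>C. C \<subseteq> X \<Longrightarrow> finite C \<Longrightarrow> C \<noteq> {} \<Longrightarrow> card C \<le> k \<Longrightarrow>
      (\<Sum>j<k. intra D {p \<in> set ps. asg p = j}) \<le> (\<Sum>p\<in>set ps. nearest D C p)"
    by (rule sd.optimal_assignment[of "set ps" k]) (use ps(1) pos(2) in auto)
  define y where "y = 1 / (\<mu> * \<epsilon>)"
  have "\<mu> * \<epsilon> \<le> 1 * (1 / 2)" using pos by (intro mult_mono) auto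
  moreover have \<mu>\<epsilon>: "0 < \<mu> * \<epsilon>" using pos by simp
  ultimately have y: "2 \<le> y" by (simp add: y_def field_simps)
  have xy: "x = (real k)\<^sup>2 * y" by (simp add: x_def y_def)
  define M where "M = nat \<lceil>64 / (\<mu> * \<epsilon>)\<rceil>"
  define T where "T = (2 * (288 * x\<^sup>2) ^ M) ^ k"
  define N where "N = nat \<lceil>real L * T\<rceil>"
  have My: "M = nat \<lceil>64 * y\<rceil>" by (simp add: M_def y_def)
  note bounds = exponential_bound[OF y pos(2) L(1), folded xy My, folded T_def, folded N_def]
  \<comment> \<open>Smaller than the locale allows by a factor \<open>k\<^sup>2\<close>, so that all
    bounds depend on \<open>x\<close> alone. The program computes \<open>T\<close> from the same
    expression, which makes \<open>1 / T\<close> the success bound of a trial.\<close>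
  define \<gamma> where "\<gamma> = 1 / (288 * x\<^sup>2)"
  have x0: "x > 0" using pos by (simp add: x_def)
  interpret km: kmedian_instance "bilinear_form d U" X D \<mu> ps k M \<epsilon> \<gamma> asg
  proof
    show "64 / (\<mu> * \<epsilon>) \<le> real M" unfolding M_def by linarith
    show "0 < \<gamma>" using x0 by (simp add: \<gamma>_def)
    have "\<gamma> = (\<mu> * \<epsilon>)\<^sup>2 / (288 * (real k)\<^sup>2 * (real k)\<^sup>2)"
      using pos by (simp add: \<gamma>_def x_def power2_eq_square)
    also have "\<dots> \<le> (\<mu> * \<epsilon>)\<^sup>2 / (288 * (real k)\<^sup>2 * 1)"
      using pos by (intro divide_left_mono mult_left_mono) auto
    finally show "\<gamma> \<le> \<epsilon>\<^sup>2 * \<mu>\<^sup>2 / (288 * (real k)\<^sup>2)"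
      by (simp add: power_mult_distrib mult.commute)
  qed (use ps pos asg(1) in auto)
  have sim: "sim run
    ((9 + 5 * M) + ((7 + k * (11 + 36 * M)) + (6 + N * (1 + trial_time (length ps) d k M))))
    (search D ps M k N) (\<lambda>s b. b \<noteq> [] \<longrightarrow> stored d (rarr s ''C'') b)"
    unfolding run_def M_def N_def T_def x_def
    using sd.convex_X XR ps sd.D_nonneg pos by (intro sim_kmedian) auto
  show "real t \<le> 44720 * real L * (real (length ps) * real d) * 2 powr (718 * x * log 2 x)"
    if st: "(s, t) \<in> set_pmf run"
  proof -
    have "t \<le> 344 * (N * (length ps * d * (k * k) * M))"
      using sim_time[OF sim st] running_time_le[of "length ps" d k M N] ps(3) pos km.M_pos bounds(2)
      by (auto simp: Suc_le_eq)
    then have "real t \<le> real (344 * (N * (length ps * d * (k * k) * M)))" by (simp only: of_nat_le_iff)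
    also have "\<dots> = (real (length ps) * real d) * (344 * (real N * ((real k)\<^sup>2 * real M)))"
      by (simp add: power2_eq_square)
    also have "\<dots> \<le> (real (length ps) * real d) * (44720 * real L * 2 powr (718 * x * log 2 x))"
      using bounds(3) by (intro mult_left_mono) auto
    finally show ?thesis by (simp add: mult_ac)
  qed
  have good: "kmedian_approx D X k \<epsilon> (set ps) (output_centers d k s)"
    if b: "b \<in> set_pmf (search D ps M k N)" and st: "b \<noteq> [] \<longrightarrow> stored d (rarr s ''C'') b"
      and good: "km.good b" for s b
  proof -
    have bX: "set b \<subseteq> X" "length b = k" "b \<noteq> []"
      using set_pmf_search[OF sd.convex_X ps(1,3) km.M_pos _ b] pos good bounds(2)
      by (auto simp: km.good_def split: if_splits)
    have "vec_at d s ''C'' (i * d) = b ! i" if "i < k" for i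
    proof (rule vec_at_stored)
      show i: "i < length b" using that bX(2) by simp
      show "b ! i \<in> Rspace d" using nth_mem[OF i] bX(1) XR by blast
    qed (use st bX(3) in simp)
    then have "output_centers d k s = (!) b ` {..<k}" unfolding output_centers_def by (intro image_cong) auto
    also have "\<dots> = set b" using bX(2) by (auto simp: set_conv_nth)
    finally have out: "output_centers d k s = set b" .
    have "set b \<in> center_sets X k" using bX card_length[of b] by (simp add: center_sets_def)
    \<comment> \<open>The optimum is an infimum that need not be known to be attained, so each
      center set is bounded from below separately; the choice of \<open>asg\<close> provides the
      bound.\<close>
    moreover have "km.opt \<le> kmedian_opt D X k (set ps)"
      unfolding kmedian_opt_def
    proof (rule cINF_greatest)
      show "center_sets X k \<noteq> {}" using \<open>set b \<in> center_sets X k\<close> by blast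
      show "km.opt \<le> kmedian_cost D (set ps) C" if "C \<in> center_sets X k" for C
        using asg(2)[of C] that
        by (simp add: center_sets_def kmedian_cost_def nearest_def km.opt_def km.cl_def)
    qed
    then have "(1 + \<epsilon>) * km.opt \<le> (1 + \<epsilon>) * kmedian_opt D X k (set ps)"
      using pos by (intro mult_left_mono) auto
    moreover have "kmedian_cost D (set ps) (set b) \<le> (1 + \<epsilon>) * km.opt"
      using good by (simp add: km.good_def cost_def kmedian_cost_def nearest_def)
    ultimately show ?thesis unfolding kmedian_approx_def out by linarith
  qed
  have "(\<gamma> ^ M / 2) ^ k = 1 / T"
    by (simp add: \<gamma>_def T_def power_divide power_mult_distrib mult.commute)
  then have "1 - (1 - 1 / T) ^ N \<le> measure_pmf.prob (search D ps M k N) {b. km.good b}"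
    using km.search_success[of N] by simp
  also have "\<dots> \<le> measure_pmf.prob run {(s, t). kmedian_approx D X k \<epsilon> (set ps) (output_centers d k s)}"
    by (rule sim_prob[OF sim]) (rule good)
  finally show "1 - \<delta> \<le> measure_pmf.prob run {(s, t). kmedian_approx D X k \<epsilon> (set ps) (output_centers d k s)}"
    using trials_suffice[OF bounds(1) _ L(2) \<delta>, of N] by (simp add: N_def) linarith
qed

theorem theorem5:
  fixes \<delta> :: real
  assumes "0 < \<delta>" and "\<delta> < 1"
  shows "\<exists>(alg :: com) (K :: real) (a :: real) (b :: nat).
    \<forall>(d :: nat) (k :: nat) (\<mu> :: real) (\<epsilon> :: real) (X :: rvec set) (\<phi> :: rvec \<Rightarrow> real)
      (g :: rvec \<Rightarrow> rvec) (P :: rvec set) (n :: nat) (ps :: rvec list).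
      d \<ge> 1 \<and> k \<ge> 1 \<and> n \<ge> 1 \<and> 0 < \<mu> \<and> \<mu> \<le> 1 \<and> 0 < \<epsilon> \<and> \<epsilon> \<le> 1 / 2 \<and>
      bregman_generator d X \<phi> g \<and> mu_similar d \<mu> X (bregman d \<phi> g) \<and>
      P \<subseteq> X \<and> card P = n \<and> set ps = P \<and> distinct ps
      \<longrightarrow>
      (let D = bregman d \<phi> g;
           run = exec D d alg (input_state d k \<mu> \<epsilon> ps);
           x = (real k)\<^sup>2 / (\<mu> * \<epsilon>)
       in (\<forall>(s, t) \<in> set_pmf run.
             real t \<le> K * (real n * real d) * 2 powr (a * x * (log 2 x) ^ b)) \<and>
          measure_pmf.prob run {(s, t). kmedian_approx D X k \<epsilon> P (output_centers d k s)}
            \<ge> 1 - \<delta>)"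
proof -
  \<comment> \<open>\<open>L\<close> is fixed before the instance, so that the program and the
    constant \<open>K\<close> depend on \<open>\<delta>\<close> alone.\<close>
  obtain L :: nat where L: "max 1 (ln (1 / \<delta>)) \<le> real L" using real_arch_simple by blast
  have L1: "L \<ge> 1" "ln (1 / \<delta>) \<le> real L" using L by auto
  show ?thesis
  proof (rule exI[of _ "kmedian_com L"], rule exI[of _ "44720 * real L"], rule exI[of _ "718 :: real"],
      rule exI[of _ "1 :: nat"], intro allI impI, unfold Let_def, intro conjI)
    fix d k :: nat and \<mu> \<epsilon> :: real and X :: "rvec set" and \<phi> :: "rvec \<Rightarrow> real" and g :: "rvec \<Rightarrow> rvec"
      and P :: "rvec set" and n :: nat and ps :: "rvec list"
    assume *: "d \<ge> 1 \<and> k \<ge> 1 \<and> n \<ge> 1 \<and> 0 < \<mu> \<and> \<mu> \<le> 1 \<and> 0 < \<epsilon> \<and> \<epsilon> \<le> 1 / 2 \<and>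
      bregman_generator d X \<phi> g \<and> mu_similar d \<mu> X (bregman d \<phi> g) \<and>
      P \<subseteq> X \<and> card P = n \<and> set ps = P \<and> distinct ps"
    have n: "length ps = n" "ps \<noteq> []" using * distinct_card[of ps] by auto
    note correct = kmedian_com_correct[of d k \<mu> \<epsilon> X \<phi> g ps L \<delta>]
    show "\<forall>(s, t)\<in>set_pmf (exec (bregman d \<phi> g) d (kmedian_com L) (input_state d k \<mu> \<epsilon> ps)).
      real t \<le> 44720 * real L * (real n * real d) *
        2 powr (718 * ((real k)\<^sup>2 / (\<mu> * \<epsilon>)) * (log 2 ((real k)\<^sup>2 / (\<mu> * \<epsilon>))) ^ 1)"
      using correct(1) * n L1 assms by auto
    show "1 - \<delta> \<le> measure_pmf.prob (exec (bregman d \<phi> g) d (kmedian_com L) (input_state d k \<mu> \<epsilon> ps))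
      {(s, t). kmedian_approx (bregman d \<phi> g) X k \<epsilon> P (output_centers d k s)}"
      using correct(2) * n L1 assms by auto
  qed
qed

end
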